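(* Let $M$ be a smooth $n$-manifold, let $A\subset TM\setminus\mathbf 0$ be an open conic subset with $\pi(A)=M$, and let $\overset{o}{\nu}$ be a homogeneous nonlinear connection on $A\to M$. For linear connections $\nabla^*$ on $\mathcal VA\to A$, let $H_{ij}^a,V_{ij}^a$ denote the Christoffel symbols of $\nabla^*$ with respect to $\overset{o}{\nu}$. Then the map $$\{\text{vertically trivial linear connections }\nabla^*\text{ on }\mathcal VA\to A\}\longrightarrow\{A\text{-anisotropic connections }\nabla\}$$ defined in natural coordinates by sending $\nabla^*\equiv(H_{ij}^a,\,V_{ij}^a=0)$ to the anisotropic connection with Christoffel symbols $\Gamma_{ij}^a=H_{ij}^a$ is well defined and bijective, and it maps (also bijectively) the set of vertically trivial connections $\nabla^*$ that are invariant by homotheties onto the set of homogeneous $A$-anisotropic connections. Moreover, this map does not depend on the chosen $\overset{o}{\nu}$. So, there exists a natural identification between vertically trivial linear connections on $\mathcal VA\to A$ and $A$-anisotropic connections, preserving the property of invariance by homotheties.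
   Context: All objects are smooth; repeated indices are summed. $\pi:TM\to M$ is the projection, $\pi_A=\pi|_A$; conic means invariant under $v\mapsto\lambda v$, $\lambda>0$. $(x,y)$ are the natural coordinates on $TU$ induced by a chart $(U,x)$ of $M$. **Anisotropic vector fields.** $\mathcal T^1_0(M_A)$ denotes the sections over $A$ of $\pi_A^*(TM)$. These are identified with sections of the vertical bundle $\mathcal VA=\ker T\pi_A\to A$ via $Z^i(x,y)\partial_{x^i}|_x\leftrightarrow Z^i(x,y)\partial_{y^i}|_{(x,y)}$. **Anisotropic connection.** An $A$-anisotropic connection is a map $\nabla:\mathfrak X(M)\times\mathfrak X(M)\to\mathcal T^1_0(M_A)$ that is additive in both entries, with $\nabla_X(fY)=(X(f)Y)\circ\pi_A+(f\circ\pi_A)\nabla_XY$ and $\nabla_{fX+hY}Z=(f\circ\pi_A)\nabla_XZ+(h\circ\pi_A)\nabla_YZ$ for $f,h\in\mathcal F(M)$. Its Christoffel symbols are the functions on $A\cap TU$ with $(\nabla_{\partial_i}\partial_j)_v=\Gamma^a_{ij}(v)\,\partial_a|_{\pi(v)}$. It is homogeneous if $(\nabla_XY)_{\lambda v}=(\nabla_XY)_v$ for all $X,Y$, $v\in A$, $\lambda>0$. **Nonlinear connection on $A\to M$.** A smooth distribution $\overset{o}{\mathcal H}A$ with $TA=\overset{o}{\mathcal H}A\oplus\mathcal VA$; its components $\overset{o}{N}{}_i^a$ are given by $\overset{o}{\mathcal H}_{(x,y)}A=\mathrm{Span}_i\{\delta_i|_{(x,y)}\}$, $\delta_i=\partial_{x^i}-\overset{o}{N}{}_i^a(x,y)\partial_{y^a}$.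 It is homogeneous if invariant under $h_\lambda:A\to A$, $h_\lambda(v)=\lambda v$ ($\lambda>0$), i.e. $\overset{o}{N}{}_i^a(x,\lambda y)=\lambda\overset{o}{N}{}_i^a(x,y)$. **Linear connections on $\mathcal VA\to A$.** A linear connection on the vector bundle $\mathcal VA\to A$ is identified with its Koszul derivative $\nabla^*:\mathfrak X(A)\times\mathcal T^1_0(M_A)\to\mathcal T^1_0(M_A)$. Its Christoffel symbols with respect to $\overset{o}{\nu}$ are the functions on $A\cap TU$ with $\nabla^*_{\delta_i}\partial_j=H^a_{ij}\partial_a$ and $\nabla^*_{\partial_{y^i}}\partial_j=V^a_{ij}\partial_a$. $\nabla^*$ is vertically trivial if $V_{ij}^a=0$ everywhere (this condition does not depend on the coordinates nor on $\overset{o}{\nu}$). **Invariance by homotheties.** Let $h_{\lambda*}:\mathcal VA\to\mathcal VA$ be the restriction of $Th_\lambda$, i.e. $(x,y,z)\mapsto(x,\lambda y,\lambda z)$ where $(x,y,z)$ stands for $z^a\partial_{y^a}|_{(x,y)}$. The linear connection is invariant by homotheties if its horizontal distribution $\mathcal H\subset T(\mathcal VA)$ satisfies $(Th_{\lambda*})_{(x,y,z)}(\mathcal H_{(x,y,z)})=\mathcal H_{(x,\lambda y,\lambda z)}$ for all $\lambda>0$. Equivalently, for every section $Z^{\mathcal V}$ of $\mathcal VA\to A$ with $Z^{\mathcal V}\circ h_\lambda=\lambda^{-1}h_{\lambda*}\circ Z^{\mathcal V}$ for all $\lambda>0$ and every $W_{(x,y)}\in T_{(x,y)}A$, $\nabla^*_{(Th_\lambda)_{(x,y)}(W_{(x,y)})}Z^{\mathcal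 V}=\lambda^{-1}(Th_\lambda)_{(x,y)}(\nabla^*_{W_{(x,y)}}Z^{\mathcal V})$ for all $\lambda>0$. *)

theory Defs
  imports "HOL-Analysis.Analysis"
begin

section \<open>Smooth functions on open sets\<close>

primrec Ck_on :: "nat \<Rightarrow> 'a::real_normed_vector set \<Rightarrow> ('a \<Rightarrow> 'b::real_normed_vector) \<Rightarrow> bool" where
  "Ck_on 0 S f \<longleftrightarrow> continuous_on S f"
| "Ck_on (Suc k) S f \<longleftrightarrow> (\<forall>x\<in>S. f differentiable (at x)) \<and>
     (\<forall>e. Ck_on k S (\<lambda>x. frechet_derivative f (at x) e))"

text \<open>Used only for open sets \<open>S\<close> of finite-dimensional spaces, where it is the usual \<open>C\<^sup>\<infinity>\<close>.\<close>
definition smooth_on :: "'a::real_normed_vector set \<Rightarrow> ('a \<Rightarrow> 'b::real_normed_vector) \<Rightarrow> bool" where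
  "smooth_on S f \<longleftrightarrow> (\<forall>k. Ck_on k S f)"


section \<open>Smooth manifolds\<close>

text \<open>A chart is a domain together with a coordinate map, whose values off the domain are
  irrelevant. A manifold is given by an atlas: its points are those covered by the charts, and its
  topology is the one for which the charts are homeomorphisms onto open sets. The atlas need not
  be maximal.\<close>

type_synonym ('p, 'e) chart = "'p set \<times> ('p \<Rightarrow> 'e)"

definition chart_inv :: "('p, 'e) chart \<Rightarrow> 'e \<Rightarrow> 'p" where
  "chart_inv c = inv_into (fst c) (snd c)"

definition transition :: "('p, 'e) chart \<Rightarrow> ('p, 'e) chart \<Rightarrow> 'e \<Rightarrow> 'e" where
  "transition c d = snd d \<circ> chart_inv c"

definition points :: "('p, 'e) chart set \<Rightarrow> 'p set" where
  "points \<A> = (\<Union>c\<in>\<A>. fst c)"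

definition atlas_topology :: "('p, 'e::topological_space) chart set \<Rightarrow> 'p topology" where
  "atlas_topology \<A> =
     topology (\<lambda>S. S \<subseteq> points \<A> \<and> (\<forall>c\<in>\<A>. open (snd c ` (S \<inter> fst c))))"

lemma openin_atlas_topology:
  assumes "\<And>c. c \<in> \<A> \<Longrightarrow> inj_on (snd c) (fst c)"
    and "\<And>c d. c \<in> \<A> \<Longrightarrow> d \<in> \<A> \<Longrightarrow> open (snd c ` (fst c \<inter> fst d))"
  shows "openin (atlas_topology \<A>) S \<longleftrightarrow>
           S \<subseteq> points \<A> \<and> (\<forall>c\<in>\<A>. open (snd c ` (S \<inter> fst c)))"
    and "topspace (atlas_topology \<A>) = points \<A>"
proof -
  have "istopology (\<lambda>S. S \<subseteq> points \<A> \<and> (\<forall>c\<in>\<A>. open (snd c ` (S \<inter> fst c))))"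
    unfolding istopology_def
  proof (rule conjI; clarify)
    fix S T
    assume S: "S \<subseteq> points \<A>" "\<forall>c\<in>\<A>. open (snd c ` (S \<inter> fst c))"
      and T: "T \<subseteq> points \<A>" "\<forall>c\<in>\<A>. open (snd c ` (T \<inter> fst c))"
    have "open (snd c ` (S \<inter> T \<inter> fst c))" if c: "c \<in> \<A>" for c
    proof -
      have "S \<inter> T \<inter> fst c = (S \<inter> fst c) \<inter> (T \<inter> fst c)" by blast
      moreover have "snd c ` ((S \<inter> fst c) \<inter> (T \<inter> fst c)) =
            snd c ` (S \<inter> fst c) \<inter> snd c ` (T \<inter> fst c)"
        by (rule inj_on_image_Int[OF assms(1)[OF c]]) auto
      ultimately show ?thesis using S T c by (simp only: open_Int)
    qed
    then show "S \<inter> T \<subseteq> points \<A> \<and> (\<forall>c\<in>\<A>. open (snd c ` (S \<inter> T \<inter> fst c)))"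
      using S by blast
  next
    fix K
    assume K: "\<forall>S\<in>K. S \<subseteq> points \<A> \<and> (\<forall>c\<in>\<A>. open (snd c ` (S \<inter> fst c)))"
    have "snd c ` (\<Union>K \<inter> fst c) = (\<Union>S\<in>K. snd c ` (S \<inter> fst c))" for c :: "('a, 'b) chart"
      by blast
    with K show "\<Union>K \<subseteq> points \<A> \<and> (\<forall>c\<in>\<A>. open (snd c ` (\<Union>K \<inter> fst c)))"
      by (simp only: open_UN) blast
  qed
  then show *: "openin (atlas_topology \<A>) S \<longleftrightarrow>
      S \<subseteq> points \<A> \<and> (\<forall>c\<in>\<A>. open (snd c ` (S \<inter> fst c)))" for S
    unfolding atlas_topology_def by (simp only: topology_inverse')
  have "snd c ` (points \<A> \<inter> fst c) = (\<Union>d\<in>\<A>. snd c ` (fst c \<inter> fst d))" for c :: "('a, 'b) chart"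
    unfolding points_def by blast
  then have "openin (atlas_topology \<A>) (points \<A>)"
    unfolding * using assms(2) by (auto intro: open_UN)
  then show "topspace (atlas_topology \<A>) = points \<A>"
    unfolding topspace_def using * by blast
qed

definition smooth_manifold :: "('p, 'e::euclidean_space) chart set \<Rightarrow> bool" where
  "smooth_manifold \<A> \<longleftrightarrow>
     (\<forall>c\<in>\<A>. inj_on (snd c) (fst c) \<and> open (snd c ` fst c)) \<and>
     (\<forall>c\<in>\<A>. \<forall>d\<in>\<A>. open (snd c ` (fst c \<inter> fst d)) \<and>
        smooth_on (snd c ` (fst c \<inter> fst d)) (transition c d)) \<and>
     Hausdorff_space (atlas_topology \<A>) \<and> second_countable (atlas_topology \<A>)"

definition smooth_functions :: "('p, 'e::real_normed_vector) chart set \<Rightarrow> 'p set \<Rightarrow> ('p \<Rightarrow> real) set" where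
  "smooth_functions \<A> S =
     {f. \<forall>c\<in>\<A>. smooth_on (snd c ` (fst c \<inter> S)) (f \<circ> chart_inv c)}"


section \<open>Tangent vectors\<close>

text \<open>A tangent vector at \<open>p\<close> is the pair of \<open>p\<close> and its coordinate vectors in all charts around
  \<open>p\<close>, which are related by the derivatives of the transition maps; the value \<open>0\<close> at other charts
  makes the representation unique. The projection of the tangent bundle is \<open>fst\<close>, and
  \<open>snd w c\<close> is the coordinate vector of \<open>w\<close> in the chart \<open>c\<close>.\<close>

type_synonym ('p, 'e) tvec = "'p \<times> (('p, 'e) chart \<Rightarrow> 'e)"

definition tangent_space :: "('p, 'e::real_normed_vector) chart set \<Rightarrow> 'p \<Rightarrow> ('p, 'e) tvec set" where
  "tangent_space \<A> p = {w. fst w = p \<and>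
     (\<forall>c\<in>\<A>. \<forall>d\<in>\<A>. p \<in> fst c \<longrightarrow> p \<in> fst d \<longrightarrow>
        snd w d = frechet_derivative (transition c d) (at (snd c p)) (snd w c)) \<and>
     (\<forall>c. c \<notin> \<A> \<or> p \<notin> fst c \<longrightarrow> snd w c = 0)}"

definition tangent_bundle :: "('p, 'e::real_normed_vector) chart set \<Rightarrow> ('p, 'e) tvec set" where
  "tangent_bundle \<A> = (\<Union>p\<in>points \<A>. tangent_space \<A> p)"

definition tzero :: "'p \<Rightarrow> ('p, 'e::real_normed_vector) tvec" where
  "tzero p = (p, \<lambda>c. 0)"

definition tadd :: "('p, 'e::real_normed_vector) tvec \<Rightarrow> ('p, 'e) tvec \<Rightarrow> ('p, 'e) tvec" where
  "tadd v w = (fst v, \<lambda>c. snd v c + snd w c)"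

definition tscale :: "real \<Rightarrow> ('p, 'e::real_normed_vector) tvec \<Rightarrow> ('p, 'e) tvec" where
  "tscale r v = (fst v, \<lambda>c. r *\<^sub>R snd v c)"

text \<open>The tangent vector at \<open>p\<close> with coordinate vector \<open>e\<close> in the chart \<open>c\<close>.\<close>
definition tvec_of :: "('p, 'e::real_normed_vector) chart set \<Rightarrow> ('p, 'e) chart \<Rightarrow> 'p \<Rightarrow> 'e \<Rightarrow> ('p, 'e) tvec" where
  "tvec_of \<A> c p e = (p, \<lambda>d. if d \<in> \<A> \<and> p \<in> fst d
     then frechet_derivative (transition c d) (at (snd c p)) e else 0)"

definition chart_at :: "('p, 'e) chart set \<Rightarrow> 'p \<Rightarrow> ('p, 'e) chart" where
  "chart_at \<A> p = (SOME c. c \<in> \<A> \<and> p \<in> fst c)"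

text \<open>The differential of a map, and the derivative of a function along a tangent vector. By the
  chain rule neither depends on the choice of the chart.\<close>
definition tmap :: "('p, 'e::real_normed_vector) chart set \<Rightarrow> ('q, 'f::real_normed_vector) chart set
    \<Rightarrow> ('p \<Rightarrow> 'q) \<Rightarrow> ('p, 'e) tvec \<Rightarrow> ('q, 'f) tvec" where
  "tmap \<A> \<B> f w = (let p = fst w; c = chart_at \<A> p in
     (f p, \<lambda>d. if d \<in> \<B> \<and> f p \<in> fst d
        then frechet_derivative (snd d \<circ> f \<circ> chart_inv c) (at (snd c p)) (snd w c) else 0))"

definition dir_deriv :: "('p, 'e::real_normed_vector) chart set \<Rightarrow> ('p, 'e) tvec \<Rightarrow> ('p \<Rightarrow> real) \<Rightarrow> real" where
  "dir_deriv \<A> w f = (let p = fst w; c = chart_at \<A> p in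
     frechet_derivative (f \<circ> chart_inv c) (at (snd c p)) (snd w c))"

text \<open>Smooth vector fields on an open set \<open>S\<close> of the manifold. The tangent space of \<open>S\<close> at a point
  is that of the ambient manifold.\<close>
definition vector_fields :: "('p, 'e::real_normed_vector) chart set \<Rightarrow> 'p set \<Rightarrow> ('p \<Rightarrow> ('p, 'e) tvec) set" where
  "vector_fields \<A> S = {X \<in> \<Pi>\<^sub>E p\<in>S. tangent_space \<A> p.
     \<forall>c\<in>\<A>. smooth_on (snd c ` (fst c \<inter> S)) (\<lambda>x. snd (X (chart_inv c x)) c)}"

text \<open>Pointwise operations on fields, for fields of vectors tangent to any manifold.\<close>
definition field_add :: "'s set \<Rightarrow> ('s \<Rightarrow> ('p, 'e::real_normed_vector) tvec) \<Rightarrow> ('s \<Rightarrow> ('p, 'e) tvec) \<Rightarrow> 's \<Rightarrow> ('p, 'e) tvec" where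
  "field_add S X Y = (\<lambda>p\<in>S. tadd (X p) (Y p))"

definition field_scale :: "'s set \<Rightarrow> ('s \<Rightarrow> real) \<Rightarrow> ('s \<Rightarrow> ('p, 'e::real_normed_vector) tvec) \<Rightarrow> 's \<Rightarrow> ('p, 'e) tvec" where
  "field_scale S f X = (\<lambda>p\<in>S. tscale (f p) (X p))"


section \<open>The tangent bundle as a manifold\<close>

text \<open>The natural coordinates \<open>(x, y)\<close>.\<close>
definition natural_chart :: "('p, 'e::real_normed_vector) chart set \<Rightarrow> ('p, 'e) chart \<Rightarrow> (('p, 'e) tvec, 'e \<times> 'e) chart" where
  "natural_chart \<A> c = ({v \<in> tangent_bundle \<A>. fst v \<in> fst c}, \<lambda>v. (snd c (fst v), snd v c))"

definition tangent_atlas :: "('p, 'e::real_normed_vector) chart set \<Rightarrow> (('p, 'e) tvec, 'e \<times> 'e) chart set" where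
  "tangent_atlas \<A> = natural_chart \<A> ` \<A>"

text \<open>Open conic subsets of the slit tangent bundle projecting onto the manifold.\<close>
definition conic_domain :: "('p, 'e::real_normed_vector) chart set \<Rightarrow> ('p, 'e) tvec set \<Rightarrow> bool" where
  "conic_domain \<A> A \<longleftrightarrow>
     A \<subseteq> tangent_bundle \<A> - tzero ` points \<A> \<and>
     openin (atlas_topology (tangent_atlas \<A>)) A \<and>
     (\<forall>r>0. \<forall>v\<in>A. tscale r v \<in> A) \<and>
     fst ` A = points \<A>"

definition vertical_space :: "('p, 'e::real_normed_vector) chart set \<Rightarrow> ('p, 'e) tvec \<Rightarrow> (('p, 'e) tvec, 'e \<times> 'e) tvec set" where
  "vertical_space \<A> v =
     {w \<in> tangent_space (tangent_atlas \<A>) v. tmap (tangent_atlas \<A>) \<A> fst w = tzero (fst v)}"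

definition vertical_bundle :: "('p, 'e::real_normed_vector) chart set \<Rightarrow> ('p, 'e) tvec set \<Rightarrow> (('p, 'e) tvec, 'e \<times> 'e) tvec set" where
  "vertical_bundle \<A> A = (\<Union>v\<in>A. vertical_space \<A> v)"

text \<open>The coordinates \<open>((x, y), z)\<close> of the vertical vector with components \<open>z\<close> along the
  \<open>\<partial>/\<partial>y\<close> at \<open>(x, y)\<close>.\<close>
definition vertical_chart :: "('p, 'e::real_normed_vector) chart set \<Rightarrow> ('p, 'e) tvec set \<Rightarrow> ('p, 'e) chart
    \<Rightarrow> ((('p, 'e) tvec, 'e \<times> 'e) tvec, ('e \<times> 'e) \<times> 'e) chart" where
  "vertical_chart \<A> A c = (let d = natural_chart \<A> c in
     ({w \<in> vertical_bundle \<A> A. fst w \<in> fst d}, \<lambda>w. (snd d (fst w), snd (snd w d))))"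

definition vertical_atlas :: "('p, 'e::real_normed_vector) chart set \<Rightarrow> ('p, 'e) tvec set
    \<Rightarrow> ((('p, 'e) tvec, 'e \<times> 'e) tvec, ('e \<times> 'e) \<times> 'e) chart set" where
  "vertical_atlas \<A> A = vertical_chart \<A> A ` \<A>"

text \<open>The identification of a vector \<open>w\<close> tangent at the base point of \<open>v\<close> with a vertical vector
  at \<open>v\<close>: the velocity of \<open>v + t w\<close> at \<open>t = 0\<close>.\<close>
definition vertical_lift :: "('p, 'e::real_normed_vector) chart set \<Rightarrow> ('p, 'e) tvec \<Rightarrow> ('p, 'e) tvec \<Rightarrow> (('p, 'e) tvec, 'e \<times> 'e) tvec" where
  "vertical_lift \<A> v w = (v, \<lambda>d. if d \<in> tangent_atlas \<A> \<and> v \<in> fst d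
     then vector_derivative (\<lambda>t. snd d (tadd v (tscale t w))) (at 0) else 0)"

text \<open>Anisotropic vector fields, i.e. sections over \<open>A\<close> of the pullback of the tangent bundle.\<close>
definition aniso_fields :: "('p, 'e::real_normed_vector) chart set \<Rightarrow> ('p, 'e) tvec set \<Rightarrow> (('p, 'e) tvec \<Rightarrow> ('p, 'e) tvec) set" where
  "aniso_fields \<A> A = {Z \<in> \<Pi>\<^sub>E v\<in>A. tangent_space \<A> (fst v).
     \<forall>c\<in>\<A>. let d = natural_chart \<A> c in
       smooth_on (snd d ` (fst d \<inter> A)) (\<lambda>u. snd (Z (chart_inv d u)) c)}"


section \<open>Anisotropic connections\<close>

type_synonym ('p, 'e) aniso_conn =
  "('p \<Rightarrow> ('p, 'e) tvec) \<Rightarrow> ('p \<Rightarrow> ('p, 'e) tvec) \<Rightarrow> ('p, 'e) tvec \<Rightarrow> ('p, 'e) tvec"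

definition aniso_connections :: "('p, 'e::real_normed_vector) chart set \<Rightarrow> ('p, 'e) tvec set \<Rightarrow> ('p, 'e) aniso_conn set" where
  "aniso_connections \<A> A = (let M = points \<A>; \<XX> = vector_fields \<A> M; \<FF> = smooth_functions \<A> M in
    {D \<in> \<XX> \<rightarrow>\<^sub>E \<XX> \<rightarrow>\<^sub>E aniso_fields \<A> A.
      (\<forall>X\<in>\<XX>. \<forall>Y\<in>\<XX>. \<forall>Z\<in>\<XX>. D (field_add M X Y) Z = field_add A (D X Z) (D Y Z)) \<and>
      (\<forall>X\<in>\<XX>. \<forall>Y\<in>\<XX>. \<forall>Z\<in>\<XX>. D X (field_add M Y Z) = field_add A (D X Y) (D X Z)) \<and>
      (\<forall>X\<in>\<XX>. \<forall>Y\<in>\<XX>. \<forall>f\<in>\<FF>. D X (field_scale M f Y) =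
         field_add A (field_scale A (\<lambda>v. dir_deriv \<A> (X (fst v)) f) (Y \<circ> fst))
                     (field_scale A (f \<circ> fst) (D X Y))) \<and>
      (\<forall>X\<in>\<XX>. \<forall>Y\<in>\<XX>. \<forall>Z\<in>\<XX>. \<forall>f\<in>\<FF>. \<forall>h\<in>\<FF>.
         D (field_add M (field_scale M f X) (field_scale M h Y)) Z =
         field_add A (field_scale A (f \<circ> fst) (D X Z)) (field_scale A (h \<circ> fst) (D Y Z)))})"

definition homogeneous_aniso :: "('p, 'e::real_normed_vector) chart set \<Rightarrow> ('p, 'e) tvec set \<Rightarrow> ('p, 'e) aniso_conn \<Rightarrow> bool" where
  "homogeneous_aniso \<A> A D \<longleftrightarrow>
     (\<forall>X\<in>vector_fields \<A> (points \<A>). \<forall>Y\<in>vector_fields \<A> (points \<A>). \<forall>v\<in>A. \<forall>r>0.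
        D X Y (tscale r v) = D X Y v)"

definition coord_vec :: "('p, real^'n) chart set \<Rightarrow> ('p, real^'n) chart \<Rightarrow> 'n \<Rightarrow> 'p \<Rightarrow> ('p, real^'n) tvec" where
  "coord_vec \<A> c i p = tvec_of \<A> c p (axis i 1)"

text \<open>Connections only act on globally defined fields, whereas coordinate fields are local. Since
  connections are local operators, a coordinate field may be replaced, at a given point, by any
  global field that coincides with it near that point.\<close>
definition extended_coord_field :: "('p, real^'n) chart set \<Rightarrow> ('p, real^'n) chart \<Rightarrow> 'n \<Rightarrow> 'p \<Rightarrow> 'p \<Rightarrow> ('p, real^'n) tvec" where
  "extended_coord_field \<A> c i p = (SOME X. X \<in> vector_fields \<A> (points \<A>) \<and>
     (\<exists>W. openin (atlas_topology \<A>) W \<and> p \<in> W \<and> W \<subseteq> fst c \<and> (\<forall>q\<in>W. X q = coord_vec \<A> c i q)))"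

definition aniso_christoffel :: "('p, real^'n) chart set \<Rightarrow> ('p, real^'n) aniso_conn \<Rightarrow> ('p, real^'n) chart
    \<Rightarrow> 'n \<Rightarrow> 'n \<Rightarrow> 'n \<Rightarrow> ('p, real^'n) tvec \<Rightarrow> real" where
  "aniso_christoffel \<A> D c a i j v =
     snd (D (extended_coord_field \<A> c i (fst v)) (extended_coord_field \<A> c j (fst v)) v) c $ a"


section \<open>Nonlinear connections\<close>

type_synonym ('p, 'e) nonlin_conn = "('p, 'e) tvec \<Rightarrow> (('p, 'e) tvec, 'e \<times> 'e) tvec set"

text \<open>The last condition is smoothness of the distribution: it has local smooth frames (of rank
  \<open>n\<close>, the rank of any complement to the vertical bundle).\<close>
definition nonlinear_connection :: "('p, real^'n) chart set \<Rightarrow> ('p, real^'n) tvec set \<Rightarrow> ('p, real^'n) nonlin_conn \<Rightarrow> bool" where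
  "nonlinear_connection \<A> A \<nu> \<longleftrightarrow> (let \<T> = tangent_atlas \<A> in
     (\<forall>v\<in>A. \<nu> v \<subseteq> tangent_space \<T> v \<and> tzero v \<in> \<nu> v \<and>
        (\<forall>w\<in>\<nu> v. \<forall>w'\<in>\<nu> v. tadd w w' \<in> \<nu> v) \<and> (\<forall>r. \<forall>w\<in>\<nu> v. tscale r w \<in> \<nu> v)) \<and>
     (\<forall>v\<in>A. \<forall>w\<in>tangent_space \<T> v.
        \<exists>!(h, u). h \<in> \<nu> v \<and> u \<in> vertical_space \<A> v \<and> w = tadd h u) \<and>
     (\<forall>v\<in>A. \<exists>W. openin (atlas_topology \<T>) W \<and> v \<in> W \<and> W \<subseteq> A \<and>
        (\<exists>E :: 'n \<Rightarrow> _. (\<forall>i. E i \<in> vector_fields \<T> W) \<and>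
          (\<forall>u\<in>W. \<forall>d\<in>\<T>. u \<in> fst d \<longrightarrow>
             (\<lambda>w. snd w d) ` \<nu> u = span (range (\<lambda>i. snd (E i u) d))))))"

definition homogeneous_nonlinear :: "('p, real^'n) chart set \<Rightarrow> ('p, real^'n) tvec set \<Rightarrow> ('p, real^'n) nonlin_conn \<Rightarrow> bool" where
  "homogeneous_nonlinear \<A> A \<nu> \<longleftrightarrow>
     (\<forall>r>0. \<forall>v\<in>A. tmap (tangent_atlas \<A>) (tangent_atlas \<A>) (tscale r) ` \<nu> v = \<nu> (tscale r v))"

text \<open>\<open>nonlin_components \<A> \<nu> c v i $ a\<close> is the component \<open>N\<^sub>i\<^sup>a\<close> at \<open>v\<close>.\<close>
definition nonlin_components :: "('p, real^'n) chart set \<Rightarrow> ('p, real^'n) nonlin_conn \<Rightarrow> ('p, real^'n) chart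
    \<Rightarrow> ('p, real^'n) tvec \<Rightarrow> 'n \<Rightarrow> real^'n" where
  "nonlin_components \<A> \<nu> c v = (THE N. (\<lambda>w. snd w (natural_chart \<A> c)) ` \<nu> v =
     span (range (\<lambda>i. (axis i 1, - N i))))"

definition delta_vec :: "('p, real^'n) chart set \<Rightarrow> ('p, real^'n) nonlin_conn \<Rightarrow> ('p, real^'n) chart
    \<Rightarrow> 'n \<Rightarrow> ('p, real^'n) tvec \<Rightarrow> (('p, real^'n) tvec, (real^'n) \<times> (real^'n)) tvec" where
  "delta_vec \<A> \<nu> c i v = tvec_of (tangent_atlas \<A>) (natural_chart \<A> c) v
     (axis i 1, - nonlin_components \<A> \<nu> c v i)"

definition vertical_coord_vec :: "('p, real^'n) chart set \<Rightarrow> ('p, real^'n) chart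
    \<Rightarrow> 'n \<Rightarrow> ('p, real^'n) tvec \<Rightarrow> (('p, real^'n) tvec, (real^'n) \<times> (real^'n)) tvec" where
  "vertical_coord_vec \<A> c i v = tvec_of (tangent_atlas \<A>) (natural_chart \<A> c) v (0, axis i 1)"


section \<open>Linear connections on the vertical bundle\<close>

text \<open>Koszul derivatives, acting on sections of the vertical bundle viewed as anisotropic vector
  fields.\<close>

type_synonym ('p, 'e) linear_conn =
  "(('p, 'e) tvec \<Rightarrow> (('p, 'e) tvec, 'e \<times> 'e) tvec) \<Rightarrow> (('p, 'e) tvec \<Rightarrow> ('p, 'e) tvec)
     \<Rightarrow> ('p, 'e) tvec \<Rightarrow> ('p, 'e) tvec"

definition linear_connections :: "('p, 'e::real_normed_vector) chart set \<Rightarrow> ('p, 'e) tvec set \<Rightarrow> ('p, 'e) linear_conn set" where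
  "linear_connections \<A> A = (let \<T> = tangent_atlas \<A>; \<XX> = vector_fields \<T> A;
      \<FF> = smooth_functions \<T> A; \<ZZ> = aniso_fields \<A> A in
    {D \<in> \<XX> \<rightarrow>\<^sub>E \<ZZ> \<rightarrow>\<^sub>E \<ZZ>.
      (\<forall>X\<in>\<XX>. \<forall>Y\<in>\<XX>. \<forall>Z\<in>\<ZZ>. D (field_add A X Y) Z = field_add A (D X Z) (D Y Z)) \<and>
      (\<forall>X\<in>\<XX>. \<forall>Z\<in>\<ZZ>. \<forall>f\<in>\<FF>. D (field_scale A f X) Z = field_scale A f (D X Z)) \<and>
      (\<forall>X\<in>\<XX>. \<forall>Y\<in>\<ZZ>. \<forall>Z\<in>\<ZZ>. D X (field_add A Y Z) = field_add A (D X Y) (D X Z)) \<and>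
      (\<forall>X\<in>\<XX>. \<forall>Z\<in>\<ZZ>. \<forall>f\<in>\<FF>. D X (field_scale A f Z) =
         field_add A (field_scale A (\<lambda>v. dir_deriv \<T> (X v) f) Z) (field_scale A f (D X Z)))})"

text \<open>The derivative along a single vector \<open>w\<close> tangent to \<open>A\<close>. It does not depend on the field
  extending \<open>w\<close>, as connections are tensorial in the first argument.\<close>
definition deriv_along :: "('p, 'e::real_normed_vector) chart set \<Rightarrow> ('p, 'e) tvec set \<Rightarrow> ('p, 'e) linear_conn
    \<Rightarrow> (('p, 'e) tvec, 'e \<times> 'e) tvec \<Rightarrow> (('p, 'e) tvec \<Rightarrow> ('p, 'e) tvec) \<Rightarrow> ('p, 'e) tvec" where
  "deriv_along \<A> A D w Z =
     D (SOME X. X \<in> vector_fields (tangent_atlas \<A>) A \<and> X (fst w) = w) Z (fst w)"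

definition extended_coord_section :: "('p, real^'n) chart set \<Rightarrow> ('p, real^'n) tvec set \<Rightarrow> ('p, real^'n) chart
    \<Rightarrow> 'n \<Rightarrow> ('p, real^'n) tvec \<Rightarrow> ('p, real^'n) tvec \<Rightarrow> ('p, real^'n) tvec" where
  "extended_coord_section \<A> A c j v = (SOME Z. Z \<in> aniso_fields \<A> A \<and>
     (\<exists>W. openin (atlas_topology (tangent_atlas \<A>)) W \<and> v \<in> W \<and> W \<subseteq> A \<inter> fst (natural_chart \<A> c) \<and>
       (\<forall>u\<in>W. Z u = coord_vec \<A> c j (fst u))))"

text \<open>The horizontal symbols \<open>H\<^sup>a\<^sub>i\<^sub>j\<close> and the vertical symbols \<open>V\<^sup>a\<^sub>i\<^sub>j\<close>.\<close>
definition horizontal_christoffel :: "('p, real^'n) chart set \<Rightarrow> ('p, real^'n) tvec set \<Rightarrow> ('p, real^'n) nonlin_conn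
    \<Rightarrow> ('p, real^'n) linear_conn \<Rightarrow> ('p, real^'n) chart \<Rightarrow> 'n \<Rightarrow> 'n \<Rightarrow> 'n \<Rightarrow> ('p, real^'n) tvec \<Rightarrow> real" where
  "horizontal_christoffel \<A> A \<nu> D c a i j v =
     snd (deriv_along \<A> A D (delta_vec \<A> \<nu> c i v) (extended_coord_section \<A> A c j v)) c $ a"

definition vertical_christoffel :: "('p, real^'n) chart set \<Rightarrow> ('p, real^'n) tvec set
    \<Rightarrow> ('p, real^'n) linear_conn \<Rightarrow> ('p, real^'n) chart \<Rightarrow> 'n \<Rightarrow> 'n \<Rightarrow> 'n \<Rightarrow> ('p, real^'n) tvec \<Rightarrow> real" where
  "vertical_christoffel \<A> A D c a i j v =
     snd (deriv_along \<A> A D (vertical_coord_vec \<A> c i v) (extended_coord_section \<A> A c j v)) c $ a"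

definition vertically_trivial :: "('p, real^'n) chart set \<Rightarrow> ('p, real^'n) tvec set \<Rightarrow> ('p, real^'n) linear_conn \<Rightarrow> bool" where
  "vertically_trivial \<A> A D \<longleftrightarrow>
     (\<forall>c\<in>\<A>. \<forall>v\<in>A. fst v \<in> fst c \<longrightarrow> (\<forall>a i j. vertical_christoffel \<A> A D c a i j v = 0))"

text \<open>The horizontal subspace at a point \<open>z\<close> of the vertical bundle consists of the velocities at
  \<open>z\<close> of the sections that are parallel in the respective direction.\<close>
definition horizontal_distribution :: "('p, 'e::real_normed_vector) chart set \<Rightarrow> ('p, 'e) tvec set \<Rightarrow> ('p, 'e) linear_conn
    \<Rightarrow> (('p, 'e) tvec, 'e \<times> 'e) tvec \<Rightarrow> ((('p, 'e) tvec, 'e \<times> 'e) tvec, ('e \<times> 'e) \<times> 'e) tvec set" where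
  "horizontal_distribution \<A> A D z =
     {tmap (tangent_atlas \<A>) (vertical_atlas \<A> A) (\<lambda>v. vertical_lift \<A> v (Z v)) w | Z w.
        Z \<in> aniso_fields \<A> A \<and> w \<in> tangent_space (tangent_atlas \<A>) (fst z) \<and>
        vertical_lift \<A> (fst z) (Z (fst z)) = z \<and>
        deriv_along \<A> A D w Z = tzero (fst (fst z))}"

definition homothety_invariant :: "('p, 'e::real_normed_vector) chart set \<Rightarrow> ('p, 'e) tvec set \<Rightarrow> ('p, 'e) linear_conn \<Rightarrow> bool" where
  "homothety_invariant \<A> A D \<longleftrightarrow>
     (\<forall>r>0. let h = tmap (tangent_atlas \<A>) (tangent_atlas \<A>) (tscale r) in
        \<forall>z\<in>vertical_bundle \<A> A.
          tmap (vertical_atlas \<A> A) (vertical_atlas \<A> A) h ` horizontal_distribution \<A> A D z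
            = horizontal_distribution \<A> A D (h z))"

definition vertically_trivial_connections :: "('p, real^'n) chart set \<Rightarrow> ('p, real^'n) tvec set \<Rightarrow> ('p, real^'n) linear_conn set" where
  "vertically_trivial_connections \<A> A = {D \<in> linear_connections \<A> A. vertically_trivial \<A> A D}"


section \<open>The correspondence\<close>

definition same_christoffel :: "('p, real^'n) chart set \<Rightarrow> ('p, real^'n) tvec set \<Rightarrow> ('p, real^'n) nonlin_conn
    \<Rightarrow> ('p, real^'n) linear_conn \<Rightarrow> ('p, real^'n) aniso_conn \<Rightarrow> bool" where
  "same_christoffel \<A> A \<nu> Ds D \<longleftrightarrow>
     (\<forall>c\<in>\<A>. \<forall>v\<in>A. fst v \<in> fst c \<longrightarrow>
        (\<forall>a i j. aniso_christoffel \<A> D c a i j v = horizontal_christoffel \<A> A \<nu> Ds c a i j v))"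

definition aniso_of_linear :: "('p, real^'n) chart set \<Rightarrow> ('p, real^'n) tvec set \<Rightarrow> ('p, real^'n) nonlin_conn
    \<Rightarrow> ('p, real^'n) linear_conn \<Rightarrow> ('p, real^'n) aniso_conn" where
  "aniso_of_linear \<A> A \<nu> Ds = (THE D. D \<in> aniso_connections \<A> A \<and> same_christoffel \<A> A \<nu> Ds D)"

end

theory Submission
  imports Defs
begin

text \<open>In a chart, a connection of either kind is the derivative of the coordinates of the
  differentiated section plus a term that is bilinear in the direction and in the value of the
  section: \<open>(\<nabla>\<^sub>X Y)\<^sub>v = dY(X) + \<Gamma>(v)(X, Y)\<close> for an anisotropic connection, and
  \<open>\<nabla>\<^sup>*\<^sub>w Z = dZ(w) + G(v)(w, Z)\<close> for a linear connection on the vertical bundle. As connections act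
  on global fields only, this rests on cutoff functions pulled back from the manifold. Vertical
  triviality says that \<open>G(v)(w, \<sqdot>)\<close> depends on the projection of \<open>w\<close> to \<open>M\<close> only, so the
  horizontal symbols are the same for every nonlinear connection, and \<open>G(v)(w, Z) = \<Gamma>(v)(\<pi>\<^sub>* w, Z)\<close>
  is the correspondence. In coordinates the horizontal space at \<open>(v, z)\<close> is the graph of
  \<open>w \<mapsto> - G(v)(w, z)\<close>, hence both homogeneity conditions say that \<open>\<Gamma>(\<lambda>v) = \<Gamma>(v)\<close>.\<close>

section \<open>Calculus of smooth functions\<close>

text \<open>No transformation law for Christoffel symbols is derived. A coordinate formula is shown
  to be independent of the chart by exhibiting a tangent vector whose coordinates it gives: a value
  of the given connection or, from anisotropic to linear connections, such a value plus the
  derivative of a section that vanishes at the point. In this way second derivatives of coordinate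
  changes never appear. Smoothness in the converse constructions is read off the coordinate formula,
  because the fields entering a value may be chosen anew at each point. Hausdorff separation enters
  through the cutoffs: a closed coordinate ball must be closed in the manifold for a bump function
  extended by zero to be smooth. An anisotropic connection differentiates fields on M but has values
  over \<open>A\<close>, so the base of the fields and the base of the values are kept apart and
  linked by a map \<open>\<phi>\<close>; both kinds of connection then share one local
  analysis.\<close>

lemma frechet_derivative_cong_open:
  assumes "open S" "x \<in> S" "\<And>x. x \<in> S \<Longrightarrow> f x = g x"
  shows "frechet_derivative f (at x) = frechet_derivative g (at x)"
    and "f differentiable (at x) \<longleftrightarrow> g differentiable (at x)"
proof -
  have "(f has_derivative f') (at x) \<longleftrightarrow> (g has_derivative f') (at x)" for f'
    using has_derivative_transform_within_open[OF _ assms(1,2)] assms(3) by metis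
  then show "frechet_derivative f (at x) = frechet_derivative g (at x)"
    and "f differentiable (at x) \<longleftrightarrow> g differentiable (at x)"
    unfolding frechet_derivative_def differentiable_def by auto
qed

lemma Ck_on_cong:
  assumes "open S" "\<And>x. x \<in> S \<Longrightarrow> f x = g x"
  shows "Ck_on k S f \<longleftrightarrow> Ck_on k S g"
  using assms(2)
proof (induction k arbitrary: f g)
  case 0
  then show ?case by (simp cong: continuous_on_cong)
next
  case (Suc k)
  have eq: "frechet_derivative f (at x) = frechet_derivative g (at x)"
    "f differentiable (at x) \<longleftrightarrow> g differentiable (at x)" if "x \<in> S" for x
    using frechet_derivative_cong_open[OF assms(1) that, of f g] Suc.prems by auto
  have "Ck_on k S (\<lambda>x. frechet_derivative f (at x) e) \<longleftrightarrow>
      Ck_on k S (\<lambda>x. frechet_derivative g (at x) e)" for e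
    using eq by (intro Suc.IH) simp
  with eq show ?case by simp
qed

lemma Ck_on_subset: "Ck_on k S f \<Longrightarrow> T \<subseteq> S \<Longrightarrow> Ck_on k T f"
  by (induction k arbitrary: f) (auto intro: continuous_on_subset)

text \<open>The recursion asks for continuity only at the top order; the lower orders get theirs
  from differentiability.\<close>

lemma Ck_on_SucD: "Ck_on (Suc k) S f \<Longrightarrow> Ck_on k S f"
proof (induction k arbitrary: f)
  case 0
  then show ?case
    by (auto intro!: differentiable_imp_continuous_on
        simp: differentiable_on_def differentiable_at_withinI)
next
  case (Suc k)
  from Suc.prems have "Ck_on k S (\<lambda>x. frechet_derivative f (at x) e)" for e
    unfolding Ck_on.simps(2)[of "Suc k"] by (blast intro: Suc.IH)
  with Suc.prems show ?case unfolding Ck_on.simps(2)[of "Suc k"] Ck_on.simps(2)[of k] by blast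
qed

text \<open>Trades the choice inside \<open>frechet_derivative\<close> for an explicit derivative;
  the differentiation rules below enter the inductions through it.\<close>

lemma Ck_on_SucI:
  assumes "open S" "\<And>x. x \<in> S \<Longrightarrow> (f has_derivative f' x) (at x)"
    and "\<And>e. Ck_on k S (\<lambda>x. f' x e)"
  shows "Ck_on (Suc k) S f"
proof -
  have "frechet_derivative f (at x) = f' x" if "x \<in> S" for x
    using frechet_derivative_at[OF assms(2)[OF that]] by simp
  then have "Ck_on k S (\<lambda>x. frechet_derivative f (at x) e)" for e
    using assms(3) Ck_on_cong[OF assms(1), of "\<lambda>x. frechet_derivative f (at x) e" "\<lambda>x. f' x e"] by simp
  with assms(2) show ?thesis unfolding Ck_on.simps differentiable_def by blast
qed

lemma Ck_on_has_derivative: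
  "Ck_on (Suc k) S f \<Longrightarrow> x \<in> S \<Longrightarrow> (f has_derivative frechet_derivative f (at x)) (at x)"
  by (simp add: frechet_derivative_works)

lemma Ck_on_const: "Ck_on k S (\<lambda>x. c)"
  by (induction k arbitrary: c) (auto simp: frechet_derivative_const)

lemma Ck_on_bounded_linear:
  assumes "bounded_linear L" "open S" "Ck_on k S f"
  shows "Ck_on k S (\<lambda>x. L (f x))"
  using assms(3)
proof (induction k arbitrary: f)
  case 0
  then show ?case by (auto intro: bounded_linear.continuous_on[OF assms(1)])
next
  case (Suc k)
  show ?case
  proof (rule Ck_on_SucI[OF assms(2)])
    show "((\<lambda>x. L (f x)) has_derivative (\<lambda>e. L (frechet_derivative f (at x) e))) (at x)" if "x \<in> S" for x
      by (rule bounded_linear.has_derivative[OF assms(1) Ck_on_has_derivative[OF Suc.prems that]])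
    show "Ck_on k S (\<lambda>x. L (frechet_derivative f (at x) e))" for e
      using Suc by simp
  qed
qed

lemma Ck_on_id: "open S \<Longrightarrow> Ck_on k S (\<lambda>x. x)"
proof (cases k)
  case (Suc m)
  assume "open S"
  then show ?thesis unfolding Suc
    by (intro Ck_on_SucI[where f' = "\<lambda>_ e. e"] Ck_on_const has_derivative_ident)
qed auto

lemma Ck_on_add:
  assumes "open S" "Ck_on k S f" "Ck_on k S g"
  shows "Ck_on k S (\<lambda>x. f x + g x)"
  using assms(2,3)
proof (induction k arbitrary: f g)
  case 0
  then show ?case by (auto intro: continuous_on_add)
next
  case (Suc k)
  show ?case
  proof (rule Ck_on_SucI[OF assms(1)])
    show "((\<lambda>x. f x + g x) has_derivative
        (\<lambda>e. frechet_derivative f (at x) e + frechet_derivative g (at x) e)) (at x)" if "x \<in> S" for x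
      using Suc.prems that by (intro has_derivative_add Ck_on_has_derivative)
    show "Ck_on k S (\<lambda>x. frechet_derivative f (at x) e + frechet_derivative g (at x) e)" for e
      using Suc by simp
  qed
qed

text \<open>The product rule pairs a derivative of one factor with the other factor itself, so the
  induction also needs both factors at the lower order (\<open>Ck_on_SucD\<close>).\<close>

lemma Ck_on_bilinear:
  assumes "bounded_bilinear B" "open S" "Ck_on k S f" "Ck_on k S g"
  shows "Ck_on k S (\<lambda>x. B (f x) (g x))"
  using assms(3,4)
proof (induction k arbitrary: f g)
  case 0
  then show ?case by (auto intro: bounded_bilinear.continuous_on[OF assms(1)])
next
  case (Suc k)
  show ?case
  proof (rule Ck_on_SucI[OF assms(2)])
    show "((\<lambda>x. B (f x) (g x)) has_derivative
        (\<lambda>e. B (f x) (frechet_derivative g (at x) e) + B (frechet_derivative f (at x) e) (g x))) (at x)"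
      if "x \<in> S" for x
      using Suc.prems that
      by (intro bounded_bilinear.FDERIV[OF assms(1)] Ck_on_has_derivative)
    show "Ck_on k S (\<lambda>x. B (f x) (frechet_derivative g (at x) e) + B (frechet_derivative f (at x) e) (g x))" for e
      using Suc Suc.prems[THEN Ck_on_SucD] by (intro Ck_on_add[OF assms(2)]) simp_all
  qed
qed

lemma Ck_on_sum:
  assumes "open S" "finite I" "\<And>i. i \<in> I \<Longrightarrow> Ck_on k S (f i)"
  shows "Ck_on k S (\<lambda>x. \<Sum>i\<in>I. f i x)"
  using assms(2,3) by (induction I) (auto simp: Ck_on_const intro: Ck_on_add[OF assms(1)])

lemma linear_basis_sum:
  fixes L :: "'b::euclidean_space \<Rightarrow> 'c::real_vector"
  assumes "linear L"
  shows "L y = (\<Sum>i\<in>Basis. (y \<bullet> i) *\<^sub>R L i)"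
proof -
  have "L y = L (\<Sum>i\<in>Basis. (y \<bullet> i) *\<^sub>R i)" by (simp only: euclidean_representation)
  also have "\<dots> = (\<Sum>i\<in>Basis. (y \<bullet> i) *\<^sub>R L i)"
    by (simp only: linear_sum[OF assms] linear_cmul[OF assms])
  finally show ?thesis .
qed

text \<open>In the chain rule the linear map and its argument both vary with \<open>x\<close>.
  Expanding the argument in a basis of the middle space turns the derivative into a finite sum of
  products, to which the induction hypothesis and the product rule apply; hence the Euclidean type
  in the middle.\<close>

lemma Ck_on_compose:
  fixes g :: "'a::real_normed_vector \<Rightarrow> 'b::euclidean_space" and f :: "'b \<Rightarrow> 'c::real_normed_vector"
  assumes "open S" "open T" "Ck_on k T f" "Ck_on k S g" "g ` S \<subseteq> T"
  shows "Ck_on k S (\<lambda>x. f (g x))"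
  using assms(3,4)
proof (induction k arbitrary: f)
  case 0
  then show ?case using assms(5) by (auto intro: continuous_on_compose2)
next
  case (Suc k)
  let ?f' = "\<lambda>y. frechet_derivative f (at y)" and ?g' = "\<lambda>x. frechet_derivative g (at x)"
  show ?case
  proof (rule Ck_on_SucI[OF assms(1)])
    show "((\<lambda>x. f (g x)) has_derivative
        (\<lambda>e. \<Sum>i\<in>Basis. (?g' x e \<bullet> i) *\<^sub>R ?f' (g x) i)) (at x)" if x: "x \<in> S" for x
    proof -
      have f: "(f has_derivative ?f' (g x)) (at (g x))"
        using Suc.prems(1) assms(5) x by (intro Ck_on_has_derivative) auto
      have "linear (?f' (g x))" using f has_derivative_linear by blast
      then have "?f' (g x) y = (\<Sum>i\<in>Basis. (y \<bullet> i) *\<^sub>R ?f' (g x) i)" for y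
        by (rule linear_basis_sum)
      then have "(\<lambda>e. \<Sum>i\<in>Basis. (?g' x e \<bullet> i) *\<^sub>R ?f' (g x) i) = (\<lambda>e. ?f' (g x) (?g' x e))"
        by (intro ext) (rule sym)
      then show ?thesis
        using has_derivative_compose[OF Ck_on_has_derivative[OF Suc.prems(2) x] f] by (simp only:)
    qed
    have "Ck_on k S (\<lambda>x. ?f' (g x) i)" for i
      using Suc.prems Ck_on_SucD[OF Suc.prems(2)] by (intro Suc.IH) simp_all
    moreover have "Ck_on k S (\<lambda>x. ?g' x e \<bullet> i)" for e i
      using Suc.prems by (intro Ck_on_bounded_linear[OF bounded_linear_inner_left assms(1)]) simp
    ultimately show "Ck_on k S (\<lambda>x. \<Sum>i\<in>Basis. (?g' x e \<bullet> i) *\<^sub>R ?f' (g x) i)" for e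
      by (intro Ck_on_sum Ck_on_bilinear[OF bounded_bilinear_scaleR] assms(1)) auto
  qed
qed

text \<open>The derivative is a product of \<open>inverse f\<close> with a derivative of
  \<open>f\<close>, so the induction feeds on its own conclusion one order lower.\<close>

lemma Ck_on_inverse:
  fixes f :: "'a::real_normed_vector \<Rightarrow> real"
  assumes "open S" "Ck_on k S f" "\<And>x. x \<in> S \<Longrightarrow> f x \<noteq> 0"
  shows "Ck_on k S (\<lambda>x. inverse (f x))"
  using assms(2)
proof (induction k)
  case 0
  then show ?case using assms(3) by (auto intro: continuous_on_inverse)
next
  case (Suc k)
  show ?case
  proof (rule Ck_on_SucI[OF assms(1)])
    show "((\<lambda>x. inverse (f x)) has_derivative
        (\<lambda>e. - (inverse (f x) * frechet_derivative f (at x) e * inverse (f x)))) (at x)"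
      if "x \<in> S" for x
      using Suc.prems that assms(3) by (intro Deriv.has_derivative_inverse Ck_on_has_derivative) auto
    have *: "Ck_on k S (\<lambda>x. inverse (f x))" using Suc.IH Ck_on_SucD[OF Suc.prems] .
    show "Ck_on k S (\<lambda>x. - (inverse (f x) * frechet_derivative f (at x) e * inverse (f x)))" for e
      using * Suc.prems
      by (intro Ck_on_bounded_linear[OF bounded_linear_minus[OF bounded_linear_ident]]
          Ck_on_bilinear[OF bounded_bilinear_mult] assms(1)) simp_all
  qed
qed

section \<open>Closure properties of functions smooth to all orders\<close>

lemma smooth_on_cong:
  "open S \<Longrightarrow> (\<And>x. x \<in> S \<Longrightarrow> f x = g x) \<Longrightarrow> smooth_on S f \<longleftrightarrow> smooth_on S g"
  unfolding smooth_on_def using Ck_on_cong by blast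

lemma smooth_on_subset: "smooth_on S f \<Longrightarrow> T \<subseteq> S \<Longrightarrow> smooth_on T f"
  unfolding smooth_on_def using Ck_on_subset by blast

lemma smooth_on_const [intro]: "smooth_on S (\<lambda>x. c)"
  unfolding smooth_on_def using Ck_on_const by blast

lemma smooth_on_id [intro]: "open S \<Longrightarrow> smooth_on S (\<lambda>x. x)"
  unfolding smooth_on_def using Ck_on_id by blast

lemma smooth_on_bounded_linear:
  "bounded_linear L \<Longrightarrow> open S \<Longrightarrow> smooth_on S f \<Longrightarrow> smooth_on S (\<lambda>x. L (f x))"
  unfolding smooth_on_def using Ck_on_bounded_linear by blast

lemma smooth_on_add: "open S \<Longrightarrow> smooth_on S f \<Longrightarrow> smooth_on S g \<Longrightarrow> smooth_on S (\<lambda>x. f x + g x)"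
  unfolding smooth_on_def using Ck_on_add by blast

lemma smooth_on_sum:
  "open S \<Longrightarrow> finite I \<Longrightarrow> (\<And>i. i \<in> I \<Longrightarrow> smooth_on S (f i)) \<Longrightarrow> smooth_on S (\<lambda>x. \<Sum>i\<in>I. f i x)"
  unfolding smooth_on_def by (blast intro: Ck_on_sum)

lemma smooth_on_scaleR:
  "open S \<Longrightarrow> smooth_on S f \<Longrightarrow> smooth_on S g \<Longrightarrow> smooth_on S (\<lambda>x. f x *\<^sub>R g x)"
  unfolding smooth_on_def using Ck_on_bilinear[OF bounded_bilinear_scaleR] by blast

lemma smooth_on_mult:
  fixes f g :: "'a::real_normed_vector \<Rightarrow> real"
  shows "open S \<Longrightarrow> smooth_on S f \<Longrightarrow> smooth_on S g \<Longrightarrow> smooth_on S (\<lambda>x. f x * g x)"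
  using smooth_on_scaleR[of S f g] by simp

lemma smooth_on_inner:
  "open S \<Longrightarrow> smooth_on S f \<Longrightarrow> smooth_on S g \<Longrightarrow> smooth_on S (\<lambda>x. f x \<bullet> g x)"
  unfolding smooth_on_def using Ck_on_bilinear[OF bounded_bilinear_inner] by blast

lemma smooth_on_compose:
  fixes g :: "'a::real_normed_vector \<Rightarrow> 'b::euclidean_space"
  shows "open S \<Longrightarrow> open T \<Longrightarrow> smooth_on T f \<Longrightarrow> smooth_on S g \<Longrightarrow> g ` S \<subseteq> T \<Longrightarrow>
    smooth_on S (\<lambda>x. f (g x))"
  unfolding smooth_on_def using Ck_on_compose by blast

lemma smooth_on_inverse:
  fixes f :: "'a::real_normed_vector \<Rightarrow> real"
  shows "open S \<Longrightarrow> smooth_on S f \<Longrightarrow> (\<And>x. x \<in> S \<Longrightarrow> f x \<noteq> 0) \<Longrightarrow> smooth_on S (\<lambda>x. inverse (f x))"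
  unfolding smooth_on_def using Ck_on_inverse by blast

lemma smooth_on_Pair:
  assumes "open S" "smooth_on S f" "smooth_on S g"
  shows "smooth_on S (\<lambda>x. (f x, g x))"
proof -
  have "smooth_on S (\<lambda>x. (f x, 0) + (0, g x))"
    using assms by (intro smooth_on_add
        smooth_on_bounded_linear[where L = "\<lambda>x. (x, 0)"] smooth_on_bounded_linear[where L = "\<lambda>x. (0, x)"]
        bounded_linear_Pair bounded_linear_ident bounded_linear_zero)
  then show ?thesis by simp
qed

lemmas smooth_on_fst = smooth_on_bounded_linear[OF bounded_linear_fst]
lemmas smooth_on_snd = smooth_on_bounded_linear[OF bounded_linear_snd]

lemma smooth_on_has_derivative:
  "smooth_on S f \<Longrightarrow> x \<in> S \<Longrightarrow> (f has_derivative frechet_derivative f (at x)) (at x)"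
  unfolding smooth_on_def using Ck_on_has_derivative by blast

lemma smooth_on_frechet: "smooth_on S f \<Longrightarrow> smooth_on S (\<lambda>x. frechet_derivative f (at x) e)"
  unfolding smooth_on_def using Ck_on.simps(2) by blast

lemma smooth_on_continuous: "smooth_on S f \<Longrightarrow> continuous_on S f"
  unfolding smooth_on_def using Ck_on.simps(1) by blast

text \<open>Meant for Jacobians applied to varying vectors: by linearity, a basis expansion reduces
  joint smoothness to smoothness at fixed vectors.\<close>

lemma smooth_on_linear_family:
  fixes h :: "'a::real_normed_vector \<Rightarrow> 'b::euclidean_space"
  assumes "open S" "\<And>i. smooth_on S (\<lambda>x. T x i)" "\<And>x. x \<in> S \<Longrightarrow> linear (T x)" "smooth_on S h"
  shows "smooth_on S (\<lambda>x. T x (h x))"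
proof -
  have "smooth_on S (\<lambda>x. \<Sum>i\<in>Basis. (h x \<bullet> i) *\<^sub>R T x i)"
    by (intro smooth_on_sum smooth_on_scaleR smooth_on_inner smooth_on_const assms) auto
  then show ?thesis
    by (subst smooth_on_cong[OF assms(1)]) (auto intro: linear_basis_sum assms(3))
qed

lemma smooth_on_frechet_apply:
  fixes f :: "'a::euclidean_space \<Rightarrow> 'b::real_normed_vector"
  assumes "open S" "smooth_on S f" "smooth_on S h"
  shows "smooth_on S (\<lambda>x. frechet_derivative f (at x) (h x))"
  by (rule smooth_on_linear_family[OF assms(1) smooth_on_frechet[OF assms(2)] _ assms(3)])
    (rule has_derivative_linear[OF smooth_on_has_derivative[OF assms(2)]])

text \<open>Serves where each point comes with its own formula: extensions by zero, and coefficients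
  of connections computed with a cutoff that depends on the point.\<close>

lemma smooth_on_local:
  assumes "\<And>x. x \<in> S \<Longrightarrow> \<exists>N. x \<in> N \<and> open N \<and> smooth_on (N \<inter> S) f"
  shows "smooth_on S f"
proof -
  have "Ck_on k S f" if "\<And>x. x \<in> S \<Longrightarrow> \<exists>N. x \<in> N \<and> open N \<and> Ck_on k (N \<inter> S) f"
    for k and f :: "'a \<Rightarrow> 'b"
    using that
  proof (induction k arbitrary: f)
    case 0
    show ?case unfolding Ck_on.simps continuous_on_eq_continuous_within
    proof
      fix x assume x: "x \<in> S"
      then obtain N where N: "x \<in> N" "open N" "continuous_on (N \<inter> S) f" using 0 by auto
      have "at x within (N \<inter> S) = at x within S"
        by (rule at_within_nhd[OF N(1,2)]) auto
      then show "continuous (at x within S) f"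
        using N x by (metis IntI continuous_on_eq_continuous_within)
    qed
  next
    case (Suc k)
    have "f differentiable (at x)" if "x \<in> S" for x
      using Suc.prems[OF that] that by auto
    moreover have "Ck_on k S (\<lambda>x. frechet_derivative f (at x) e)" for e
      by (rule Suc.IH) (use Suc.prems in fastforce)
    ultimately show ?case by simp
  qed
  then show ?thesis using assms unfolding smooth_on_def by metis
qed

section \<open>Bump functions\<close>

text \<open>The derivatives of exp(-1/x) are combinations of the functions x^(-k) exp(-1/x).
  Carrying the exponent \<open>k\<close> along gives a family closed under differentiation.\<close>

definition flat :: "nat \<Rightarrow> real \<Rightarrow> real" where
  "flat k x = (if x > 0 then inverse x ^ k * exp (- inverse x) else 0)"

lemma flat_tendsto: "(flat k \<longlongrightarrow> 0) (at 0)"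
proof -
  have "((\<lambda>x. inverse x ^ k * exp (- inverse x)) \<longlongrightarrow> 0) (at_right (0::real))"
  proof -
    have "((\<lambda>t::real. t ^ k * exp (- t)) \<longlongrightarrow> 0) at_top"
      using tendsto_power_div_exp_0[of k] by (simp add: exp_minus divide_inverse)
    then show ?thesis
      by (rule filterlim_compose[OF _ filterlim_inverse_at_top_right])
  qed
  then have "(flat k \<longlongrightarrow> 0) (at_right 0)"
    by (rule Lim_transform_eventually)
      (auto simp: flat_def eventually_at_filter)
  moreover have "(flat k \<longlongrightarrow> 0) (at_left 0)"
    by (rule Lim_transform_eventually[OF tendsto_const])
      (auto simp: flat_def eventually_at_filter)
  ultimately show ?thesis by (simp add: filterlim_split_at)
qed

lemma flat_deriv: "(flat k has_real_derivative (flat (k + 2) x - real k * flat (k + 1) x)) (at x)"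
proof (cases x "0::real" rule: linorder_cases)
  case less
  have "((\<lambda>_. 0) has_real_derivative 0) (at x)" by simp
  then have "(flat k has_real_derivative 0) (at x)"
    by (rule has_field_derivative_transform_within_open[where S = "{..<0}"])
      (use less in \<open>auto simp: flat_def\<close>)
  then show ?thesis using less by (simp add: flat_def)
next
  case equal
  \<comment> \<open>The difference quotient of \<open>flat k\<close> at 0 is
    \<open>flat (k + 1)\<close>, which is why the limit was established for every exponent.\<close>
  have "((\<lambda>h. flat k h / h) \<longlongrightarrow> 0) (at 0)"
    by (rule Lim_transform_eventually[OF flat_tendsto[of "k + 1"]])
      (auto simp: flat_def eventually_at_filter divide_simps)
  then show ?thesis using equal by (simp add: DERIV_def flat_def)
next
  case greater
  \<comment> \<open>The closing case split on \<open>k\<close> deals with the exponent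
    \<open>k - 1\<close> from the power rule, which is truncated at 0.\<close>
  have "((\<lambda>x. inverse x ^ k * exp (- inverse x)) has_real_derivative
      (flat (k + 2) x - real k * flat (k + 1) x)) (at x)"
    using greater
    by (auto intro!: derivative_eq_intros simp: flat_def power2_eq_square)
      (cases k; simp add: field_simps)
  then show ?thesis
    by (rule has_field_derivative_transform_within_open[where S = "{0<..}"])
      (use greater in \<open>auto simp: flat_def\<close>)
qed

lemma smooth_flat: "smooth_on UNIV (flat k)"
proof -
  have "Ck_on n UNIV (flat k)" for n
  proof (induction n arbitrary: k)
    case 0
    then show ?case
      using flat_deriv DERIV_continuous continuous_at_imp_continuous_on by (metis Ck_on.simps(1))
  next
    case (Suc n)
    show ?case
    proof (rule Ck_on_SucI)
      show "(flat k has_derivative (*) (flat (k + 2) x - real k * flat (k + 1) x)) (at x)" for x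
        using flat_deriv has_field_derivative_def by blast
      have "Ck_on n UNIV (\<lambda>x. (flat (k + 2) x + (- real k) * flat (k + 1) x) * e)" for e
        by (intro Ck_on_bilinear[OF bounded_bilinear_mult] Ck_on_add Ck_on_const Suc.IH open_UNIV)
      then show "Ck_on n UNIV (\<lambda>x. (flat (k + 2) x - real k * flat (k + 1) x) * e)" for e
        by simp
    qed simp
  qed
  then show ?thesis unfolding smooth_on_def by blast
qed

text \<open>The function is p/(p + q), where p is positive exactly inside radius \<open>R\<close>
  and q exactly outside radius \<open>r\<close>. As \<open>r < R\<close>, the two regions cover the
  space and the denominator never vanishes. Distances enter squared because the squared norm is
  smooth.\<close>

lemma smooth_bump:
  fixes x0 :: "'a::euclidean_space"
  assumes "0 < r" "r < R"
  obtains \<beta> :: "'a \<Rightarrow> real" where "smooth_on UNIV \<beta>" "\<And>x. x \<in> ball x0 r \<Longrightarrow> \<beta> x = 1"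
    "\<And>x. x \<notin> cball x0 R \<Longrightarrow> \<beta> x = 0"
proof
  define s where "s = (\<lambda>x. (x - x0) \<bullet> (x - x0))"
  define p where "p = (\<lambda>x. flat 0 (R\<^sup>2 - s x))"
  define q where "q = (\<lambda>x. flat 0 (s x - r\<^sup>2))"
  have s_iff: "s x < t\<^sup>2 \<longleftrightarrow> dist x0 x < t" "s x \<le> t\<^sup>2 \<longleftrightarrow> dist x0 x \<le> t" if "t > 0" for x t
    using that power_mono_iff[of "dist x0 x" t 2] power_mono_iff[of t "dist x0 x" 2]
    by (auto simp: s_def dist_norm norm_minus_commute power2_norm_eq_inner[symmetric] not_le[symmetric])
  have "smooth_on UNIV (\<lambda>x. x + - x0)"
    by (intro smooth_on_add smooth_on_const smooth_on_id open_UNIV)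
  then have s: "smooth_on UNIV s"
    unfolding s_def by (intro smooth_on_inner open_UNIV) simp_all
  have "smooth_on UNIV (\<lambda>x. R\<^sup>2 + (-1) * s x)" "smooth_on UNIV (\<lambda>x. s x + - r\<^sup>2)"
    by (intro smooth_on_add smooth_on_const smooth_on_mult s open_UNIV)+
  then have pq: "smooth_on UNIV p" "smooth_on UNIV q"
    unfolding p_def q_def
    by (auto intro!: smooth_on_compose[OF open_UNIV open_UNIV smooth_flat])
  have nn: "p x \<ge> 0" "q x \<ge> 0" for x by (auto simp: p_def q_def flat_def)
  have "p x > 0 \<or> q x > 0" for x
  proof -
    have "r\<^sup>2 < R\<^sup>2" using assms by (simp add: power_strict_mono)
    then have "s x < R\<^sup>2 \<or> r\<^sup>2 < s x" by linarith
    then show ?thesis by (auto simp: p_def q_def flat_def)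
  qed
  then have pos: "p x + q x \<noteq> 0" for x using nn[of x] by (metis add_nonneg_eq_0_iff less_irrefl)
  show "smooth_on UNIV (\<lambda>x. p x * inverse (p x + q x))"
    by (intro smooth_on_mult smooth_on_inverse smooth_on_add pq pos open_UNIV)
  show "p x * inverse (p x + q x) = 1" if "x \<in> ball x0 r" for x
  proof -
    have "s x < r\<^sup>2" using that s_iff assms by simp
    then have "q x = 0" by (simp add: q_def flat_def)
    then show ?thesis using pos[of x] by simp
  qed
  show "p x * inverse (p x + q x) = 0" if "x \<notin> cball x0 R" for x
  proof -
    have "s x > R\<^sup>2" using that s_iff(2)[of R x] assms by simp
    then show ?thesis by (simp add: p_def flat_def)
  qed
qed

section \<open>Charts and tangent vectors\<close>

text \<open>Isolates the compatibility of charts, so that the same calculus serves the manifold, its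
  tangent bundle and the vertical bundle.\<close>

locale smooth_atlas =
  fixes \<B> :: "('p, 'e::euclidean_space) chart set"
  assumes inj: "c \<in> \<B> \<Longrightarrow> inj_on (snd c) (fst c)"
    and open_overlap: "c \<in> \<B> \<Longrightarrow> d \<in> \<B> \<Longrightarrow> open (snd c ` (fst c \<inter> fst d))"
    and smooth_transition: "c \<in> \<B> \<Longrightarrow> d \<in> \<B> \<Longrightarrow> smooth_on (snd c ` (fst c \<inter> fst d)) (transition c d)"
begin

lemma chart_inv_chart [simp]: "c \<in> \<B> \<Longrightarrow> p \<in> fst c \<Longrightarrow> chart_inv c (snd c p) = p"
  unfolding chart_inv_def by (simp add: inv_into_f_f[OF inj])

lemma open_image: "c \<in> \<B> \<Longrightarrow> open (snd c ` fst c)"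
  using open_overlap[of c c] by simp

lemma transition_chart: "c \<in> \<B> \<Longrightarrow> p \<in> fst c \<Longrightarrow> transition c d (snd c p) = snd d p"
  unfolding transition_def by simp

definition dtrans :: "('p, 'e) chart \<Rightarrow> ('p, 'e) chart \<Rightarrow> 'p \<Rightarrow> 'e \<Rightarrow> 'e" where
  "dtrans c d p = frechet_derivative (transition c d) (at (snd c p))"

lemma transition_has_derivative:
  assumes "c \<in> \<B>" "d \<in> \<B>" "p \<in> fst c" "p \<in> fst d"
  shows "(transition c d has_derivative dtrans c d p) (at (snd c p))"
  unfolding dtrans_def using assms
  by (intro smooth_on_has_derivative[OF smooth_transition]) auto

lemma linear_dtrans:
  "c \<in> \<B> \<Longrightarrow> d \<in> \<B> \<Longrightarrow> p \<in> fst c \<Longrightarrow> p \<in> fst d \<Longrightarrow> linear (dtrans c d p)"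
  using transition_has_derivative has_derivative_linear by blast

lemma dtrans_same:
  assumes "c \<in> \<B>" "p \<in> fst c"
  shows "dtrans c c p e = e"
proof -
  have "((\<lambda>x. x) has_derivative (\<lambda>x. x)) (at (snd c p))" by (rule has_derivative_ident)
  then have "(transition c c has_derivative (\<lambda>x. x)) (at (snd c p))"
    by (rule has_derivative_transform_within_open[OF _ open_image[OF assms(1)]])
      (use assms transition_chart[of c _ c] in auto)
  then show ?thesis unfolding dtrans_def using frechet_derivative_at by metis
qed

text \<open>The cocycle condition, which makes the coordinates collected in \<open>tvec_of\<close>
  consistent.\<close>

lemma dtrans_trans:
  assumes "c \<in> \<B>" "d \<in> \<B>" "c' \<in> \<B>" "p \<in> fst c" "p \<in> fst d" "p \<in> fst c'"
  shows "dtrans d c' p (dtrans c d p e) = dtrans c c' p e"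
proof -
  have "(transition d c' has_derivative dtrans d c' p) (at (transition c d (snd c p)))"
    using transition_has_derivative[of d c' p] assms by (simp add: transition_chart)
  from has_derivative_compose[OF transition_has_derivative this]
  have "((\<lambda>x. transition d c' (transition c d x)) has_derivative (\<lambda>e. dtrans d c' p (dtrans c d p e))) (at (snd c p))"
    using assms by blast
  then have "(transition c c' has_derivative (\<lambda>e. dtrans d c' p (dtrans c d p e))) (at (snd c p))"
    by (rule has_derivative_transform_within_open[OF _ open_overlap[OF assms(1,2)]])
      (use assms in \<open>auto simp: transition_chart\<close>)
  then show ?thesis unfolding dtrans_def[of c c'] using frechet_derivative_at by metis
qed

lemma tangent_spaceI:
  assumes "fst w = p"
    and "\<And>c d. c \<in> \<B> \<Longrightarrow> d \<in> \<B> \<Longrightarrow> p \<in> fst c \<Longrightarrow> p \<in> fst d \<Longrightarrow> snd w d = dtrans c d p (snd w c)"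
    and "\<And>c. c \<notin> \<B> \<or> p \<notin> fst c \<Longrightarrow> snd w c = 0"
  shows "w \<in> tangent_space \<B> p"
  using assms unfolding tangent_space_def dtrans_def by blast

lemma fst_tvec_of [simp]: "fst (tvec_of \<B>' c p e) = p"
  by (simp add: tvec_of_def)

lemma snd_tvec_of: "d \<in> \<B> \<Longrightarrow> p \<in> fst d \<Longrightarrow> snd (tvec_of \<B> c p e) d = dtrans c d p e"
  by (simp add: tvec_of_def dtrans_def)

lemma snd_tvec_of_same [simp]: "c \<in> \<B> \<Longrightarrow> p \<in> fst c \<Longrightarrow> snd (tvec_of \<B> c p e) c = e"
  by (simp add: snd_tvec_of dtrans_same)

lemma tvec_of_in_tangent_space:
  assumes "c \<in> \<B>" "p \<in> fst c"
  shows "tvec_of \<B> c p e \<in> tangent_space \<B> p"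
proof (rule tangent_spaceI)
  show "snd (tvec_of \<B> c p e) d' = dtrans d d' p (snd (tvec_of \<B> c p e) d)"
    if "d \<in> \<B>" "d' \<in> \<B>" "p \<in> fst d" "p \<in> fst d'" for d d'
    using dtrans_trans[of c d d' p e] that assms by (simp add: snd_tvec_of)
qed (auto simp: tvec_of_def)

lemma tangent_space_dtrans:
  assumes "w \<in> tangent_space \<B> p" "c \<in> \<B>" "d \<in> \<B>" "p \<in> fst c" "p \<in> fst d"
  shows "snd w d = dtrans c d p (snd w c)"
  using assms unfolding tangent_space_def dtrans_def by blast

lemma fst_tangent_space: "w \<in> tangent_space \<B> p \<Longrightarrow> fst w = p"
  unfolding tangent_space_def by blast

lemma tangent_space_zero: "w \<in> tangent_space \<B> p \<Longrightarrow> c \<notin> \<B> \<or> p \<notin> fst c \<Longrightarrow> snd w c = 0"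
  unfolding tangent_space_def by blast

text \<open>Coordinates in the other charts around \<open>p\<close> follow by \<open>dtrans\<close>,
  and the entries at all remaining charts are 0 by convention.\<close>

lemma tangent_space_eqI:
  assumes "w \<in> tangent_space \<B> p" "w' \<in> tangent_space \<B> p" "c \<in> \<B>" "p \<in> fst c" "snd w c = snd w' c"
  shows "w = w'"
proof (rule prod_eqI)
  show "fst w = fst w'" using assms(1,2) by (simp add: fst_tangent_space)
  have "snd w d = snd w' d" for d
  proof (cases "d \<in> \<B> \<and> p \<in> fst d")
    case True
    then show ?thesis using tangent_space_dtrans[of _ p c d] assms by metis
  next
    case False
    then show ?thesis using assms(1,2) by (simp add: tangent_space_zero)
  qed
  then show "snd w = snd w'" by blast
qed

lemma tadd_in_tangent_space:
  assumes "v \<in> tangent_space \<B> p" "w \<in> tangent_space \<B> p"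
  shows "tadd v w \<in> tangent_space \<B> p"
proof (rule tangent_spaceI)
  show "snd (tadd v w) d = dtrans c d p (snd (tadd v w) c)"
    if "c \<in> \<B>" "d \<in> \<B>" "p \<in> fst c" "p \<in> fst d" for c d
    using tangent_space_dtrans[OF assms(1) that] tangent_space_dtrans[OF assms(2) that] linear_dtrans[OF that]
    by (simp add: tadd_def linear_add)
qed (use assms in \<open>simp_all add: fst_tangent_space tangent_space_zero tadd_def\<close>)

lemma tscale_in_tangent_space:
  assumes "w \<in> tangent_space \<B> p"
  shows "tscale r w \<in> tangent_space \<B> p"
proof (rule tangent_spaceI)
  show "snd (tscale r w) d = dtrans c d p (snd (tscale r w) c)"
    if "c \<in> \<B>" "d \<in> \<B>" "p \<in> fst c" "p \<in> fst d" for c d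
    using tangent_space_dtrans[OF assms that] linear_dtrans[OF that]
    by (simp add: tscale_def linear_cmul)
qed (use assms in \<open>simp_all add: fst_tangent_space tangent_space_zero tscale_def\<close>)

lemma tzero_in_tangent_space: "tzero p \<in> tangent_space \<B> p"
  by (rule tangent_spaceI) (simp_all add: tzero_def linear_0[OF linear_dtrans])

lemma chart_at:
  assumes "p \<in> points \<B>"
  shows "chart_at \<B> p \<in> \<B>" "p \<in> fst (chart_at \<B> p)"
proof -
  have "\<exists>c. c \<in> \<B> \<and> p \<in> fst c" using assms unfolding points_def by blast
  from someI_ex[OF this] show "chart_at \<B> p \<in> \<B>" "p \<in> fst (chart_at \<B> p)"
    unfolding chart_at_def by blast+
qed

text \<open>\<open>dir_deriv\<close> and \<open>tmap\<close> are defined with the arbitrary chart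
  \<open>chart_at\<close>; this allows them to be computed in any chart around the point.\<close>

lemma frechet_derivative_change_chart:
  fixes g :: "'p \<Rightarrow> 'b::real_normed_vector"
  assumes w: "w \<in> tangent_space \<B> p" and c: "c \<in> \<B>" "d \<in> \<B>" "p \<in> fst c" "p \<in> fst d"
    and g: "((g \<circ> chart_inv c) has_derivative g') (at (snd c p))"
  shows "((g \<circ> chart_inv d) has_derivative (\<lambda>e. g' (dtrans d c p e))) (at (snd d p))"
    and "frechet_derivative (g \<circ> chart_inv d) (at (snd d p)) (snd w d) = g' (snd w c)"
proof -
  have "((g \<circ> chart_inv c) has_derivative g') (at (transition d c (snd d p)))"
    using g c by (simp add: transition_chart)
  from has_derivative_compose[OF transition_has_derivative this]
  have "((\<lambda>x. (g \<circ> chart_inv c) (transition d c x)) has_derivative (\<lambda>e. g' (dtrans d c p e))) (at (snd d p))"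
    using c by blast
  then show *: "((g \<circ> chart_inv d) has_derivative (\<lambda>e. g' (dtrans d c p e))) (at (snd d p))"
    by (rule has_derivative_transform_within_open[OF _ open_overlap[OF c(2,1)]])
      (use c in \<open>auto simp: transition_chart\<close>)
  show "frechet_derivative (g \<circ> chart_inv d) (at (snd d p)) (snd w d) = g' (snd w c)"
    using frechet_derivative_at[OF *] tangent_space_dtrans[OF w] c by metis
qed

lemma dir_deriv_eq:
  assumes "w \<in> tangent_space \<B> p" "c \<in> \<B>" "p \<in> fst c"
    and "((f \<circ> chart_inv c) has_derivative f') (at (snd c p))"
  shows "dir_deriv \<B> w f = f' (snd w c)"
proof -
  have "p \<in> points \<B>" using assms unfolding points_def by auto
  from frechet_derivative_change_chart(2)[OF assms(1,2) chart_at(1)[OF this] assms(3) chart_at(2)[OF this] assms(4)]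
  show ?thesis unfolding dir_deriv_def Let_def fst_tangent_space[OF assms(1)] .
qed

lemma tmap_coord:
  fixes f :: "'p \<Rightarrow> 'q" and \<C> :: "('q, 'f::real_normed_vector) chart set"
  assumes "w \<in> tangent_space \<B> p" "c \<in> \<B>" "p \<in> fst c" "d \<in> \<C>" "f p \<in> fst d"
    and "((snd d \<circ> f \<circ> chart_inv c) has_derivative f') (at (snd c p))"
  shows "snd (tmap \<B> \<C> f w) d = f' (snd w c)"
proof -
  have "p \<in> points \<B>" using assms unfolding points_def by auto
  from frechet_derivative_change_chart(2)[OF assms(1,2) chart_at(1)[OF this] assms(3) chart_at(2)[OF this] assms(6)]
  show ?thesis using assms(4,5) unfolding tmap_def Let_def fst_tangent_space[OF assms(1)] by simp
qed

lemma fst_tmap: "fst (tmap \<B> \<C> f w) = f (fst w)"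
  by (simp add: tmap_def Let_def)

lemma openin_iff:
  "openin (atlas_topology \<B>) S \<longleftrightarrow> S \<subseteq> points \<B> \<and> (\<forall>c\<in>\<B>. open (snd c ` (S \<inter> fst c)))"
  and topspace: "topspace (atlas_topology \<B>) = points \<B>"
  using openin_atlas_topology[OF inj open_overlap] by auto

lemma openin_chart_preimage:
  assumes "c \<in> \<B>" "open N" 
  shows "openin (atlas_topology \<B>) {p \<in> fst c. snd c p \<in> N}"
proof -
  have "open (snd d ` ({p \<in> fst c. snd c p \<in> N} \<inter> fst d))" if d: "d \<in> \<B>" for d
  proof -
    have "continuous_on (snd d ` (fst d \<inter> fst c)) (transition d c)"
      using smooth_on_continuous smooth_transition d assms by blast
    then have "open (snd d ` (fst d \<inter> fst c) \<inter> transition d c -` N)"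
      using continuous_on_open_vimage[OF open_overlap[OF d assms(1)]] assms(2) by (metis Int_commute)
    moreover have "snd d ` ({p \<in> fst c. snd c p \<in> N} \<inter> fst d) = snd d ` (fst d \<inter> fst c) \<inter> transition d c -` N"
      using d by (auto simp: transition_chart)
    ultimately show ?thesis by simp
  qed
  then show ?thesis using assms(1) unfolding openin_iff points_def by auto
qed

end

text \<open>Consistency in two target charts is the chain rule for \<open>transition d d'\<close>
  after the local expression of \<open>f\<close>. That factorization holds only while
  \<open>f\<close> stays in the domain of \<open>d\<close>, hence the neighbourhood
  \<open>N\<close>.\<close>

lemma (in smooth_atlas) tmap_in_tangent_space:
  fixes f :: "'p \<Rightarrow> 'q" and \<C> :: "('q, 'f::euclidean_space) chart set"
  assumes "smooth_atlas \<C>" and w: "w \<in> tangent_space \<B> p"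
    and f: "\<And>d. d \<in> \<C> \<Longrightarrow> f p \<in> fst d \<Longrightarrow> \<exists>c N f'. c \<in> \<B> \<and> p \<in> fst c \<and>
        ((snd d \<circ> f \<circ> chart_inv c) has_derivative f') (at (snd c p)) \<and>
        open N \<and> snd c p \<in> N \<and> (\<forall>x\<in>N. f (chart_inv c x) \<in> fst d)"
  shows "tmap \<B> \<C> f w \<in> tangent_space \<C> (f p)"
proof -
  interpret C: smooth_atlas \<C> by fact
  have "snd (tmap \<B> \<C> f w) d' = C.dtrans d d' (f p) (snd (tmap \<B> \<C> f w) d)"
    if d: "d \<in> \<C>" "d' \<in> \<C>" "f p \<in> fst d" "f p \<in> fst d'" for d d'
  proof -
    obtain c N f' where c: "c \<in> \<B>" "p \<in> fst c"
      and f': "((snd d \<circ> f \<circ> chart_inv c) has_derivative f') (at (snd c p))"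
      and N: "open N" "snd c p \<in> N" "\<forall>x\<in>N. f (chart_inv c x) \<in> fst d"
      using f[OF d(1,3)] by blast
    have "(transition d d' has_derivative C.dtrans d d' (f p)) (at ((snd d \<circ> f \<circ> chart_inv c) (snd c p)))"
      using C.transition_has_derivative d c by simp
    from has_derivative_compose[OF f' this]
    have *: "((\<lambda>x. transition d d' ((snd d \<circ> f \<circ> chart_inv c) x)) has_derivative (\<lambda>e. C.dtrans d d' (f p) (f' e))) (at (snd c p))" .
    have "((snd d' \<circ> f \<circ> chart_inv c) has_derivative (\<lambda>e. C.dtrans d d' (f p) (f' e))) (at (snd c p))"
      by (rule has_derivative_transform_within_open[OF * N(1,2)])
        (use N(3) d in \<open>auto simp: C.transition_chart\<close>)
    from tmap_coord[OF w c d(2,4) this] tmap_coord[OF w c d(1,3) f']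
    show ?thesis by simp
  qed
  moreover have "fst (tmap \<B> \<C> f w) = f p" by (simp add: fst_tmap fst_tangent_space[OF w])
  moreover have "\<forall>d. d \<notin> \<C> \<or> f p \<notin> fst d \<longrightarrow> snd (tmap \<B> \<C> f w) d = 0"
    using fst_tangent_space[OF w] by (auto simp: tmap_def Let_def)
  ultimately show ?thesis by (intro C.tangent_spaceI) blast+
qed

lemma smooth_manifold_imp_smooth_atlas: "smooth_manifold \<A> \<Longrightarrow> smooth_atlas \<A>"
  unfolding smooth_manifold_def by unfold_locales auto

lemma fst_tadd [simp]: "fst (tadd v w) = fst v"
  and snd_tadd [simp]: "snd (tadd v w) c = snd v c + snd w c"
  and fst_tscale [simp]: "fst (tscale r v) = fst v"
  and snd_tscale [simp]: "snd (tscale r v) c = r *\<^sub>R snd v c"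
  and fst_tzero [simp]: "fst (tzero p) = p"
  and snd_tzero [simp]: "snd (tzero p) c = 0"
  by (simp_all add: tadd_def tscale_def tzero_def)

section \<open>The tangent bundle\<close>

context smooth_atlas
begin

lemma tangent_bundle_iff: "v \<in> tangent_bundle \<B> \<longleftrightarrow> v \<in> tangent_space \<B> (fst v) \<and> fst v \<in> points \<B>"
  unfolding tangent_bundle_def by (auto simp: fst_tangent_space)

lemma fst_natural_chart: "v \<in> fst (natural_chart \<B> c) \<longleftrightarrow> v \<in> tangent_space \<B> (fst v) \<and> fst v \<in> points \<B> \<and> fst v \<in> fst c"
  by (auto simp: natural_chart_def tangent_bundle_iff)

lemma fst_natural_chart': "c \<in> \<B> \<Longrightarrow> v \<in> fst (natural_chart \<B> c) \<longleftrightarrow> v \<in> tangent_space \<B> (fst v) \<and> fst v \<in> fst c"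
  by (auto simp: fst_natural_chart points_def)

lemma snd_natural_chart [simp]: "snd (natural_chart \<B> c) v = (snd c (fst v), snd v c)"
  by (simp add: natural_chart_def)

lemma tvec_of_in_natural_chart:
  "c \<in> \<B> \<Longrightarrow> p \<in> fst c \<Longrightarrow> p \<in> fst d \<Longrightarrow> tvec_of \<B> c p y \<in> fst (natural_chart \<B> d)"
  using tvec_of_in_tangent_space unfolding fst_natural_chart points_def by auto

lemma natural_chart_image:
  assumes "c \<in> \<B>"
  shows "snd (natural_chart \<B> c) ` (fst (natural_chart \<B> c) \<inter> fst (natural_chart \<B> d)) =
    (snd c ` (fst c \<inter> fst d)) \<times> UNIV"
proof
  show "(snd c ` (fst c \<inter> fst d)) \<times> UNIV \<subseteq> snd (natural_chart \<B> c) ` (fst (natural_chart \<B> c) \<inter> fst (natural_chart \<B> d))"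
  proof clarify
    fix p y assume p: "p \<in> fst c" "p \<in> fst d"
    have "(snd c p, y) = snd (natural_chart \<B> c) (tvec_of \<B> c p y)" using p assms by simp
    then show "(snd c p, y) \<in> snd (natural_chart \<B> c) ` (fst (natural_chart \<B> c) \<inter> fst (natural_chart \<B> d))"
      using tvec_of_in_natural_chart assms p by blast
  qed
qed (auto simp: fst_natural_chart)

lemma inj_natural_chart:
  assumes "c \<in> \<B>"
  shows "inj_on (snd (natural_chart \<B> c)) (fst (natural_chart \<B> c))"
proof (rule inj_onI)
  fix v w assume "v \<in> fst (natural_chart \<B> c)" "w \<in> fst (natural_chart \<B> c)"
    "snd (natural_chart \<B> c) v = snd (natural_chart \<B> c) w"
  moreover from this have "fst v = fst w"
    using inj[OF assms] unfolding fst_natural_chart inj_on_def by auto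
  ultimately show "v = w"
    using tangent_space_eqI[of v "fst v" w c] assms unfolding fst_natural_chart by auto
qed

lemma chart_inv_natural_chart:
  assumes "c \<in> \<B>" "p \<in> fst c"
  shows "chart_inv (natural_chart \<B> c) (snd c p, y) = tvec_of \<B> c p y"
proof -
  have "(snd c p, y) = snd (natural_chart \<B> c) (tvec_of \<B> c p y)" using assms by simp
  then show ?thesis
    unfolding chart_inv_def
    using inv_into_f_f[OF inj_natural_chart tvec_of_in_natural_chart] assms by metis
qed

lemma transition_natural_chart:
  assumes "c \<in> \<B>" "d \<in> \<B>" "x \<in> snd c ` (fst c \<inter> fst d)"
  shows "transition (natural_chart \<B> c) (natural_chart \<B> d) (x, y) =
    (transition c d x, frechet_derivative (transition c d) (at x) y)"
  using assms
  by (auto simp: transition_def[of "natural_chart \<B> c"] chart_inv_natural_chart snd_tvec_of dtrans_def transition_chart)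

text \<open>Joint smoothness in point and vector: the Jacobian is smooth in the point and linear in
  the vector.\<close>

lemma smooth_on_dtrans:
  assumes "c \<in> \<B>" "d \<in> \<B>"
  shows "smooth_on ((snd c ` (fst c \<inter> fst d)) \<times> UNIV) (\<lambda>u. frechet_derivative (transition c d) (at (fst u)) (snd u))"
proof (rule smooth_on_linear_family[where T = "\<lambda>u. frechet_derivative (transition c d) (at (fst u))" and h = snd])
  show o: "open ((snd c ` (fst c \<inter> fst d)) \<times> UNIV)"
    by (intro open_Times open_overlap assms open_UNIV)
  show "smooth_on ((snd c ` (fst c \<inter> fst d)) \<times> UNIV) (\<lambda>u. frechet_derivative (transition c d) (at (fst u)) i)" for i
    by (rule smooth_on_compose[OF o open_overlap[OF assms] smooth_on_frechet[OF smooth_transition[OF assms]]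
        smooth_on_fst[OF o smooth_on_id[OF o]]]) auto
  show "linear (frechet_derivative (transition c d) (at (fst u)))" if "u \<in> (snd c ` (fst c \<inter> fst d)) \<times> UNIV" for u
    using that linear_dtrans[OF assms] unfolding dtrans_def by auto
qed (intro smooth_on_snd smooth_on_id open_Times open_overlap assms open_UNIV)+

lemma smooth_atlas_tangent_atlas: "smooth_atlas (tangent_atlas \<B>)"
proof
  show "inj_on (snd C) (fst C)" if "C \<in> tangent_atlas \<B>" for C
    using that inj_natural_chart unfolding tangent_atlas_def by auto
next
  fix C D assume "C \<in> tangent_atlas \<B>" "D \<in> tangent_atlas \<B>"
  then obtain c d where c: "c \<in> \<B>" "d \<in> \<B>" and CD: "C = natural_chart \<B> c" "D = natural_chart \<B> d"
    unfolding tangent_atlas_def by auto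
  let ?O = "(snd c ` (fst c \<inter> fst d)) \<times> (UNIV :: 'e set)"
  show o: "open (snd C ` (fst C \<inter> fst D))"
    unfolding CD natural_chart_image[OF c(1)] by (intro open_Times open_overlap c open_UNIV)
  have "smooth_on ?O (\<lambda>u. (transition c d (fst u), frechet_derivative (transition c d) (at (fst u)) (snd u)))"
    using o unfolding CD natural_chart_image[OF c(1)]
    by (intro smooth_on_Pair smooth_on_dtrans[OF c]
        smooth_on_compose[OF _ open_overlap[OF c] smooth_transition[OF c]] smooth_on_fst smooth_on_id) auto
  then have "smooth_on ?O (transition C D)"
    using o unfolding CD natural_chart_image[OF c(1)]
    by (subst smooth_on_cong) (auto simp: transition_natural_chart[OF c])
  then show "smooth_on (snd C ` (fst C \<inter> fst D)) (transition C D)"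
    unfolding CD natural_chart_image[OF c(1)] .
qed

lemma natural_chart_in_tangent_atlas: "c \<in> \<B> \<Longrightarrow> natural_chart \<B> c \<in> tangent_atlas \<B>"
  unfolding tangent_atlas_def by simp

lemma tangent_atlasE:
  assumes "C \<in> tangent_atlas \<B>"
  obtains c where "c \<in> \<B>" "C = natural_chart \<B> c"
  using assms unfolding tangent_atlas_def by blast

text \<open>The Jacobian of the change of natural coordinates is block triangular. Only the base
  block and the vertical block are extracted; the remaining block, which holds second derivatives of
  the coordinate change, is avoided.\<close>

lemma has_derivative_natural_transition:
  assumes c: "c \<in> \<B>" "d \<in> \<B>" and v: "v \<in> fst (natural_chart \<B> c)" "v \<in> fst (natural_chart \<B> d)"
  defines "L \<equiv> smooth_atlas.dtrans (natural_chart \<B> c) (natural_chart \<B> d) v"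
  shows "fst (L w) = dtrans c d (fst v) (fst w)"
    and "L (0, e) = (0, dtrans c d (fst v) e)"
proof -
  interpret T: smooth_atlas "tangent_atlas \<B>" by (rule smooth_atlas_tangent_atlas)
  let ?O = "(snd c ` (fst c \<inter> fst d)) \<times> (UNIV :: 'e set)"
  let ?t = "transition (natural_chart \<B> c) (natural_chart \<B> d)"
  have O: "open ?O" by (intro open_Times open_overlap c open_UNIV)
  have p: "fst v \<in> fst c" "fst v \<in> fst d" using v by (auto simp: fst_natural_chart)
  have L: "(?t has_derivative L) (at (snd c (fst v), snd v c))"
    using T.transition_has_derivative[of "natural_chart \<B> c" "natural_chart \<B> d" v] v c
    unfolding L_def by (simp add: natural_chart_in_tangent_atlas)
  have "((\<lambda>u. transition c d (fst u)) has_derivative (\<lambda>w. dtrans c d (fst v) (fst w))) (at (snd c (fst v), snd v c))"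
    using has_derivative_compose[OF has_derivative_fst[OF has_derivative_ident]] transition_has_derivative[OF c p]
    by (metis fst_conv)
  then have "((\<lambda>u. fst (?t u)) has_derivative (\<lambda>w. dtrans c d (fst v) (fst w))) (at (snd c (fst v), snd v c))"
    by (rule has_derivative_transform_within_open[OF _ O])
      (use p in \<open>auto simp: transition_natural_chart[OF c]\<close>)
  then have 1: "fst (L w) = dtrans c d (fst v) (fst w)" for w
    using has_derivative_unique has_derivative_fst[OF L] by metis
  then show "fst (L w) = dtrans c d (fst v) (fst w)" .
  have lin: "linear (dtrans c d (fst v))" using linear_dtrans[OF c p] .
  \<comment> \<open>Along a line in the fibre the coordinate change is affine in \<open>s\<close>,
    so its velocity can be read off and compared with \<open>L\<close>.\<close>
  have "((\<lambda>s. ?t (snd c (fst v), snd v c + s *\<^sub>R e)) has_derivative (\<lambda>s. L (0, s *\<^sub>R e))) (at 0)"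
    by (rule has_derivative_compose[where g = ?t and f = "\<lambda>s. (snd c (fst v), snd v c + s *\<^sub>R e)"])
      (use L in \<open>auto intro!: derivative_eq_intros\<close>)
  then have *: "((\<lambda>s. snd (?t (snd c (fst v), snd v c + s *\<^sub>R e))) has_derivative (\<lambda>s. snd (L (0, s *\<^sub>R e)))) (at 0)"
    by (rule has_derivative_snd)
  have "(\<lambda>s. snd (?t (snd c (fst v), snd v c + s *\<^sub>R e))) = (\<lambda>s. dtrans c d (fst v) (snd v c) + s *\<^sub>R dtrans c d (fst v) e)"
    using p by (simp add: transition_natural_chart[OF c] dtrans_def[symmetric] linear_add[OF lin] linear_cmul[OF lin])
  moreover have "((\<lambda>s. dtrans c d (fst v) (snd v c) + s *\<^sub>R dtrans c d (fst v) e) has_derivative (\<lambda>s. s *\<^sub>R dtrans c d (fst v) e)) (at 0)"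
    by (auto intro!: derivative_eq_intros)
  ultimately have "(\<lambda>s. snd (L (0, s *\<^sub>R e))) = (\<lambda>s. s *\<^sub>R dtrans c d (fst v) e)"
    using has_derivative_unique[OF *] by simp
  from fun_cong[OF this, of 1] have "snd (L (0, e)) = dtrans c d (fst v) e" by simp
  moreover have "fst (L (0, e)) = 0" using 1 linear_0[OF lin] by simp
  ultimately show "L (0, e) = (0, dtrans c d (fst v) e)" by (metis prod.collapse)
qed

end

section \<open>Sections of vector bundles\<close>

text \<open>The chart \<open>c\<close> provides coordinates \<open>\<kappa> c\<close> on the base and the linear coordinate
  \<open>\<lambda>w. snd w (\<sigma> c)\<close> on the fibres. With suitable parameters the sections are the vector fields
  on the manifold, the vector fields on \<open>A\<close>, and the anisotropic vector fields.\<close>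
locale vector_bundle =
  fixes I :: "'c set" and \<kappa> :: "'c \<Rightarrow> ('s, 'b::euclidean_space) chart" and S :: "'s set"
    and \<sigma> :: "'c \<Rightarrow> ('q, 'e::euclidean_space) chart" and F :: "'s \<Rightarrow> ('q, 'e) tvec set"
  assumes base: "smooth_atlas (\<kappa> ` I)"
    and open_domain: "c \<in> I \<Longrightarrow> open (snd (\<kappa> c) ` (fst (\<kappa> c) \<inter> S))"
    and cover: "u \<in> S \<Longrightarrow> \<exists>c\<in>I. u \<in> fst (\<kappa> c)"
    and fibre_ex: "c \<in> I \<Longrightarrow> u \<in> S \<Longrightarrow> u \<in> fst (\<kappa> c) \<Longrightarrow> \<exists>w\<in>F u. snd w (\<sigma> c) = e"
    and fibre_eqI: "c \<in> I \<Longrightarrow> u \<in> S \<Longrightarrow> u \<in> fst (\<kappa> c) \<Longrightarrow> w \<in> F u \<Longrightarrow> w' \<in> F u \<Longrightarrow>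
      snd w (\<sigma> c) = snd w' (\<sigma> c) \<Longrightarrow> w = w'"
    and fibre_tadd: "u \<in> S \<Longrightarrow> w \<in> F u \<Longrightarrow> w' \<in> F u \<Longrightarrow> tadd w w' \<in> F u"
    and fibre_tscale: "u \<in> S \<Longrightarrow> w \<in> F u \<Longrightarrow> tscale r w \<in> F u"
    and fibre_transition: "c \<in> I \<Longrightarrow> d \<in> I \<Longrightarrow>
      \<exists>t. smooth_on (snd (\<kappa> c) ` (fst (\<kappa> c) \<inter> fst (\<kappa> d))) t \<and>
        (\<forall>u\<in>S. u \<in> fst (\<kappa> c) \<longrightarrow> u \<in> fst (\<kappa> d) \<longrightarrow>
           (\<forall>w\<in>F u. snd w (\<sigma> c) = e \<longrightarrow> snd w (\<sigma> d) = t (snd (\<kappa> c) u)))"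
begin

sublocale base: smooth_atlas "\<kappa> ` I" by (rule base)

definition cdom :: "'c \<Rightarrow> 'b set" where
  "cdom c = snd (\<kappa> c) ` (fst (\<kappa> c) \<inter> S)"

definition crd :: "'c \<Rightarrow> ('s \<Rightarrow> ('q, 'e) tvec) \<Rightarrow> 'b \<Rightarrow> 'e" where
  "crd c Z = (\<lambda>x. snd (Z (chart_inv (\<kappa> c) x)) (\<sigma> c))"

definition sections :: "('s \<Rightarrow> ('q, 'e) tvec) set" where
  "sections = {Z \<in> \<Pi>\<^sub>E u\<in>S. F u. \<forall>c\<in>I. smooth_on (cdom c) (crd c Z)}"

lemma open_cdom: "c \<in> I \<Longrightarrow> open (cdom c)"
  using open_domain unfolding cdom_def .

lemma in_cdom: "u \<in> S \<Longrightarrow> u \<in> fst (\<kappa> c) \<Longrightarrow> snd (\<kappa> c) u \<in> cdom c"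
  unfolding cdom_def by blast

lemma chart_inv [simp]: "c \<in> I \<Longrightarrow> u \<in> fst (\<kappa> c) \<Longrightarrow> chart_inv (\<kappa> c) (snd (\<kappa> c) u) = u"
  by (rule base.chart_inv_chart) auto

lemma crd_chart [simp]: "c \<in> I \<Longrightarrow> u \<in> fst (\<kappa> c) \<Longrightarrow> crd c Z (snd (\<kappa> c) u) = snd (Z u) (\<sigma> c)"
  unfolding crd_def by simp

lemma section_fibre: "Z \<in> sections \<Longrightarrow> u \<in> S \<Longrightarrow> Z u \<in> F u"
  unfolding sections_def by (auto simp: PiE_iff)

lemma section_undefined: "Z \<in> sections \<Longrightarrow> u \<notin> S \<Longrightarrow> Z u = undefined"
  unfolding sections_def by (auto simp: PiE_iff extensional_def)

lemma smooth_crd: "Z \<in> sections \<Longrightarrow> c \<in> I \<Longrightarrow> smooth_on (cdom c) (crd c Z)"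
  unfolding sections_def by blast

lemma crd_has_derivative:
  "Z \<in> sections \<Longrightarrow> c \<in> I \<Longrightarrow> u \<in> S \<Longrightarrow> u \<in> fst (\<kappa> c) \<Longrightarrow>
    (crd c Z has_derivative frechet_derivative (crd c Z) (at (snd (\<kappa> c) u))) (at (snd (\<kappa> c) u))"
  using smooth_on_has_derivative[OF smooth_crd] in_cdom by blast

lemma sectionsI:
  assumes "\<And>u. u \<in> S \<Longrightarrow> Z u \<in> F u" "\<And>u. u \<notin> S \<Longrightarrow> Z u = undefined"
    and "\<And>c. c \<in> I \<Longrightarrow> smooth_on (cdom c) (crd c Z)"
  shows "Z \<in> sections"
  using assms unfolding sections_def by (auto simp: PiE_iff extensional_def)

lemma sections_eqI:
  assumes "Z \<in> sections" "Z' \<in> sections"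
    and "\<And>u. u \<in> S \<Longrightarrow> \<exists>c\<in>I. u \<in> fst (\<kappa> c) \<and> snd (Z u) (\<sigma> c) = snd (Z' u) (\<sigma> c)"
  shows "Z = Z'"
proof
  fix u
  show "Z u = Z' u"
  proof (cases "u \<in> S")
    case True
    then show ?thesis using assms section_fibre fibre_eqI by meson
  next
    case False
    then show ?thesis using assms(1,2) by (simp add: section_undefined)
  qed
qed

lemma field_add_in_sections:
  assumes "Z \<in> sections" "Z' \<in> sections"
  shows "field_add S Z Z' \<in> sections"
proof (rule sectionsI)
  fix c assume c: "c \<in> I"
  have "smooth_on (cdom c) (\<lambda>x. crd c Z x + crd c Z' x)"
    using c assms by (intro smooth_on_add open_cdom smooth_crd)
  then show "smooth_on (cdom c) (crd c (field_add S Z Z'))"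
    by (subst smooth_on_cong[OF open_cdom[OF c]]) (use c in \<open>auto simp: crd_def field_add_def cdom_def\<close>)
qed (use assms section_fibre fibre_tadd in \<open>auto simp: field_add_def\<close>)

abbreviation FF :: "('s \<Rightarrow> real) set" where
  "FF \<equiv> smooth_functions (\<kappa> ` I) S"

lemma smooth_function: "f \<in> FF \<Longrightarrow> c \<in> I \<Longrightarrow> smooth_on (cdom c) (f \<circ> chart_inv (\<kappa> c))"
  unfolding smooth_functions_def cdom_def by blast

lemma functionsI: "(\<And>c. c \<in> I \<Longrightarrow> smooth_on (cdom c) (f \<circ> chart_inv (\<kappa> c))) \<Longrightarrow> f \<in> FF"
  unfolding smooth_functions_def cdom_def by blast

lemma const_function: "(\<lambda>_. r) \<in> FF"
  by (intro functionsI) (auto simp: o_def)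

lemma field_scale_in_sections:
  assumes "f \<in> FF" "Z \<in> sections"
  shows "field_scale S f Z \<in> sections"
proof (rule sectionsI)
  fix c assume c: "c \<in> I"
  have "smooth_on (cdom c) (\<lambda>x. (f \<circ> chart_inv (\<kappa> c)) x *\<^sub>R crd c Z x)"
    using c assms by (intro smooth_on_scaleR open_cdom smooth_crd smooth_function)
  then show "smooth_on (cdom c) (crd c (field_scale S f Z))"
    by (subst smooth_on_cong[OF open_cdom[OF c]]) (use c in \<open>auto simp: crd_def field_scale_def cdom_def\<close>)
qed (use assms section_fibre fibre_tscale in \<open>auto simp: field_scale_def\<close>)

text \<open>The locale names no zero vector; \<open>tscale 0 w\<close> takes its place, and its
  coordinates vanish at every chart.\<close>

lemma fibre_zero:
  assumes "c \<in> I" "u \<in> S" "u \<in> fst (\<kappa> c)" "w \<in> F u" "snd w (\<sigma> c) = 0"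
  shows "snd w d = 0"
proof -
  have "w = tscale 0 w"
    using assms fibre_tscale by (intro fibre_eqI[OF assms(1-3)]) auto
  then have "snd w d = snd (tscale 0 w) d" by (rule arg_cong)
  then show ?thesis by simp
qed

definition fvec :: "'c \<Rightarrow> 's \<Rightarrow> 'e \<Rightarrow> ('q, 'e) tvec" where
  "fvec c u e = (SOME w. w \<in> F u \<and> snd w (\<sigma> c) = e)"

lemma fvec:
  assumes "c \<in> I" "u \<in> S" "u \<in> fst (\<kappa> c)"
  shows "fvec c u e \<in> F u" "snd (fvec c u e) (\<sigma> c) = e"
proof -
  have "\<exists>w. w \<in> F u \<and> snd w (\<sigma> c) = e" using fibre_ex[OF assms] by blast
  from someI_ex[OF this] show "fvec c u e \<in> F u" "snd (fvec c u e) (\<sigma> c) = e"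
    unfolding fvec_def by blast+
qed

text \<open>The locale provides only a smooth new coordinate for each fixed vector \<open>e\<close>.
  Linearity in \<open>e\<close> comes from the fibre operations, and then finitely many frame
  functions determine the change of fibre coordinates.\<close>

lemma transition_frame:
  assumes "c \<in> I" "d \<in> I"
  obtains t :: "'e \<Rightarrow> 'b \<Rightarrow> 'e" where
    "\<And>e. smooth_on (snd (\<kappa> c) ` (fst (\<kappa> c) \<inter> fst (\<kappa> d))) (t e)"
    "\<And>u w. u \<in> S \<Longrightarrow> u \<in> fst (\<kappa> c) \<Longrightarrow> u \<in> fst (\<kappa> d) \<Longrightarrow> w \<in> F u \<Longrightarrow>
       snd w (\<sigma> d) = (\<Sum>i\<in>Basis. (snd w (\<sigma> c) \<bullet> i) *\<^sub>R t i (snd (\<kappa> c) u))"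
proof -
  obtain t where t: "\<And>e. smooth_on (snd (\<kappa> c) ` (fst (\<kappa> c) \<inter> fst (\<kappa> d))) (t e)"
    "\<And>e u w. u \<in> S \<Longrightarrow> u \<in> fst (\<kappa> c) \<Longrightarrow> u \<in> fst (\<kappa> d) \<Longrightarrow> w \<in> F u \<Longrightarrow> snd w (\<sigma> c) = e \<Longrightarrow>
       snd w (\<sigma> d) = t e (snd (\<kappa> c) u)"
    using fibre_transition[OF assms] by metis
  have "snd w (\<sigma> d) = (\<Sum>i\<in>Basis. (snd w (\<sigma> c) \<bullet> i) *\<^sub>R t i (snd (\<kappa> c) u))"
    if u: "u \<in> S" "u \<in> fst (\<kappa> c)" "u \<in> fst (\<kappa> d)" and w: "w \<in> F u" for u w
  proof -
    let ?L = "\<lambda>e. snd (fvec c u e) (\<sigma> d)"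
    note f = fvec[OF assms(1) u(1,2)]
    have "linear ?L"
    proof (rule linearI)
      fix x y r
      have "fvec c u (x + y) = tadd (fvec c u x) (fvec c u y)"
        by (rule fibre_eqI[OF assms(1) u(1,2)]) (simp_all add: f fibre_tadd u)
      then show "?L (x + y) = ?L x + ?L y" by simp
      have "fvec c u (r *\<^sub>R x) = tscale r (fvec c u x)"
        by (rule fibre_eqI[OF assms(1) u(1,2)]) (simp_all add: f fibre_tscale u)
      then show "?L (r *\<^sub>R x) = r *\<^sub>R ?L x" by simp
    qed
    moreover have "w = fvec c u (snd w (\<sigma> c))"
      by (rule fibre_eqI[OF assms(1) u(1,2) w]) (simp_all add: f)
    moreover have "?L i = t i (snd (\<kappa> c) u)" for i
      using t(2)[OF u f] .
    ultimately show ?thesis using linear_basis_sum[of ?L "snd w (\<sigma> c)"] by simp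
  qed
  with t(1) that show thesis by blast
qed

text \<open>In the product rule every derivative of a frame function is multiplied by a coordinate
  of \<open>Z\<close> at \<open>u\<close>, which is 0. What remains transforms like a vector of the
  fibre: the intrinsic derivative of a section at a zero.\<close>

lemma derivative_vanishing_section:
  assumes c: "c \<in> I" "d \<in> I" and u: "u \<in> S" "u \<in> fst (\<kappa> c)" "u \<in> fst (\<kappa> d)"
    and Z: "Z \<in> sections" "snd (Z u) (\<sigma> c) = 0"
    and w: "w \<in> F u" "snd w (\<sigma> c) = frechet_derivative (crd c Z) (at (snd (\<kappa> c) u)) \<xi>"
  shows "frechet_derivative (crd d Z) (at (snd (\<kappa> d) u)) (base.dtrans (\<kappa> c) (\<kappa> d) u \<xi>) = snd w (\<sigma> d)"
proof -
  let ?x = "snd (\<kappa> c) u" and ?O = "snd (\<kappa> c) ` (fst (\<kappa> c) \<inter> fst (\<kappa> d))"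
  obtain t where t: "\<And>e. smooth_on ?O (t e)"
    "\<And>u w. u \<in> S \<Longrightarrow> u \<in> fst (\<kappa> c) \<Longrightarrow> u \<in> fst (\<kappa> d) \<Longrightarrow> w \<in> F u \<Longrightarrow>
       snd w (\<sigma> d) = (\<Sum>i\<in>Basis. (snd w (\<sigma> c) \<bullet> i) *\<^sub>R t i (snd (\<kappa> c) u))"
    using transition_frame[OF c] by blast
  have k: "\<kappa> c \<in> \<kappa> ` I" "\<kappa> d \<in> \<kappa> ` I" using c by auto
  have O: "open (?O \<inter> cdom c)" by (intro open_Int open_cdom c base.open_overlap k)
  have x: "?x \<in> ?O \<inter> cdom c" using u by (auto simp: cdom_def)
  let ?D = "frechet_derivative (crd c Z) (at ?x)"
  have tD: "(t i has_derivative frechet_derivative (t i) (at ?x)) (at ?x)" for i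
    using smooth_on_has_derivative[OF t(1)] x by blast
  have "((\<lambda>x. \<Sum>i\<in>Basis. (crd c Z x \<bullet> i) *\<^sub>R t i x) has_derivative
      (\<lambda>e. \<Sum>i\<in>Basis. (crd c Z ?x \<bullet> i) *\<^sub>R frechet_derivative (t i) (at ?x) e + (?D e \<bullet> i) *\<^sub>R t i ?x)) (at ?x)"
    by (intro has_derivative_sum has_derivative_scaleR has_derivative_inner_left tD crd_has_derivative c u Z)
  then have 1: "((\<lambda>x. \<Sum>i\<in>Basis. (crd c Z x \<bullet> i) *\<^sub>R t i x) has_derivative
      (\<lambda>e. \<Sum>i\<in>Basis. (?D e \<bullet> i) *\<^sub>R t i ?x)) (at ?x)"
    using Z(2) c u by simp
  have "(crd d Z has_derivative frechet_derivative (crd d Z) (at (snd (\<kappa> d) u))) (at (transition (\<kappa> c) (\<kappa> d) ?x))"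
    using crd_has_derivative[OF Z(1) c(2) u(1,3)] base.transition_chart[OF k(1) u(2)] by simp
  from has_derivative_compose[OF base.transition_has_derivative[OF k u(2,3)] this]
  have "((\<lambda>x. crd d Z (transition (\<kappa> c) (\<kappa> d) x)) has_derivative
      (\<lambda>e. frechet_derivative (crd d Z) (at (snd (\<kappa> d) u)) (base.dtrans (\<kappa> c) (\<kappa> d) u e))) (at ?x)" .
  then have "((\<lambda>x. \<Sum>i\<in>Basis. (crd c Z x \<bullet> i) *\<^sub>R t i x) has_derivative
      (\<lambda>e. frechet_derivative (crd d Z) (at (snd (\<kappa> d) u)) (base.dtrans (\<kappa> c) (\<kappa> d) u e))) (at ?x)"
  proof (rule has_derivative_transform_within_open[OF _ O x])
    fix y assume "y \<in> ?O \<inter> cdom c"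
    then obtain q where q: "y = snd (\<kappa> c) q" "q \<in> fst (\<kappa> c)" "q \<in> S" "q \<in> fst (\<kappa> d)"
      using base.inj[OF k(1)] unfolding cdom_def inj_on_def by blast
    show "crd d Z (transition (\<kappa> c) (\<kappa> d) y) = (\<Sum>i\<in>Basis. (crd c Z y \<bullet> i) *\<^sub>R t i y)"
      using t(2)[OF q(3,2,4) section_fibre[OF Z(1) q(3)]] q c by (simp add: base.transition_chart[OF k(1)])
  qed
  from has_derivative_unique[OF this 1]
  have "frechet_derivative (crd d Z) (at (snd (\<kappa> d) u)) (base.dtrans (\<kappa> c) (\<kappa> d) u \<xi>)
      = (\<Sum>i\<in>Basis. (?D \<xi> \<bullet> i) *\<^sub>R t i ?x)" by meson
  also have "\<dots> = snd w (\<sigma> d)" using t(2)[OF u w(1)] w(2) by simp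
  finally show ?thesis .
qed

subsection \<open>Extension of local sections\<close>

text \<open>Says that the closure of the support, relative to \<open>S\<close>, stays inside the
  domain of \<open>c\<close>. It is phrased with coordinate neighbourhoods because the locale puts
  no topology on \<open>S\<close>.\<close>

definition supported :: "'c \<Rightarrow> ('s \<Rightarrow> real) \<Rightarrow> bool" where
  "supported c b \<longleftrightarrow> c \<in> I \<and>
     (\<forall>d\<in>I. \<forall>u\<in>S. u \<in> fst (\<kappa> d) \<longrightarrow> u \<notin> fst (\<kappa> c) \<longrightarrow>
        (\<exists>V. open V \<and> snd (\<kappa> d) u \<in> V \<and>
          (\<forall>u'\<in>S. u' \<in> fst (\<kappa> d) \<longrightarrow> snd (\<kappa> d) u' \<in> V \<longrightarrow> b u' = 0)))"

definition cutoff :: "'c \<Rightarrow> ('s \<Rightarrow> real) \<Rightarrow> bool" where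
  "cutoff c b \<longleftrightarrow> supported c b \<and> b \<in> FF"

lemma cutoffD: "cutoff c b \<Longrightarrow> c \<in> I" "cutoff c b \<Longrightarrow> b \<in> FF" "cutoff c b \<Longrightarrow> supported c b"
  unfolding cutoff_def supported_def by blast+

lemma supportedE:
  assumes "supported c b" "d \<in> I" "u \<in> S" "u \<in> fst (\<kappa> d)" "u \<notin> fst (\<kappa> c)"
  obtains V where "open V" "snd (\<kappa> d) u \<in> V"
    "\<And>u'. u' \<in> S \<Longrightarrow> u' \<in> fst (\<kappa> d) \<Longrightarrow> snd (\<kappa> d) u' \<in> V \<Longrightarrow> b u' = 0"
  using assms unfolding supported_def by blast

text \<open>Off the domain of \<open>c\<close> the zero vector of the fibre has to be taken from
  some other chart.\<close>

definition extend :: "'c \<Rightarrow> ('s \<Rightarrow> real) \<Rightarrow> ('b \<Rightarrow> 'e) \<Rightarrow> 's \<Rightarrow> ('q, 'e) tvec" where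
  "extend c b g = (\<lambda>u\<in>S. if u \<in> fst (\<kappa> c) then fvec c u (b u *\<^sub>R g (snd (\<kappa> c) u))
     else fvec (SOME d. d \<in> I \<and> u \<in> fst (\<kappa> d)) u 0)"

definition extend_fun :: "'c \<Rightarrow> ('s \<Rightarrow> real) \<Rightarrow> ('b \<Rightarrow> real) \<Rightarrow> 's \<Rightarrow> real" where
  "extend_fun c b f u = (if u \<in> fst (\<kappa> c) then b u * f (snd (\<kappa> c) u) else 0)"

lemma extend_outside:
  assumes "u \<in> S" "u \<notin> fst (\<kappa> c)"
  shows "extend c b g u \<in> F u" "snd (extend c b g u) d = 0"
proof -
  define c' where "c' = (SOME d. d \<in> I \<and> u \<in> fst (\<kappa> d))"
  have "\<exists>d. d \<in> I \<and> u \<in> fst (\<kappa> d)" using cover[OF assms(1)] by blast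
  from someI_ex[OF this] have c': "c' \<in> I" "u \<in> fst (\<kappa> c')" unfolding c'_def by auto
  have *: "extend c b g u = fvec c' u 0" using assms unfolding extend_def c'_def by simp
  show "extend c b g u \<in> F u" unfolding * using fvec(1)[OF c'(1) assms(1) c'(2)] .
  show "snd (extend c b g u) d = 0"
    unfolding * using fibre_zero[OF c'(1) assms(1) c'(2)] fvec[OF c'(1) assms(1) c'(2)] by blast
qed

lemma extend_inside:
  assumes "c \<in> I" "u \<in> S" "u \<in> fst (\<kappa> c)"
  shows "extend c b g u \<in> F u" "snd (extend c b g u) (\<sigma> c) = b u *\<^sub>R g (snd (\<kappa> c) u)"
  using fvec[OF assms] assms unfolding extend_def by auto

text \<open>The gluing behind extension by zero: near a point in the domain of \<open>c\<close> the
  overlap hypothesis applies, and near any other point \<open>b\<close>, and with it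
  \<open>h\<close>, vanishes.\<close>

lemma smooth_on_supported:
  fixes h :: "'b \<Rightarrow> 'v::real_normed_vector"
  assumes b: "supported c b" and d: "d \<in> I"
    and ov: "smooth_on (snd (\<kappa> d) ` (fst (\<kappa> d) \<inter> fst (\<kappa> c)) \<inter> cdom d) h"
    and zero: "\<And>u. u \<in> S \<Longrightarrow> u \<in> fst (\<kappa> d) \<Longrightarrow> u \<notin> fst (\<kappa> c) \<or> b u = 0 \<Longrightarrow> h (snd (\<kappa> d) u) = 0"
  shows "smooth_on (cdom d) h"
proof (rule smooth_on_local)
  fix x assume "x \<in> cdom d"
  then obtain u where u: "x = snd (\<kappa> d) u" "u \<in> S" "u \<in> fst (\<kappa> d)" unfolding cdom_def by blast
  have c: "c \<in> I" using b unfolding supported_def by blast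
  show "\<exists>N. x \<in> N \<and> open N \<and> smooth_on (N \<inter> cdom d) h"
  proof (cases "u \<in> fst (\<kappa> c)")
    case True
    have "open (snd (\<kappa> d) ` (fst (\<kappa> d) \<inter> fst (\<kappa> c)))"
      by (intro base.open_overlap) (use c d in auto)
    moreover have "x \<in> snd (\<kappa> d) ` (fst (\<kappa> d) \<inter> fst (\<kappa> c))"
      unfolding u(1) by (intro imageI IntI u(3) True)
    ultimately show ?thesis using ov by (intro exI conjI)
  next
    case False
    from supportedE[OF b d u(2,3) this] obtain V where V: "open V" "x \<in> V"
      "\<And>u'. u'\<in>S \<Longrightarrow> u' \<in> fst (\<kappa> d) \<Longrightarrow> snd (\<kappa> d) u' \<in> V \<Longrightarrow> b u' = 0"
      unfolding u(1) by metis
    have "h y = 0" if "y \<in> V \<inter> cdom d" for y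
    proof -
      obtain u' where "y = snd (\<kappa> d) u'" "u' \<in> S" "u' \<in> fst (\<kappa> d)"
        using \<open>y \<in> V \<inter> cdom d\<close> unfolding cdom_def by blast
      then show ?thesis using zero V(3) that by simp
    qed
    then have "smooth_on (V \<inter> cdom d) h"
      by (subst smooth_on_cong[of _ _ "\<lambda>_. 0"]) (use V(1) open_cdom[OF d] in auto)
    with V show ?thesis by blast
  qed
qed

lemma smooth_on_transition_compose:
  fixes g :: "'b \<Rightarrow> 'v::real_normed_vector"
  assumes c: "c \<in> I" "d \<in> I" and g: "smooth_on (cdom c) g"
  shows "smooth_on (snd (\<kappa> d) ` (fst (\<kappa> d) \<inter> fst (\<kappa> c)) \<inter> cdom d) (\<lambda>x. g (transition (\<kappa> d) (\<kappa> c) x))"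
proof -
  have k: "\<kappa> c \<in> \<kappa> ` I" "\<kappa> d \<in> \<kappa> ` I" using c by auto
  show ?thesis
  proof (rule smooth_on_compose[OF _ open_cdom[OF c(1)] g])
    show "open (snd (\<kappa> d) ` (fst (\<kappa> d) \<inter> fst (\<kappa> c)) \<inter> cdom d)"
      by (intro open_Int open_cdom c base.open_overlap k)
    show "smooth_on (snd (\<kappa> d) ` (fst (\<kappa> d) \<inter> fst (\<kappa> c)) \<inter> cdom d) (transition (\<kappa> d) (\<kappa> c))"
      by (rule smooth_on_subset[OF base.smooth_transition[OF k(2,1)]]) blast
    show "transition (\<kappa> d) (\<kappa> c) ` (snd (\<kappa> d) ` (fst (\<kappa> d) \<inter> fst (\<kappa> c)) \<inter> cdom d) \<subseteq> cdom c"
    proof clarify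
      fix u assume u: "snd (\<kappa> d) u \<in> cdom d" "u \<in> fst (\<kappa> d)" "u \<in> fst (\<kappa> c)"
      then have "u \<in> S" using base.inj[OF k(2)] unfolding cdom_def inj_on_def by blast
      then show "transition (\<kappa> d) (\<kappa> c) (snd (\<kappa> d) u) \<in> cdom c"
        using u by (auto simp: base.transition_chart[OF k(2)] in_cdom)
    qed
  qed
qed

text \<open>Injectivity of the chart makes the preimage in the overlap and the preimage in
  \<open>S\<close> the same point.\<close>

lemma overlapE:
  assumes "d \<in> I" "x \<in> snd (\<kappa> d) ` (fst (\<kappa> d) \<inter> fst (\<kappa> c)) \<inter> cdom d"
  obtains u where "x = snd (\<kappa> d) u" "u \<in> S" "u \<in> fst (\<kappa> d)" "u \<in> fst (\<kappa> c)"
  using assms base.inj[of "\<kappa> d"] unfolding cdom_def inj_on_def by blast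

lemma open_overlap_cdom:
  "c \<in> I \<Longrightarrow> d \<in> I \<Longrightarrow> open (snd (\<kappa> d) ` (fst (\<kappa> d) \<inter> fst (\<kappa> c)) \<inter> cdom d)"
  by (intro open_Int open_cdom base.open_overlap) auto

lemma extend_fun_in_functions:
  assumes b: "cutoff c b" and f: "smooth_on (cdom c) f"
  shows "extend_fun c b f \<in> FF"
proof (rule functionsI)
  fix d assume d: "d \<in> I"
  have c: "c \<in> I" and bf: "b \<in> FF" using cutoffD b by auto
  note o = open_overlap_cdom[OF c d]
  have "smooth_on (snd (\<kappa> d) ` (fst (\<kappa> d) \<inter> fst (\<kappa> c)) \<inter> cdom d)
      (\<lambda>x. (b \<circ> chart_inv (\<kappa> d)) x * f (transition (\<kappa> d) (\<kappa> c) x))"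
    by (intro smooth_on_mult o smooth_on_transition_compose[OF c d f] smooth_on_subset[OF smooth_function[OF bf d]]) blast
  then have "smooth_on (snd (\<kappa> d) ` (fst (\<kappa> d) \<inter> fst (\<kappa> c)) \<inter> cdom d) (extend_fun c b f \<circ> chart_inv (\<kappa> d))"
    by (subst smooth_on_cong[OF o])
      (use d in \<open>auto elim!: overlapE[OF d] simp: extend_fun_def base.transition_chart\<close>)
  then show "smooth_on (cdom d) (extend_fun c b f \<circ> chart_inv (\<kappa> d))"
    by (rule smooth_on_supported[OF cutoffD(3)[OF b] d]) (use d in \<open>auto simp: extend_fun_def\<close>)
qed

text \<open>Smoothness is required in every chart \<open>d\<close>. On the overlap,
  \<open>transition_frame\<close> expresses the coordinates through \<open>b\<close>,
  \<open>g\<close> and frame functions; everywhere else \<open>smooth_on_supported\<close> takes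
  over.\<close>

lemma extend_in_sections:
  assumes b: "cutoff c b" and g: "smooth_on (cdom c) g"
  shows "extend c b g \<in> sections"
proof (rule sectionsI)
  have c: "c \<in> I" and bf: "b \<in> FF" using cutoffD b by auto
  show "extend c b g u \<in> F u" if "u \<in> S" for u
    using that extend_inside(1)[OF c] extend_outside(1) by blast
  show "extend c b g u = undefined" if "u \<notin> S" for u
    using that by (simp add: extend_def)
  fix d assume d: "d \<in> I"
  obtain t where t: "\<And>e. smooth_on (snd (\<kappa> c) ` (fst (\<kappa> c) \<inter> fst (\<kappa> d))) (t e)"
    "\<And>u w. u \<in> S \<Longrightarrow> u \<in> fst (\<kappa> c) \<Longrightarrow> u \<in> fst (\<kappa> d) \<Longrightarrow> w \<in> F u \<Longrightarrow>
       snd w (\<sigma> d) = (\<Sum>i\<in>Basis. (snd w (\<sigma> c) \<bullet> i) *\<^sub>R t i (snd (\<kappa> c) u))"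
    using transition_frame[OF c d] by blast
  note o = open_overlap_cdom[OF c d]
  let ?O = "snd (\<kappa> d) ` (fst (\<kappa> d) \<inter> fst (\<kappa> c)) \<inter> cdom d"
  let ?\<tau> = "transition (\<kappa> d) (\<kappa> c)"
  have k: "\<kappa> c \<in> \<kappa> ` I" "\<kappa> d \<in> \<kappa> ` I" using c d by auto
  have "smooth_on ?O (\<lambda>x. t i (?\<tau> x))" for i
  proof (rule smooth_on_compose[OF o base.open_overlap[OF k] t(1)])
    show "smooth_on ?O ?\<tau>" by (rule smooth_on_subset[OF base.smooth_transition[OF k(2,1)]]) blast
  qed (auto elim!: overlapE[OF d] simp: base.transition_chart[OF k(2)])
  then have sm: "smooth_on ?O (\<lambda>x. \<Sum>i\<in>Basis. (((b \<circ> chart_inv (\<kappa> d)) x *\<^sub>R g (?\<tau> x)) \<bullet> i) *\<^sub>R t i (?\<tau> x))"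
    by (intro smooth_on_sum smooth_on_scaleR smooth_on_inner smooth_on_const o
        smooth_on_transition_compose[OF c d g] smooth_on_subset[OF smooth_function[OF bf d]]) auto
  have eq: "crd d (extend c b g) x = (\<Sum>i\<in>Basis. (((b \<circ> chart_inv (\<kappa> d)) x *\<^sub>R g (?\<tau> x)) \<bullet> i) *\<^sub>R t i (?\<tau> x))"
    if "x \<in> ?O" for x
  proof -
    obtain u where u: "x = snd (\<kappa> d) u" "u \<in> S" "u \<in> fst (\<kappa> d)" "u \<in> fst (\<kappa> c)"
      by (rule overlapE[OF d \<open>x \<in> ?O\<close>])
    show ?thesis
      using t(2)[OF u(2,4,3) extend_inside(1)[OF c u(2,4)], of b g] extend_inside(2)[OF c u(2,4)] u d
      by (simp add: base.transition_chart[OF k(2)])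
  qed
  have "smooth_on ?O (crd d (extend c b g))"
    by (rule iffD2[OF smooth_on_cong[OF o eq] sm])
  then show "smooth_on (cdom d) (crd d (extend c b g))"
  proof (rule smooth_on_supported[OF cutoffD(3)[OF b] d])
    fix u assume u: "u \<in> S" "u \<in> fst (\<kappa> d)" "u \<notin> fst (\<kappa> c) \<or> b u = 0"
    show "crd d (extend c b g) (snd (\<kappa> d) u) = 0"
    proof (cases "u \<in> fst (\<kappa> c)")
      case True
      then show ?thesis
        using fibre_zero[OF c u(1) True extend_inside(1)[OF c u(1) True]] extend_inside(2)[OF c u(1) True] u d by simp
    next
      case False
      then show ?thesis using extend_outside(2)[OF u(1)] u d by simp
    qed
  qed
qed

lemma sections_eq_extendI:
  assumes "c \<in> I" "Z \<in> sections" "Z' \<in> sections"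
    and "\<And>u. u \<in> S \<Longrightarrow> u \<in> fst (\<kappa> c) \<Longrightarrow> snd (Z u) (\<sigma> c) = snd (Z' u) (\<sigma> c)"
    and "\<And>u d. u \<in> S \<Longrightarrow> u \<notin> fst (\<kappa> c) \<Longrightarrow> snd (Z u) d = snd (Z' u) d"
  shows "Z = Z'"
proof (rule sections_eqI[OF assms(2,3)])
  fix u assume u: "u \<in> S"
  show "\<exists>c\<in>I. u \<in> fst (\<kappa> c) \<and> snd (Z u) (\<sigma> c) = snd (Z' u) (\<sigma> c)"
    using assms(1,4,5) cover[OF u] u by (cases "u \<in> fst (\<kappa> c)") auto
qed

lemma cutoff_outside:
  assumes "cutoff c b" "u \<in> S" "u \<notin> fst (\<kappa> c)"
  shows "b u = 0"
  using cover[OF assms(2)] supportedE[OF cutoffD(3)[OF assms(1)] _ assms(2) _ assms(3)] assms(2) by metis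

text \<open>With a cutoff function \<open>b\<close> equal to \<open>1\<close> at \<open>q\<close>, \<open>b\<^sup>2 Z\<close> is a combination of the global
  sections extending the coordinate frame, and \<open>L (b\<^sup>2 Z) = L Z\<close>.\<close>
lemma tensorial_expansion:
  fixes L :: "('s \<Rightarrow> ('q, 'e) tvec) \<Rightarrow> 'v::real_vector"
  assumes b: "cutoff c b" and q: "q \<in> S" "q \<in> fst (\<kappa> c)" "b q = 1"
    and add: "\<And>Z Z'. Z \<in> sections \<Longrightarrow> Z' \<in> sections \<Longrightarrow> L (field_add S Z Z') = L Z + L Z'"
    and scale: "\<And>f Z. f \<in> FF \<Longrightarrow> Z \<in> sections \<Longrightarrow> L (field_scale S f Z) = f q *\<^sub>R L Z"
    and Z: "Z \<in> sections"
  shows "L Z = (\<Sum>i\<in>Basis. (snd (Z q) (\<sigma> c) \<bullet> i) *\<^sub>R L (extend c b (\<lambda>_. i)))"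
proof -
  have c: "c \<in> I" and bf: "b \<in> FF" using cutoffD b by auto
  let ?b = "b \<circ> chart_inv (\<kappa> c)"
  define z where "z = (\<lambda>i x. crd c Z x \<bullet> i)"
  have smz: "smooth_on (cdom c) (z i)" for i
    unfolding z_def by (intro smooth_on_inner open_cdom c smooth_crd Z smooth_on_const)
  have smb: "smooth_on (cdom c) ?b" using smooth_function[OF bf c] .
  have sm: "smooth_on (cdom c) (\<lambda>x. \<Sum>i\<in>B. (?b x * z i x) *\<^sub>R i)" if "finite B" for B
    using that by (intro smooth_on_sum smooth_on_scaleR smooth_on_mult open_cdom c smb smz smooth_on_const)
  \<comment> \<open>The sum carries one factor \<open>b\<close> and \<open>extend\<close> adds
    another. So each term splits into the global function \<open>extend_fun c b (z i)\<close> times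
    the global section extending the constant \<open>i\<close>, each holding one factor.\<close>
  have *: "L (extend c b (\<lambda>x. \<Sum>i\<in>B. (?b x * z i x) *\<^sub>R i)) =
      (\<Sum>i\<in>B. z i (snd (\<kappa> c) q) *\<^sub>R L (extend c b (\<lambda>_. i)))" if "finite B" for B
    using that
  proof (induction B)
    case empty
    have 0: "extend c b (\<lambda>_. 0) \<in> sections" by (intro extend_in_sections b smooth_on_const)
    \<comment> \<open>Being 0 times itself, the zero section is sent to 0 by the scaling
      rule.\<close>
    have "extend c b (\<lambda>_. 0) = field_scale S (\<lambda>_. 0) (extend c b (\<lambda>_. 0))"
      by (rule sections_eq_extendI[OF c 0 field_scale_in_sections[OF const_function 0]])
        (simp_all add: field_scale_def extend_inside[OF c] extend_outside)
    then have "L (extend c b (\<lambda>_. 0)) = 0 *\<^sub>R L (extend c b (\<lambda>_. 0))"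
      using scale[OF const_function 0] by metis
    then show ?case by simp
  next
    case (insert i B)
    have 1: "extend c b (\<lambda>x. \<Sum>i\<in>B. (?b x * z i x) *\<^sub>R i) \<in> sections"
      by (rule extend_in_sections[OF b sm[OF insert.hyps(1)]])
    have 2: "extend c b (\<lambda>_. i) \<in> sections" by (rule extend_in_sections[OF b]) auto
    have 3: "extend_fun c b (z i) \<in> FF" by (rule extend_fun_in_functions[OF b smz])
    have 4: "field_scale S (extend_fun c b (z i)) (extend c b (\<lambda>_. i)) \<in> sections"
      by (rule field_scale_in_sections[OF 3 2])
    have "extend c b (\<lambda>x. \<Sum>i\<in>insert i B. (?b x * z i x) *\<^sub>R i) =
        field_add S (field_scale S (extend_fun c b (z i)) (extend c b (\<lambda>_. i)))
          (extend c b (\<lambda>x. \<Sum>i\<in>B. (?b x * z i x) *\<^sub>R i))"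
      by (rule sections_eq_extendI[OF c extend_in_sections[OF b sm] field_add_in_sections[OF 4 1]])
        (use insert.hyps c in \<open>simp_all add: field_add_def field_scale_def extend_inside extend_outside
            extend_fun_def scaleR_add_right\<close>)
    then show ?case
      using add[OF 4 1] scale[OF 3 2] insert q by (simp add: extend_fun_def)
  qed
  have 5: "field_scale S b Z \<in> sections" by (rule field_scale_in_sections[OF bf Z])
  have 6: "field_scale S b (field_scale S b Z) \<in> sections" by (rule field_scale_in_sections[OF bf 5])
  have "(\<Sum>i\<in>Basis. (?b x * z i x) *\<^sub>R i) = ?b x *\<^sub>R crd c Z x" for x
    unfolding z_def scaleR_scaleR[symmetric] scaleR_sum_right[symmetric] euclidean_representation ..
  then have "extend c b (\<lambda>x. ?b x *\<^sub>R crd c Z x) = extend c b (\<lambda>x. \<Sum>i\<in>Basis. (?b x * z i x) *\<^sub>R i)"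
    by simp
  moreover have "extend c b (\<lambda>x. ?b x *\<^sub>R crd c Z x) = field_scale S b (field_scale S b Z)"
    by (rule sections_eq_extendI[OF c extend_in_sections[OF b
            smooth_on_scaleR[OF open_cdom[OF c] smb smooth_crd[OF Z c]]] 6])
      (use c in \<open>auto simp: field_scale_def extend_inside extend_outside cutoff_outside[OF b]\<close>)
  moreover have "L (field_scale S b (field_scale S b Z)) = L Z"
    using scale[OF bf 5] scale[OF bf Z] q(3) by simp
  ultimately have "L Z = (\<Sum>i\<in>Basis. z i (snd (\<kappa> c) q) *\<^sub>R L (extend c b (\<lambda>_. i)))"
    using *[of Basis] by simp
  then show ?thesis using q c by (simp add: z_def)
qed

text \<open>The value 1 on a neighbourhood, rather than at a point only, keeps derivatives of
  \<open>b\<close> out of the derivative of \<open>extend c b g\<close>.\<close>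

definition one_near :: "'c \<Rightarrow> ('s \<Rightarrow> real) \<Rightarrow> 'b set \<Rightarrow> bool" where
  "one_near c b N \<longleftrightarrow> open N \<and> (\<forall>u\<in>S. u \<in> fst (\<kappa> c) \<longrightarrow> snd (\<kappa> c) u \<in> N \<longrightarrow> b u = 1)"

lemma derivative_extend:
  assumes b: "cutoff c b" "one_near c b N" and q: "q \<in> S" "q \<in> fst (\<kappa> c)" "snd (\<kappa> c) q \<in> N"
    and g: "(g has_derivative g') (at (snd (\<kappa> c) q))"
  shows "frechet_derivative (crd c (extend c b g)) (at (snd (\<kappa> c) q)) = g'"
proof -
  have c: "c \<in> I" using cutoffD b by auto
  have "open (N \<inter> cdom c)" "snd (\<kappa> c) q \<in> N \<inter> cdom c"
    using b q in_cdom open_cdom[OF c] unfolding one_near_def by auto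
  then have "(crd c (extend c b g) has_derivative g') (at (snd (\<kappa> c) q))"
    by (rule has_derivative_transform_within_open[OF g])
      (use b c in \<open>auto simp: cdom_def extend_inside one_near_def\<close>)
  then show ?thesis using frechet_derivative_at by metis
qed

lemma derivative_field_add:
  assumes Z: "Z \<in> sections" "Z' \<in> sections" and c: "c \<in> I" and q: "q \<in> S" "q \<in> fst (\<kappa> c)"
  shows "frechet_derivative (crd c (field_add S Z Z')) (at (snd (\<kappa> c) q)) =
    (\<lambda>e. frechet_derivative (crd c Z) (at (snd (\<kappa> c) q)) e + frechet_derivative (crd c Z') (at (snd (\<kappa> c) q)) e)"
proof (rule frechet_derivative_at[symmetric])
  show "(crd c (field_add S Z Z') has_derivative
    (\<lambda>e. frechet_derivative (crd c Z) (at (snd (\<kappa> c) q)) e + frechet_derivative (crd c Z') (at (snd (\<kappa> c) q)) e))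
    (at (snd (\<kappa> c) q))"
    by (rule has_derivative_transform_within_open[OF
          has_derivative_add[OF crd_has_derivative[OF Z(1) c q] crd_has_derivative[OF Z(2) c q]]
          open_cdom[OF c] in_cdom[OF q]])
      (use c in \<open>auto simp: cdom_def field_add_def\<close>)
qed

lemma derivative_field_scale:
  assumes f: "f \<in> FF" and Z: "Z \<in> sections" and c: "c \<in> I" and q: "q \<in> S" "q \<in> fst (\<kappa> c)"
  shows "frechet_derivative (crd c (field_scale S f Z)) (at (snd (\<kappa> c) q)) =
    (\<lambda>e. f q *\<^sub>R frechet_derivative (crd c Z) (at (snd (\<kappa> c) q)) e +
      frechet_derivative (f \<circ> chart_inv (\<kappa> c)) (at (snd (\<kappa> c) q)) e *\<^sub>R snd (Z q) (\<sigma> c))"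
proof (rule frechet_derivative_at[symmetric])
  let ?x = "snd (\<kappa> c) q" and ?f = "f \<circ> chart_inv (\<kappa> c)"
  have "(crd c (field_scale S f Z) has_derivative
      (\<lambda>e. ?f ?x *\<^sub>R frechet_derivative (crd c Z) (at ?x) e + frechet_derivative ?f (at ?x) e *\<^sub>R crd c Z ?x)) (at ?x)"
    by (rule has_derivative_transform_within_open[OF
          has_derivative_scaleR[OF smooth_on_has_derivative[OF smooth_function[OF f c] in_cdom[OF q]] crd_has_derivative[OF Z c q]]
          open_cdom[OF c] in_cdom[OF q]])
      (use c in \<open>auto simp: cdom_def field_scale_def\<close>)
  then show "(crd c (field_scale S f Z) has_derivative
      (\<lambda>e. f q *\<^sub>R frechet_derivative (crd c Z) (at ?x) e + frechet_derivative ?f (at ?x) e *\<^sub>R snd (Z q) (\<sigma> c))) (at ?x)"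
    using c q by simp
qed

text \<open>Subtracting the directional derivative of the coordinates turns a derivation of sections into
  a tensorial functional.\<close>
lemma leibniz_expansion:
  fixes L :: "('s \<Rightarrow> ('q, 'e) tvec) \<Rightarrow> 'e"
  assumes b: "cutoff c b" "one_near c b N" and q: "q \<in> S" "q \<in> fst (\<kappa> c)" "snd (\<kappa> c) q \<in> N"
    and add: "\<And>Z Z'. Z \<in> sections \<Longrightarrow> Z' \<in> sections \<Longrightarrow> L (field_add S Z Z') = L Z + L Z'"
    and scale: "\<And>f Z. f \<in> FF \<Longrightarrow> Z \<in> sections \<Longrightarrow>
      L (field_scale S f Z) = frechet_derivative (f \<circ> chart_inv (\<kappa> c)) (at (snd (\<kappa> c) q)) \<xi> *\<^sub>R snd (Z q) (\<sigma> c)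
        + f q *\<^sub>R L Z"
    and Z: "Z \<in> sections"
  shows "L Z = frechet_derivative (crd c Z) (at (snd (\<kappa> c) q)) \<xi> +
    (\<Sum>i\<in>Basis. (snd (Z q) (\<sigma> c) \<bullet> i) *\<^sub>R L (extend c b (\<lambda>_. i)))"
proof -
  let ?x = "snd (\<kappa> c) q"
  have c: "c \<in> I" using cutoffD b by auto
  define L' where "L' = (\<lambda>Z. L Z - frechet_derivative (crd c Z) (at ?x) \<xi>)"
  have "L' Z = (\<Sum>i\<in>Basis. (snd (Z q) (\<sigma> c) \<bullet> i) *\<^sub>R L' (extend c b (\<lambda>_. i)))"
  proof (rule tensorial_expansion[OF b(1) q(1,2)])
    show "b q = 1" using b(2) q unfolding one_near_def by blast
  next
    fix Z Z' assume Z: "Z \<in> sections" "Z' \<in> sections"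
    show "L' (field_add S Z Z') = L' Z + L' Z'"
      using add[OF Z] derivative_field_add[OF Z c q(1,2)] unfolding L'_def by simp
  next
    fix f Z assume f: "f \<in> FF" and Z: "Z \<in> sections"
    show "L' (field_scale S f Z) = f q *\<^sub>R L' Z"
      using scale[OF f Z] derivative_field_scale[OF f Z c q(1,2)] c q unfolding L'_def by (simp add: scaleR_diff_right)
  qed (rule Z)
  \<comment> \<open>These sections have constant coordinates near \<open>q\<close>, so the
    subtracted derivative is 0 on them.\<close>
  moreover have "L' (extend c b (\<lambda>_. i)) = L (extend c b (\<lambda>_. i))" for i
    unfolding L'_def using derivative_extend[OF b q has_derivative_const, of i] by simp
  ultimately show ?thesis unfolding L'_def by (simp add: algebra_simps)
qed

end

section \<open>Vector fields and anisotropic vector fields\<close>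

text \<open>Covers the tangent bundle of M and that of the open subset \<open>A\<close> of the
  tangent bundle.\<close>

lemma vector_bundle_tangent:
  assumes "smooth_atlas (\<kappa> ` I)"
    and "\<And>c. c \<in> I \<Longrightarrow> open (snd (\<kappa> c) ` (fst (\<kappa> c) \<inter> S))"
    and "\<And>u. u \<in> S \<Longrightarrow> \<exists>c\<in>I. u \<in> fst (\<kappa> c)"
  shows "vector_bundle I \<kappa> S \<kappa> (tangent_space (\<kappa> ` I))"
proof -
  interpret B: smooth_atlas "\<kappa> ` I" by fact
  show ?thesis
  proof
    fix c d e assume c: "c \<in> I" "d \<in> I"
    show "\<exists>t. smooth_on (snd (\<kappa> c) ` (fst (\<kappa> c) \<inter> fst (\<kappa> d))) t \<and>
      (\<forall>u\<in>S. u \<in> fst (\<kappa> c) \<longrightarrow> u \<in> fst (\<kappa> d) \<longrightarrow>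
        (\<forall>w\<in>tangent_space (\<kappa> ` I) u. snd w (\<kappa> c) = e \<longrightarrow> snd w (\<kappa> d) = t (snd (\<kappa> c) u)))"
    proof (intro exI conjI ballI impI)
      show "smooth_on (snd (\<kappa> c) ` (fst (\<kappa> c) \<inter> fst (\<kappa> d)))
          (\<lambda>x. frechet_derivative (transition (\<kappa> c) (\<kappa> d)) (at x) e)"
        using c by (intro smooth_on_frechet B.smooth_transition) auto
      show "snd w (\<kappa> d) = frechet_derivative (transition (\<kappa> c) (\<kappa> d)) (at (snd (\<kappa> c) u)) e"
        if "u \<in> fst (\<kappa> c)" "u \<in> fst (\<kappa> d)" "w \<in> tangent_space (\<kappa> ` I) u" "snd w (\<kappa> c) = e" for u w
        using B.tangent_space_dtrans[OF that(3) _ _ that(1,2)] c that(4) by (simp add: B.dtrans_def)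
    qed
  next
    fix c u e assume c: "c \<in> I" "u \<in> S" "u \<in> fst (\<kappa> c)"
    show "\<exists>w\<in>tangent_space (\<kappa> ` I) u. snd w (\<kappa> c) = e"
      using c by (intro bexI[of _ "tvec_of (\<kappa> ` I) (\<kappa> c) u e"] B.tvec_of_in_tangent_space) auto
  next
    fix c u w w' assume "c \<in> I" "u \<in> S" "u \<in> fst (\<kappa> c)" "w \<in> tangent_space (\<kappa> ` I) u"
      "w' \<in> tangent_space (\<kappa> ` I) u" "snd w (\<kappa> c) = snd w' (\<kappa> c)"
    then show "w = w'" by (intro B.tangent_space_eqI[of w u w' "\<kappa> c"]) auto
  qed (use assms B.tadd_in_tangent_space B.tscale_in_tangent_space in auto)
qed

locale conic_manifold =
  fixes \<A> :: "('m, 'e::euclidean_space) chart set" and A :: "('m, 'e) tvec set"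
  assumes manifold: "smooth_manifold \<A>" and conic: "conic_domain \<A> A"
begin

sublocale M: smooth_atlas \<A> by (rule smooth_manifold_imp_smooth_atlas[OF manifold])

sublocale T: smooth_atlas "tangent_atlas \<A>" by (rule M.smooth_atlas_tangent_atlas)

abbreviation nc :: "('m, 'e) chart \<Rightarrow> (('m, 'e) tvec, 'e \<times> 'e) chart" where
  "nc \<equiv> natural_chart \<A>"

lemma in_A: "v \<in> A \<Longrightarrow> v \<in> tangent_space \<A> (fst v)" "v \<in> A \<Longrightarrow> fst v \<in> points \<A>"
  using conic M.tangent_bundle_iff[of v] unfolding conic_domain_def by blast+

lemma tscale_in_A: "r > 0 \<Longrightarrow> v \<in> A \<Longrightarrow> tscale r v \<in> A"
  using conic unfolding conic_domain_def by blast

lemma in_nc: "v \<in> A \<Longrightarrow> v \<in> fst (nc c) \<longleftrightarrow> fst v \<in> fst c"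
  using in_A by (auto simp: M.fst_natural_chart)

lemma open_A: "c \<in> \<A> \<Longrightarrow> open (snd (nc c) ` (fst (nc c) \<inter> A))"
  using conic T.openin_iff M.natural_chart_in_tangent_atlas unfolding conic_domain_def
  by (metis Int_commute)

lemma ex_chart: "v \<in> A \<Longrightarrow> \<exists>c\<in>\<A>. fst v \<in> fst c"
  using in_A(2) unfolding points_def by blast

section \<open>Vector fields on M (\<open>VM\<close>), vector fields on \<open>A\<close>
  (\<open>VA\<close>) and anisotropic vector fields (\<open>AF\<close>) as sections\<close>

sublocale VM: vector_bundle \<A> "\<lambda>c. c" "points \<A>" "\<lambda>c. c" "tangent_space \<A>"
proof -
  have "fst c \<inter> points \<A> = fst c" if "c \<in> \<A>" for c
    using that unfolding points_def by blast
  then show "vector_bundle \<A> (\<lambda>c. c) (points \<A>) (\<lambda>c. c) (tangent_space \<A>)"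
    using vector_bundle_tangent[of "\<lambda>c. c" \<A> "points \<A>"] M.smooth_atlas_axioms M.open_image
    by (auto simp: points_def)
qed

sublocale VA: vector_bundle \<A> nc A nc "tangent_space (tangent_atlas \<A>)"
proof -
  have "\<exists>c\<in>\<A>. u \<in> fst (nc c)" if "u \<in> A" for u
    using ex_chart[OF that] in_nc[OF that] by blast
  then show "vector_bundle \<A> nc A nc (tangent_space (tangent_atlas \<A>))"
    using vector_bundle_tangent[of nc \<A> A] open_A T.smooth_atlas_axioms
    unfolding tangent_atlas_def by blast
qed

sublocale AF: vector_bundle \<A> nc A "\<lambda>c. c" "\<lambda>v. tangent_space \<A> (fst v)"
proof
  show "\<exists>c\<in>\<A>. u \<in> fst (nc c)" if "u \<in> A" for u
    using ex_chart[OF that] in_nc[OF that] by blast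
  show "\<exists>w\<in>tangent_space \<A> (fst u). snd w c = e" if "c \<in> \<A>" "u \<in> A" "u \<in> fst (nc c)" for c u e
    using that in_nc
    by (intro bexI[of _ "tvec_of \<A> c (fst u) e"] M.tvec_of_in_tangent_space) auto
  show "w = w'" if "c \<in> \<A>" "u \<in> A" "u \<in> fst (nc c)" "w \<in> tangent_space \<A> (fst u)"
      "w' \<in> tangent_space \<A> (fst u)" "snd w c = snd w' c" for c u w w'
    using that in_nc by (intro M.tangent_space_eqI[of w "fst u" w' c]) auto
  fix c d e assume c: "c \<in> \<A>" "d \<in> \<A>"
  show "\<exists>t. smooth_on (snd (nc c) ` (fst (nc c) \<inter> fst (nc d))) t \<and>
    (\<forall>u\<in>A. u \<in> fst (nc c) \<longrightarrow> u \<in> fst (nc d) \<longrightarrow>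
      (\<forall>w\<in>tangent_space \<A> (fst u). snd w c = e \<longrightarrow> snd w d = t (snd (nc c) u)))"
  proof (intro exI conjI ballI impI)
    show "smooth_on (snd (nc c) ` (fst (nc c) \<inter> fst (nc d))) (\<lambda>x. frechet_derivative (transition c d) (at (fst x)) e)"
      unfolding M.natural_chart_image[OF c(1)]
      by (rule smooth_on_compose[OF _ M.open_overlap[OF c] smooth_on_frechet[OF M.smooth_transition[OF c]]])
        (auto intro!: smooth_on_fst smooth_on_id open_Times M.open_overlap c)
    show "snd w d = frechet_derivative (transition c d) (at (fst (snd (nc c) u))) e"
      if "u \<in> A" "u \<in> fst (nc c)" "u \<in> fst (nc d)" "w \<in> tangent_space \<A> (fst u)" "snd w c = e" for u w
      using M.tangent_space_dtrans[OF that(4) c] that in_nc by (simp add: M.dtrans_def)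
  qed
qed (use open_A M.tadd_in_tangent_space M.tscale_in_tangent_space in auto)

lemma sections_VM: "VM.sections = vector_fields \<A> (points \<A>)"
  unfolding VM.sections_def vector_fields_def VM.cdom_def VM.crd_def ..

lemma sections_VA: "VA.sections = vector_fields (tangent_atlas \<A>) A"
  unfolding VA.sections_def vector_fields_def VA.cdom_def VA.crd_def
  by (simp add: tangent_atlas_def)

lemma sections_AF: "AF.sections = aniso_fields \<A> A"
  unfolding AF.sections_def aniso_fields_def AF.cdom_def AF.crd_def Let_def ..

lemma functions_VA: "VA.FF = smooth_functions (tangent_atlas \<A>) A"
  by (simp add: tangent_atlas_def)

section \<open>Cutoff functions on the manifold\<close>

lemma compact_closed_in_manifold:
  assumes c: "c \<in> \<A>" and K: "compact K" "K \<subseteq> snd c ` fst c"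
  shows "closedin (atlas_topology \<A>) (chart_inv c ` K)"
proof (rule compactin_imp_closedin)
  show "Hausdorff_space (atlas_topology \<A>)" using manifold unfolding smooth_manifold_def by blast
  \<comment> \<open>Continuity of the inverse chart makes the image of \<open>K\<close> compact; in
    a Hausdorff space it is then closed.\<close>
  have "continuous_map (top_of_set (snd c ` fst c)) (atlas_topology \<A>) (chart_inv c)"
    unfolding continuous_map_def
  proof (intro conjI allI impI)
    show "chart_inv c \<in> topspace (top_of_set (snd c ` fst c)) \<rightarrow> topspace (atlas_topology \<A>)"
      using c by (auto simp: M.topspace points_def)
    fix U assume U: "openin (atlas_topology \<A>) U"
    then have "open (snd c ` (U \<inter> fst c))" using c M.openin_iff by blast
    moreover have "{x \<in> topspace (top_of_set (snd c ` fst c)). chart_inv c x \<in> U} = snd c ` (U \<inter> fst c)"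
      using c by auto
    ultimately show "openin (top_of_set (snd c ` fst c)) {x \<in> topspace (top_of_set (snd c ` fst c)). chart_inv c x \<in> U}"
      by (simp add: open_subset image_mono)
  qed
  moreover have "compactin (top_of_set (snd c ` fst c)) K"
    using K by (simp add: compactin_subtopology)
  ultimately show "compactin (atlas_topology \<A>) (chart_inv c ` K)"
    using image_compactin by blast
qed

text \<open>A bump function in the chart, extended by zero. \<open>R\<close> is chosen so that the
  closed ball of radius \<open>R\<close> lies in the image of the chart; its preimage
  \<open>K\<close> then contains the support and is closed in the manifold.\<close>

lemma ex_cutoff_manifold:
  assumes c: "c \<in> \<A>" "p \<in> fst c"
  obtains b N where "VM.cutoff c b" "VM.one_near c b N" "snd c p \<in> N"
proof -
  obtain R where R: "R > 0" "cball (snd c p) R \<subseteq> snd c ` fst c"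
    using M.open_image[OF c(1)] c(2) open_contains_cball by blast
  obtain \<beta> :: "'e \<Rightarrow> real" where \<beta>: "smooth_on UNIV \<beta>" "\<And>x. x \<in> ball (snd c p) (R/2) \<Longrightarrow> \<beta> x = 1"
    "\<And>x. x \<notin> cball (snd c p) R \<Longrightarrow> \<beta> x = 0"
    using smooth_bump[of "R/2" R "snd c p"] R(1) by auto
  define b where "b = (\<lambda>q. if q \<in> fst c then \<beta> (snd c q) else 0)"
  define K where "K = chart_inv c ` cball (snd c p) R"
  have K: "closedin (atlas_topology \<A>) K"
    unfolding K_def by (rule compact_closed_in_manifold[OF c(1) compact_cball R(2)])
  have Kc: "K \<subseteq> fst c" using R(2) c(1) unfolding K_def by auto
  have b0: "b q = 0" if "q \<notin> K" for q
  proof (cases "q \<in> fst c")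
    case True
    then have "snd c q \<notin> cball (snd c p) R"
      using that c(1) unfolding K_def by (metis M.chart_inv_chart imageI)
    then show ?thesis using \<beta>(3) by (simp add: b_def)
  qed (simp add: b_def)
  have sup: "VM.supported c b"
    unfolding VM.supported_def
  proof (intro conjI ballI impI)
    fix d q assume d: "d \<in> \<A>" and q: "q \<in> points \<A>" "q \<in> fst d" "q \<notin> fst c"
    \<comment> \<open>The complement of \<open>K\<close> is an open set that contains
      \<open>q\<close> and on which \<open>b\<close> vanishes.\<close>
    let ?V = "snd d ` ((points \<A> - K) \<inter> fst d)"
    have "openin (atlas_topology \<A>) (points \<A> - K)"
      using K M.topspace by (metis closedin_def)
    then have "open ?V" using d unfolding M.openin_iff by blast
    moreover have "snd d q \<in> ?V" using q Kc by blast
    moreover have "b u = 0" if "u \<in> fst d" "snd d u \<in> ?V" for u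
      using b0 that M.inj[OF d] unfolding inj_on_def by blast
    ultimately show "\<exists>V. open V \<and> snd d q \<in> V \<and> (\<forall>u\<in>points \<A>. u \<in> fst d \<longrightarrow> snd d u \<in> V \<longrightarrow> b u = 0)"
      by blast
  qed (rule c(1))
  have "b \<in> VM.FF"
  proof (rule VM.functionsI)
    fix d assume d: "d \<in> \<A>"
    show "smooth_on (VM.cdom d) (b \<circ> chart_inv d)"
    proof (rule VM.smooth_on_supported[OF sup d])
      let ?O = "snd d ` (fst d \<inter> fst c) \<inter> VM.cdom d"
      have "smooth_on (VM.cdom c) \<beta>" using \<beta>(1) smooth_on_subset by blast
      from VM.smooth_on_transition_compose[OF c(1) d this]
      have s: "smooth_on ?O (\<lambda>x. \<beta> (transition d c x))" .
      have eq: "(b \<circ> chart_inv d) x = \<beta> (transition d c x)" if "x \<in> ?O" for x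
        using d by (rule VM.overlapE[OF _ that]) (use d in \<open>auto simp: b_def M.transition_chart\<close>)
      show "smooth_on ?O (b \<circ> chart_inv d)"
        by (rule iffD2[OF smooth_on_cong[OF VM.open_overlap_cdom[OF c(1) d] eq] s])
      show "(b \<circ> chart_inv d) (snd d u) = 0" if "u \<in> fst d" "u \<notin> fst c \<or> b u = 0" for u
        using that d by (auto simp: b_def)
    qed
  qed
  with sup have "VM.cutoff c b" unfolding VM.cutoff_def by blast
  moreover have "VM.one_near c b (ball (snd c p) (R/2))"
    unfolding VM.one_near_def using \<beta>(2) by (simp add: b_def)
  ultimately show thesis using that R(1) by auto
qed

lemma cdomE:
  assumes "u \<in> AF.cdom c"
  obtains v where "u = snd (nc c) v" "v \<in> A" "fst v \<in> fst c" "v \<in> fst (nc c)"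
  using assms in_nc unfolding AF.cdom_def by blast

section \<open>Pulling functions and cutoffs back from M to \<open>A\<close>\<close>

lemma smooth_on_fst_cdom:
  assumes "c \<in> \<A>" "smooth_on (VM.cdom c) g"
  shows "smooth_on (AF.cdom c) (\<lambda>u. g (fst u))"
proof (rule smooth_on_compose[OF AF.open_cdom[OF assms(1)] VM.open_cdom[OF assms(1)] assms(2)])
  show "smooth_on (AF.cdom c) fst"
    by (intro smooth_on_fst smooth_on_id AF.open_cdom assms)
  show "fst ` AF.cdom c \<subseteq> VM.cdom c"
  proof
    fix x assume "x \<in> fst ` AF.cdom c"
    then obtain u where u: "u \<in> AF.cdom c" "x = fst u" by blast
    obtain v where "u = snd (nc c) v" "v \<in> A" "fst v \<in> fst c" by (rule cdomE[OF u(1)])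
    then show "x \<in> VM.cdom c" using VM.in_cdom[of "fst v" c] in_A(2)[of v] u(2) by simp
  qed
qed

lemma fst_o_function:
  assumes f: "f \<in> smooth_functions \<A> (points \<A>)"
  shows "f \<circ> fst \<in> VA.FF"
proof (rule VA.functionsI)
  fix d assume d: "d \<in> \<A>"
  have f': "f \<in> VM.FF" using f by simp
  have eq: "(f \<circ> fst \<circ> chart_inv (nc d)) x = (f \<circ> chart_inv d) (fst x)" if "x \<in> VA.cdom d" for x
    by (rule cdomE[OF that]) (use d AF.chart_inv[OF d] M.chart_inv_chart[OF d] in simp)
  show "smooth_on (VA.cdom d) (f \<circ> fst \<circ> chart_inv (nc d))"
    by (rule iffD2[OF smooth_on_cong[OF VA.open_cdom[OF d] eq] smooth_on_fst_cdom[OF d VM.smooth_function[OF f' d]]])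
qed

text \<open>Within \<open>A\<close> the domain of a natural chart is the full preimage of the base
  chart, so a cutoff in the base directions suffices.\<close>

lemma cutoff_lift:
  assumes b: "VM.cutoff c b" "VM.one_near c b N"
  shows "VA.cutoff c (b \<circ> fst)" "VA.one_near c (b \<circ> fst) (N \<times> UNIV)"
proof -
  note c = VM.cutoffD(1)[OF b(1)]
  show "VA.one_near c (b \<circ> fst) (N \<times> UNIV)"
    using b(2) in_nc in_A(2) unfolding VM.one_near_def VA.one_near_def by (auto intro: open_Times)
  have "VA.supported c (b \<circ> fst)" unfolding VA.supported_def
  proof (intro conjI ballI impI)
    fix d v assume d: "d \<in> \<A>" "v \<in> A" "v \<in> fst (nc d)" "v \<notin> fst (nc c)"
    then have "fst v \<in> points \<A>" "fst v \<in> fst d" "fst v \<notin> fst c" using in_nc in_A by auto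
    from VM.supportedE[OF VM.cutoffD(3)[OF b(1)] d(1) this]
    obtain V where V: "open V" "snd d (fst v) \<in> V"
      "\<And>u. u \<in> points \<A> \<Longrightarrow> u \<in> fst d \<Longrightarrow> snd d u \<in> V \<Longrightarrow> b u = 0" by metis
    have "(b \<circ> fst) u = 0" if "u \<in> A" "u \<in> fst (nc d)" "snd (nc d) u \<in> V \<times> UNIV" for u
      using V(3)[of "fst u"] that in_A in_nc by auto
    moreover have "open (V \<times> (UNIV :: 'e set))" "snd (nc d) v \<in> V \<times> UNIV"
      using V by (auto intro: open_Times)
    ultimately show "\<exists>V. open V \<and> snd (nc d) v \<in> V \<and>
        (\<forall>u'\<in>A. u' \<in> fst (nc d) \<longrightarrow> snd (nc d) u' \<in> V \<longrightarrow> (b \<circ> fst) u' = 0)"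
      by (intro exI[of _ "V \<times> UNIV"] conjI ballI impI)
  qed (rule c)
  moreover have "b \<circ> fst \<in> VA.FF"
    using VM.cutoffD(2)[OF b(1)] by (intro fst_o_function) simp
  ultimately show "VA.cutoff c (b \<circ> fst)" unfolding VA.cutoff_def by blast
qed

lemma ex_cutoff_A:
  assumes c: "c \<in> \<A>" "v \<in> A" "fst v \<in> fst c"
  obtains b N where "VA.cutoff c b" "VA.one_near c b N" "snd (nc c) v \<in> N"
proof -
  obtain b N where b: "VM.cutoff c b" "VM.one_near c b N" "snd c (fst v) \<in> N"
    using ex_cutoff_manifold[OF c(1,3)] .
  show thesis by (rule that[OF cutoff_lift[OF b(1,2)]]) (use b(3) in simp)
qed

end

section \<open>Local representation of connections\<close>

lemma bilinear_basis_sum: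
  fixes G :: "'a::euclidean_space \<Rightarrow> 'b::euclidean_space \<Rightarrow> 'c::real_vector"
  assumes "bilinear G"
  shows "G x y = (\<Sum>i\<in>Basis. \<Sum>j\<in>Basis. ((x \<bullet> i) * (y \<bullet> j)) *\<^sub>R G i j)"
proof -
  have l: "linear (\<lambda>x. G x y)" "linear (G x)" for x y
    using assms unfolding bilinear_def by auto
  have "G x y = (\<Sum>i\<in>Basis. (x \<bullet> i) *\<^sub>R G i y)" by (rule linear_basis_sum[OF l(1)])
  also have "\<dots> = (\<Sum>i\<in>Basis. (x \<bullet> i) *\<^sub>R (\<Sum>j\<in>Basis. (y \<bullet> j) *\<^sub>R G i j))"
    by (intro sum.cong refl arg_cong[where f = "(*\<^sub>R) _"] linear_basis_sum l)
  finally show ?thesis by (simp add: scaleR_sum_right)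
qed

text \<open>Covers both anisotropic connections (\<open>S = M\<close>, \<open>\<phi> = \<pi>\<close>) and linear connections on the
  vertical bundle (\<open>S = A\<close>, \<open>\<phi> = id\<close>).\<close>
locale connection_base = conic_manifold \<A> A
  for \<A> :: "('m, 'e::euclidean_space) chart set" and A :: "('m, 'e) tvec set" +
  fixes \<kappa> :: "('m, 'e) chart \<Rightarrow> ('s, 'b::euclidean_space) chart" and S :: "'s set"
    and \<rho> :: "'s \<Rightarrow> 'm" and \<phi> :: "('m, 'e) tvec \<Rightarrow> 's" and pr :: "'e \<times> 'e \<Rightarrow> 'b"
  assumes bundle_X: "vector_bundle \<A> \<kappa> S \<kappa> (tangent_space (\<kappa> ` \<A>))"
    and bundle_Y: "vector_bundle \<A> \<kappa> S (\<lambda>c. c) (\<lambda>u. tangent_space \<A> (\<rho> u))"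
    and \<phi>: "v \<in> A \<Longrightarrow> \<phi> v \<in> S"
    and \<phi>_chart: "v \<in> A \<Longrightarrow> c \<in> \<A> \<Longrightarrow> fst v \<in> fst c \<Longrightarrow> \<phi> v \<in> fst (\<kappa> c)"
      "v \<in> A \<Longrightarrow> c \<in> \<A> \<Longrightarrow> fst v \<in> fst c \<Longrightarrow> snd (\<kappa> c) (\<phi> v) = pr (snd c (fst v), snd v c)"
    and pr: "continuous_on UNIV pr"
    and ex_cutoff: "c \<in> \<A> \<Longrightarrow> q \<in> S \<Longrightarrow> q \<in> fst (\<kappa> c) \<Longrightarrow>
      \<exists>b N. vector_bundle.cutoff \<A> \<kappa> S c b \<and> vector_bundle.one_near \<kappa> S c b N \<and> snd (\<kappa> c) q \<in> N"
begin

sublocale X: vector_bundle \<A> \<kappa> S \<kappa> "tangent_space (\<kappa> ` \<A>)" by (rule bundle_X)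
sublocale Y: vector_bundle \<A> \<kappa> S "\<lambda>c. c" "\<lambda>u. tangent_space \<A> (\<rho> u)" by (rule bundle_Y)

text \<open>Bilinearity is demanded at every \<open>v\<close>, also off the chart, which spares side
  conditions in basis expansions; the formula pins down \<open>G v\<close> only for \<open>v\<close>
  in \<open>A\<close> over the domain of \<open>c\<close>.\<close>

definition represents :: "('m, 'e) chart \<Rightarrow> (('m, 'e) tvec \<Rightarrow> 'b \<Rightarrow> 'e \<Rightarrow> 'e) \<Rightarrow>
    (('s \<Rightarrow> ('s, 'b) tvec) \<Rightarrow> ('s \<Rightarrow> ('m, 'e) tvec) \<Rightarrow> ('m, 'e) tvec \<Rightarrow> ('m, 'e) tvec) \<Rightarrow> bool" where
  "represents c G D \<longleftrightarrow> (\<forall>v. bilinear (G v)) \<and>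
     (\<forall>v\<in>A. fst v \<in> fst c \<longrightarrow> (\<forall>X\<in>X.sections. \<forall>Y\<in>Y.sections.
        snd (D X Y v) c = frechet_derivative (Y.crd c Y) (at (snd (\<kappa> c) (\<phi> v))) (snd (X (\<phi> v)) (\<kappa> c))
          + G v (snd (X (\<phi> v)) (\<kappa> c)) (snd (Y (\<phi> v)) c))) \<and>
     (\<forall>\<xi> \<zeta>. smooth_on (AF.cdom c) (\<lambda>u. G (chart_inv (nc c) u) \<xi> \<zeta>))"

text \<open>At a fixed \<open>v\<close>, \<open>Y.leibniz_expansion\<close> reduces
  \<open>D X Y\<close> to the derivative of \<open>Y\<close> plus values of \<open>D\<close> on
  extended frame sections, and \<open>X.tensorial_expansion\<close> resolves these in
  \<open>X\<close>. The coefficients \<open>S2\<close> mention a cutoff that varies with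
  \<open>v\<close>, so smoothness needs an argument of its own: near any point they agree with
  coefficients formed with one common cutoff.\<close>

lemma local_representation:
  fixes D :: "('s \<Rightarrow> ('s, 'b) tvec) \<Rightarrow> ('s \<Rightarrow> ('m, 'e) tvec) \<Rightarrow> ('m, 'e) tvec \<Rightarrow> ('m, 'e) tvec"
  assumes D: "\<And>X Y. X \<in> X.sections \<Longrightarrow> Y \<in> Y.sections \<Longrightarrow> D X Y \<in> AF.sections"
    and addX: "\<And>X X' Y. X \<in> X.sections \<Longrightarrow> X' \<in> X.sections \<Longrightarrow> Y \<in> Y.sections \<Longrightarrow>
      D (field_add S X X') Y = field_add A (D X Y) (D X' Y)"
    and scaleX: "\<And>f X Y. f \<in> X.FF \<Longrightarrow> X \<in> X.sections \<Longrightarrow> Y \<in> Y.sections \<Longrightarrow>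
      D (field_scale S f X) Y = field_scale A (f \<circ> \<phi>) (D X Y)"
    and addY: "\<And>X Y Y'. X \<in> X.sections \<Longrightarrow> Y \<in> Y.sections \<Longrightarrow> Y' \<in> Y.sections \<Longrightarrow>
      D X (field_add S Y Y') = field_add A (D X Y) (D X Y')"
    and scaleY: "\<And>f X Y. f \<in> X.FF \<Longrightarrow> X \<in> X.sections \<Longrightarrow> Y \<in> Y.sections \<Longrightarrow>
      D X (field_scale S f Y) = field_add A (field_scale A (\<lambda>v. dir_deriv (\<kappa> ` \<A>) (X (\<phi> v)) f) (Y \<circ> \<phi>))
        (field_scale A (f \<circ> \<phi>) (D X Y))"
    and c: "c \<in> \<A>"
  shows "\<exists>G. represents c G D"
proof -
  define S2 where "S2 = (\<lambda>b v \<xi> \<zeta>. \<Sum>i\<in>Basis. \<Sum>j\<in>Basis. ((\<xi> \<bullet> i) * (\<zeta> \<bullet> j)) *\<^sub>R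
    snd (D (X.extend c b (\<lambda>_. i)) (Y.extend c b (\<lambda>_. j)) v) c)"
  have rep: "snd (D X Y v) c =
      frechet_derivative (Y.crd c Y) (at (snd (\<kappa> c) (\<phi> v))) (snd (X (\<phi> v)) (\<kappa> c))
      + S2 b v (snd (X (\<phi> v)) (\<kappa> c)) (snd (Y (\<phi> v)) c)"
    if v: "v \<in> A" "fst v \<in> fst c" and b: "X.cutoff c b" "X.one_near c b N" "snd (\<kappa> c) (\<phi> v) \<in> N"
      and X: "X \<in> X.sections" and Y: "Y \<in> Y.sections" for v b N X Y
  proof -
    note q = \<phi>[OF v(1)] \<phi>_chart(1)[OF v(1) c v(2)]
    have bq: "b (\<phi> v) = 1" using b q unfolding X.one_near_def by blast
    have E: "Y.extend c b (\<lambda>_. j) \<in> Y.sections" for j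
      by (intro Y.extend_in_sections b smooth_on_const)
    have 1: "snd (D X Y v) c = frechet_derivative (Y.crd c Y) (at (snd (\<kappa> c) (\<phi> v))) (snd (X (\<phi> v)) (\<kappa> c))
        + (\<Sum>j\<in>Basis. (snd (Y (\<phi> v)) c \<bullet> j) *\<^sub>R snd (D X (Y.extend c b (\<lambda>_. j)) v) c)"
    proof (rule Y.leibniz_expansion[OF b(1,2) q b(3) _ _ Y, where L = "\<lambda>Y. snd (D X Y v) c"])
      show "snd (D X (field_add S Z Z') v) c = snd (D X Z v) c + snd (D X Z' v) c"
        if "Z \<in> Y.sections" "Z' \<in> Y.sections" for Z Z'
        using addY[OF X that] v by (simp add: field_add_def)
      fix f Z assume f: "f \<in> Y.FF" and Z: "Z \<in> Y.sections"
      have "(f \<circ> chart_inv (\<kappa> c) has_derivative frechet_derivative (f \<circ> chart_inv (\<kappa> c)) (at (snd (\<kappa> c) (\<phi> v))))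
          (at (snd (\<kappa> c) (\<phi> v)))"
        by (rule smooth_on_has_derivative[OF X.smooth_function[OF f c] X.in_cdom[OF q]])
      then have "dir_deriv (\<kappa> ` \<A>) (X (\<phi> v)) f =
          frechet_derivative (f \<circ> chart_inv (\<kappa> c)) (at (snd (\<kappa> c) (\<phi> v))) (snd (X (\<phi> v)) (\<kappa> c))"
        by (rule X.base.dir_deriv_eq[OF X.section_fibre[OF X q(1)] imageI[OF c] q(2)])
      then show "snd (D X (field_scale S f Z) v) c =
          frechet_derivative (f \<circ> chart_inv (\<kappa> c)) (at (snd (\<kappa> c) (\<phi> v))) (snd (X (\<phi> v)) (\<kappa> c)) *\<^sub>R snd (Z (\<phi> v)) c
          + f (\<phi> v) *\<^sub>R snd (D X Z v) c"
        using scaleY[OF f X Z] v by (simp add: field_add_def field_scale_def)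
    qed
    have 2: "snd (D X (Y.extend c b (\<lambda>_. j)) v) c = (\<Sum>i\<in>Basis. (snd (X (\<phi> v)) (\<kappa> c) \<bullet> i) *\<^sub>R
        snd (D (X.extend c b (\<lambda>_. i)) (Y.extend c b (\<lambda>_. j)) v) c)" for j
    proof (rule X.tensorial_expansion[OF b(1) q bq _ _ X, where L = "\<lambda>X. snd (D X (Y.extend c b (\<lambda>_. j)) v) c"])
      show "snd (D (field_add S Z Z') (Y.extend c b (\<lambda>_. j)) v) c =
          snd (D Z (Y.extend c b (\<lambda>_. j)) v) c + snd (D Z' (Y.extend c b (\<lambda>_. j)) v) c"
        if "Z \<in> X.sections" "Z' \<in> X.sections" for Z Z'
        using addX[OF that E] v by (simp add: field_add_def)
      show "snd (D (field_scale S f Z) (Y.extend c b (\<lambda>_. j)) v) c = f (\<phi> v) *\<^sub>R snd (D Z (Y.extend c b (\<lambda>_. j)) v) c"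
        if "f \<in> X.FF" "Z \<in> X.sections" for f Z
        using scaleX[OF that E] v by (simp add: field_scale_def)
    qed
    show ?thesis
      unfolding 1 2 S2_def
      by (subst sum.swap) (simp add: scaleR_sum_right mult.commute)
  qed
  define good where "good = (\<lambda>v b. \<exists>N. X.cutoff c b \<and> X.one_near c b N \<and> snd (\<kappa> c) (\<phi> v) \<in> N)"
  \<comment> \<open>The cutoff has to be 1 near \<open>\<phi> v\<close>, so \<open>G\<close> picks
    one for each \<open>v\<close>.\<close>
  define bb where "bb = (\<lambda>v. SOME b. good v b)"
  have bb: "good v (bb v)" if "v \<in> A" "fst v \<in> fst c" for v
    using ex_cutoff[OF c \<phi>[OF that(1)] \<phi>_chart(1)[OF that(1) c that(2)]]
    unfolding bb_def by (intro someI_ex[of "good v"]) (auto simp only: good_def)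
  define G where "G = (\<lambda>v. S2 (bb v) v)"
  have bil: "bilinear (G v)" for v
    unfolding bilinear_def G_def S2_def
    by (intro conjI allI linearI)
      (simp_all add: inner_add_left algebra_simps sum.distrib scaleR_sum_right scaleR_add_left)
  have repG: "snd (D X Y v) c = frechet_derivative (Y.crd c Y) (at (snd (\<kappa> c) (\<phi> v))) (snd (X (\<phi> v)) (\<kappa> c))
          + G v (snd (X (\<phi> v)) (\<kappa> c)) (snd (Y (\<phi> v)) c)"
    if "v \<in> A" "fst v \<in> fst c" "X \<in> X.sections" "Y \<in> Y.sections" for v X Y
    using rep[OF that(1,2) _ _ _ that(3,4)] bb[OF that(1,2)] unfolding G_def good_def by blast
  have "smooth_on (AF.cdom c) (\<lambda>u. G (chart_inv (nc c) u) \<xi> \<zeta>)" for \<xi> \<zeta>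
  proof (rule smooth_on_local)
    fix u0 assume "u0 \<in> AF.cdom c"
    then obtain v0 where v0: "u0 = snd (nc c) v0" "v0 \<in> A" "fst v0 \<in> fst c"
      by (rule cdomE)
    note q0 = \<phi>[OF v0(2)] \<phi>_chart(1)[OF v0(2) c v0(3)]
    obtain b N where b: "X.cutoff c b" "X.one_near c b N" "snd (\<kappa> c) (\<phi> v0) \<in> N"
      using ex_cutoff[OF c q0] by blast
    have E: "X.extend c b (\<lambda>_. i) \<in> X.sections" "Y.extend c b (\<lambda>_. j) \<in> Y.sections" for i j
      by (intro X.extend_in_sections Y.extend_in_sections b smooth_on_const)+
    have oN: "open (pr -` N)"
      using b(2) pr unfolding X.one_near_def by (simp add: open_vimage)
    have o: "open (pr -` N \<inter> AF.cdom c)" using oN AF.open_cdom[OF c] by blast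
    \<comment> \<open>For all \<open>v\<close> over \<open>N\<close> the same cutoff
      \<open>b\<close> is admissible. Evaluating \<open>repG\<close> on its extended frames, where
      the derivative term vanishes, recovers \<open>G v\<close> from sections that no longer depend
      on \<open>v\<close>.\<close>
    have eq: "G (chart_inv (nc c) u) \<xi> \<zeta> = (\<Sum>i\<in>Basis. \<Sum>j\<in>Basis. ((\<xi> \<bullet> i) * (\<zeta> \<bullet> j)) *\<^sub>R
        AF.crd c (D (X.extend c b (\<lambda>_. i)) (Y.extend c b (\<lambda>_. j))) u)"
      if "u \<in> pr -` N \<inter> AF.cdom c" for u
    proof -
      from that have "u \<in> AF.cdom c" "pr u \<in> N" by auto
      then obtain v where v: "u = snd (nc c) v" "v \<in> A" "fst v \<in> fst c" "pr u \<in> N"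
        by (auto elim!: cdomE)
      have vu: "chart_inv (nc c) u = v" using AF.chart_inv[OF c] v in_nc by simp
      note q = \<phi>[OF v(2)] \<phi>_chart[OF v(2) c v(3)]
      have N: "snd (\<kappa> c) (\<phi> v) \<in> N" using q(3) v(1,4) by simp
      have bq: "b (\<phi> v) = 1" using b(2) q N unfolding X.one_near_def by blast
      have "G v i j = snd (D (X.extend c b (\<lambda>_. i)) (Y.extend c b (\<lambda>_. j)) v) c" for i j
      proof -
        have "frechet_derivative (Y.crd c (Y.extend c b (\<lambda>_. j))) (at (snd (\<kappa> c) (\<phi> v))) = (\<lambda>_. 0)"
          by (rule Y.derivative_extend[OF b(1,2) q(1,2) N has_derivative_const])
        then show ?thesis
          using repG[OF v(2,3) E] by (simp add: X.extend_inside[OF c q(1,2)] Y.extend_inside[OF c q(1,2)] bq)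
      qed
      then have "G v \<xi> \<zeta> = (\<Sum>i\<in>Basis. \<Sum>j\<in>Basis. ((\<xi> \<bullet> i) * (\<zeta> \<bullet> j)) *\<^sub>R
          snd (D (X.extend c b (\<lambda>_. i)) (Y.extend c b (\<lambda>_. j)) v) c)"
        using bilinear_basis_sum[OF bil, of v \<xi> \<zeta>] by (simp only:)
      then show ?thesis unfolding AF.crd_def vu .
    qed
    have "smooth_on (AF.cdom c) (AF.crd c (D (X.extend c b (\<lambda>_. i)) (Y.extend c b (\<lambda>_. j))))" for i j
      by (rule AF.smooth_crd[OF D[OF E] c])
    then have "smooth_on (pr -` N \<inter> AF.cdom c) (\<lambda>u. \<Sum>i\<in>Basis. \<Sum>j\<in>Basis. ((\<xi> \<bullet> i) * (\<zeta> \<bullet> j)) *\<^sub>R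
        AF.crd c (D (X.extend c b (\<lambda>_. i)) (Y.extend c b (\<lambda>_. j))) u)"
      using smooth_on_subset[of "AF.cdom c" _ "pr -` N \<inter> AF.cdom c"]
      by (intro smooth_on_sum smooth_on_scaleR o smooth_on_const) auto
    then have "smooth_on (pr -` N \<inter> AF.cdom c) (\<lambda>u. G (chart_inv (nc c) u) \<xi> \<zeta>)"
      using eq by (subst smooth_on_cong[OF o]) assumption+
    moreover have "u0 \<in> pr -` N" using b(3) \<phi>_chart(2)[OF v0(2) c v0(3)] v0(1) by simp
    ultimately show "\<exists>N. u0 \<in> N \<and> open N \<and> smooth_on (N \<inter> AF.cdom c) (\<lambda>u. G (chart_inv (nc c) u) \<xi> \<zeta>)"
      using oN by blast
  qed
  with bil repG have "represents c G D" unfolding represents_def by blast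
  then show ?thesis by (rule exI[where x = G])
qed

lemma ex_fields_through:
  assumes c: "c \<in> \<A>" and v: "v \<in> A" "fst v \<in> fst c"
  obtains X Y where "X \<in> X.sections" "Y \<in> Y.sections" "snd (X (\<phi> v)) (\<kappa> c) = \<xi>" "snd (Y (\<phi> v)) c = \<zeta>"
    "frechet_derivative (Y.crd c Y) (at (snd (\<kappa> c) (\<phi> v))) = (\<lambda>_. 0)"
proof -
  note q = \<phi>[OF v(1)] \<phi>_chart(1)[OF v(1) c v(2)]
  obtain b N where b: "X.cutoff c b" "X.one_near c b N" "snd (\<kappa> c) (\<phi> v) \<in> N"
    using ex_cutoff[OF c q] by blast
  have bq: "b (\<phi> v) = 1" using b q unfolding X.one_near_def by blast
  show thesis
    by (rule that[of "X.extend c b (\<lambda>_. \<xi>)" "Y.extend c b (\<lambda>_. \<zeta>)"])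
      (simp_all add: X.extend_in_sections Y.extend_in_sections b smooth_on_const
        X.extend_inside[OF c q] Y.extend_inside[OF c q] bq
        Y.derivative_extend[OF b(1,2) q b(3) has_derivative_const])
qed

end

lemma snd_field_add: "p \<in> S \<Longrightarrow> snd (field_add S X Y p) c = snd (X p) c + snd (Y p) c"
  and snd_field_scale: "p \<in> S \<Longrightarrow> snd (field_scale S f X p) c = f p *\<^sub>R snd (X p) c"
  by (simp_all add: field_add_def field_scale_def)

text \<open>Anisotropic connections are given with a rule for f X + h Y; the choice h = 0 turns it
  into the scaling rule that the local analysis expects.\<close>

lemma field_add_scale_zero: "field_add S (field_scale S g Z) (field_scale S (\<lambda>_. 0) Z) = field_scale S g Z"
  by (auto simp: fun_eq_iff field_add_def field_scale_def tadd_def tscale_def)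

lemma bilinear_simps:
  assumes "bilinear B"
  shows "B (x + y) z = B x z + B y z" "B x (z + w) = B x z + B x w"
    "B (r *\<^sub>R x) z = r *\<^sub>R B x z" "B x (r *\<^sub>R z) = r *\<^sub>R B x z"
  using assms by (auto simp: bilinear_ladd bilinear_radd bilinear_lmul bilinear_rmul)

section \<open>Coordinate forms of the two kinds of connection\<close>

context conic_manifold
begin

text \<open>This and \<open>linear_rep\<close> are the two instances of \<open>represents\<close>,
  restated outside its locale.\<close>

definition aniso_rep :: "('m, 'e) chart \<Rightarrow> (('m, 'e) tvec \<Rightarrow> 'e \<Rightarrow> 'e \<Rightarrow> 'e) \<Rightarrow> ('m, 'e) aniso_conn \<Rightarrow> bool" where
  "aniso_rep c \<Gamma> D \<longleftrightarrow> (\<forall>v. bilinear (\<Gamma> v)) \<and>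
     (\<forall>v\<in>A. fst v \<in> fst c \<longrightarrow> (\<forall>X\<in>VM.sections. \<forall>Y\<in>VM.sections.
        snd (D X Y v) c = frechet_derivative (VM.crd c Y) (at (snd c (fst v))) (snd (X (fst v)) c)
          + \<Gamma> v (snd (X (fst v)) c) (snd (Y (fst v)) c))) \<and>
     (\<forall>\<xi> \<zeta>. smooth_on (AF.cdom c) (\<lambda>u. \<Gamma> (chart_inv (nc c) u) \<xi> \<zeta>))"

definition linear_rep :: "('m, 'e) chart \<Rightarrow> (('m, 'e) tvec \<Rightarrow> 'e \<times> 'e \<Rightarrow> 'e \<Rightarrow> 'e) \<Rightarrow> ('m, 'e) linear_conn \<Rightarrow> bool" where
  "linear_rep c G D \<longleftrightarrow> (\<forall>v. bilinear (G v)) \<and>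
     (\<forall>v\<in>A. fst v \<in> fst c \<longrightarrow> (\<forall>X\<in>VA.sections. \<forall>Z\<in>AF.sections.
        snd (D X Z v) c = frechet_derivative (AF.crd c Z) (at (snd (nc c) v)) (snd (X v) (nc c))
          + G v (snd (X v) (nc c)) (snd (Z v) c))) \<and>
     (\<forall>\<xi> \<zeta>. smooth_on (AF.cdom c) (\<lambda>u. G (chart_inv (nc c) u) \<xi> \<zeta>))"

lemma aniso_base: "connection_base \<A> A (\<lambda>c. c) (points \<A>) (\<lambda>u. u) fst fst"
proof
  show "\<exists>b N. VM.cutoff c b \<and> VM.one_near c b N \<and> snd c q \<in> N"
    if "c \<in> \<A>" "q \<in> fst c" for c q
    using ex_cutoff_manifold[OF that] by metis
qed (use VM.vector_bundle_axioms in \<open>auto simp: vector_bundle_def in_A continuous_on_fst\<close>)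

lemma linear_base: "connection_base \<A> A nc A fst (\<lambda>v. v) (\<lambda>x. x)"
  unfolding connection_base_def connection_base_axioms_def
proof (intro conjI allI impI)
  show "conic_manifold \<A> A" by (rule conic_manifold_axioms)
  show "vector_bundle \<A> nc A nc (tangent_space (nc ` \<A>))"
    using VA.vector_bundle_axioms unfolding tangent_atlas_def .
  show "vector_bundle \<A> nc A (\<lambda>c. c) (\<lambda>v. tangent_space \<A> (fst v))"
    by (rule AF.vector_bundle_axioms)
  show "\<exists>b N. VA.cutoff c b \<and> VA.one_near c b N \<and> snd (nc c) q \<in> N"
    if "c \<in> \<A>" "q \<in> A" "q \<in> fst (nc c)" for c q
    using ex_cutoff_A[OF that(1,2)] in_nc[OF that(2)] that(3) by metis
qed (simp_all add: in_nc)

lemma ex_aniso_rep: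
  assumes D: "D \<in> aniso_connections \<A> A" and c: "c \<in> \<A>"
  shows "\<exists>\<Gamma>. aniso_rep c \<Gamma> D"
proof -
  interpret B: connection_base \<A> A "\<lambda>c. c" "points \<A>" "\<lambda>u. u" fst fst by (rule aniso_base)
  have s: "B.X.sections = VM.sections" by simp
  have f: "B.X.FF = smooth_functions \<A> (points \<A>)" by simp
  note D' = D[unfolded aniso_connections_def Let_def sections_VM[symmetric] sections_AF[symmetric]]
  have "\<exists>\<Gamma>. B.represents c \<Gamma> D"
  proof (rule B.local_representation)
    show "D X Y \<in> AF.sections" if "X \<in> B.X.sections" "Y \<in> VM.sections" for X Y
      using D' that unfolding s by (auto simp: PiE_iff)
    show "D (field_add (points \<A>) X X') Y = field_add A (D X Y) (D X' Y)"
      if "X \<in> B.X.sections" "X' \<in> B.X.sections" "Y \<in> VM.sections" for X X' Y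
      using D' that unfolding s by blast
    show "D X (field_add (points \<A>) Y Y') = field_add A (D X Y) (D X Y')"
      if "X \<in> B.X.sections" "Y \<in> VM.sections" "Y' \<in> VM.sections" for X Y Y'
      using D' that unfolding s by blast
    show "D X (field_scale (points \<A>) h Y) = field_add A (field_scale A (\<lambda>v. dir_deriv ((\<lambda>c. c) ` \<A>) (X (fst v)) h) (Y \<circ> fst))
        (field_scale A (h \<circ> fst) (D X Y))"
      if "h \<in> B.X.FF" "X \<in> B.X.sections" "Y \<in> VM.sections" for h X Y
      using D' that unfolding s f image_ident by blast
    show "D (field_scale (points \<A>) h X) Y = field_scale A (h \<circ> fst) (D X Y)"
      if h: "h \<in> B.X.FF" and X: "X \<in> B.X.sections" and Y: "Y \<in> VM.sections" for h X Y
    proof -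
      have "(\<lambda>_. 0) \<in> smooth_functions \<A> (points \<A>)" using B.X.const_function[of 0] unfolding f .
      then have "D (field_add (points \<A>) (field_scale (points \<A>) h X) (field_scale (points \<A>) (\<lambda>_. 0) X)) Y =
         field_add A (field_scale A (h \<circ> fst) (D X Y)) (field_scale A ((\<lambda>_. 0) \<circ> fst) (D X Y))"
        using D' h X Y unfolding s f by blast
      then show ?thesis by (simp only: o_def field_add_scale_zero)
    qed
  qed (rule c)
  then show ?thesis unfolding B.represents_def aniso_rep_def s .
qed

lemma ex_linear_rep:
  assumes D: "D \<in> linear_connections \<A> A" and c: "c \<in> \<A>"
  shows "\<exists>G. linear_rep c G D"
proof -
  interpret B: connection_base \<A> A nc A fst "\<lambda>v. v" "\<lambda>x. x" by (rule linear_base)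
  have s: "B.X.sections = VA.sections" unfolding tangent_atlas_def ..
  note D' = D[unfolded linear_connections_def Let_def sections_VA[symmetric] sections_AF[symmetric] functions_VA[symmetric]]
  have "\<exists>G. B.represents c G D"
  proof (rule B.local_representation)
    show "D X Y \<in> AF.sections" if "X \<in> B.X.sections" "Y \<in> AF.sections" for X Y
      using D' that unfolding s by (auto simp: PiE_iff)
    show "D (field_add A X X') Y = field_add A (D X Y) (D X' Y)"
      if "X \<in> B.X.sections" "X' \<in> B.X.sections" "Y \<in> AF.sections" for X X' Y
      using D' that unfolding s by blast
    show "D X (field_add A Y Y') = field_add A (D X Y) (D X Y')"
      if "X \<in> B.X.sections" "Y \<in> AF.sections" "Y' \<in> AF.sections" for X Y Y'
      using D' that unfolding s by blast
    show "D X (field_scale A h Y) = field_add A (field_scale A (\<lambda>v. dir_deriv (nc ` \<A>) (X v) h) (Y \<circ> (\<lambda>v. v)))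
        (field_scale A (h \<circ> (\<lambda>v. v)) (D X Y))"
      if "h \<in> VA.FF" "X \<in> B.X.sections" "Y \<in> AF.sections" for h X Y
      using D' that unfolding s by (simp add: o_def tangent_atlas_def)
    show "D (field_scale A h X) Y = field_scale A (h \<circ> (\<lambda>v. v)) (D X Y)"
      if "h \<in> VA.FF" "X \<in> B.X.sections" "Y \<in> AF.sections" for h X Y
      using D' that unfolding s by (simp add: o_def)
  qed (rule c)
  then show ?thesis unfolding B.represents_def linear_rep_def s .
qed

lemma ex_fields_through_point:
  assumes "c \<in> \<A>" "v \<in> A" "fst v \<in> fst c"
  obtains X Y where "X \<in> VM.sections" "Y \<in> VM.sections" "snd (X (fst v)) c = \<xi>" "snd (Y (fst v)) c = \<zeta>"
    "frechet_derivative (VM.crd c Y) (at (snd c (fst v))) = (\<lambda>_. 0)"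
proof -
  interpret B: connection_base \<A> A "\<lambda>c. c" "points \<A>" "\<lambda>u. u" fst fst by (rule aniso_base)
  have "B.X.sections = VM.sections" by simp
  then show thesis by - (rule B.ex_fields_through[OF assms, of \<xi> \<zeta>], rule that, simp_all only:)
qed

lemma ex_fields_through_vector:
  assumes "c \<in> \<A>" "v \<in> A" "fst v \<in> fst c"
  obtains X Z where "X \<in> VA.sections" "Z \<in> AF.sections" "snd (X v) (nc c) = w" "snd (Z v) c = \<zeta>"
    "frechet_derivative (AF.crd c Z) (at (snd (nc c) v)) = (\<lambda>_. 0)"
proof -
  interpret B: connection_base \<A> A nc A fst "\<lambda>v. v" "\<lambda>x. x" by (rule linear_base)
  have "B.X.sections = VA.sections" unfolding tangent_atlas_def ..
  then show thesis by - (rule B.ex_fields_through[OF assms, of w \<zeta>], rule that, simp_all only:)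
qed

text \<open>There are global fields with any prescribed values at the point, and the derivative
  terms of the two formulas are the same.\<close>

lemma aniso_rep_unique:
  assumes "c \<in> \<A>" "aniso_rep c \<Gamma> D" "aniso_rep c \<Gamma>' D" "v \<in> A" "fst v \<in> fst c"
  shows "\<Gamma> v \<xi> \<zeta> = \<Gamma>' v \<xi> \<zeta>"
proof -
  obtain X Y where "X \<in> VM.sections" "Y \<in> VM.sections" "snd (X (fst v)) c = \<xi>" "snd (Y (fst v)) c = \<zeta>"
    using ex_fields_through_point[OF assms(1,4,5)] .
  then have "snd (D X Y v) c = frechet_derivative (VM.crd c Y) (at (snd c (fst v))) \<xi> + \<Gamma> v \<xi> \<zeta>"
    "snd (D X Y v) c = frechet_derivative (VM.crd c Y) (at (snd c (fst v))) \<xi> + \<Gamma>' v \<xi> \<zeta>"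
    using assms unfolding aniso_rep_def by blast+
  then show ?thesis by simp
qed

lemma linear_rep_unique:
  assumes "c \<in> \<A>" "linear_rep c G D" "linear_rep c G' D" "v \<in> A" "fst v \<in> fst c"
  shows "G v \<xi> \<zeta> = G' v \<xi> \<zeta>"
proof -
  obtain X Y where "X \<in> VA.sections" "Y \<in> AF.sections" "snd (X v) (nc c) = \<xi>" "snd (Y v) c = \<zeta>"
    using ex_fields_through_vector[OF assms(1,4,5)] .
  then have "snd (D X Y v) c = frechet_derivative (AF.crd c Y) (at (snd (nc c) v)) \<xi> + G v \<xi> \<zeta>"
    "snd (D X Y v) c = frechet_derivative (AF.crd c Y) (at (snd (nc c) v)) \<xi> + G' v \<xi> \<zeta>"
    using assms unfolding linear_rep_def by blast+
  then show ?thesis by simp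
qed

lemma smooth_on_bilinear_family:
  fixes f :: "'x::real_normed_vector \<Rightarrow> 'y::euclidean_space" and g :: "'x \<Rightarrow> 'z::euclidean_space"
    and B :: "'x \<Rightarrow> 'y \<Rightarrow> 'z \<Rightarrow> 'w::real_normed_vector"
  assumes "open S" "\<And>i j. smooth_on S (\<lambda>x. B x i j)" "\<And>x. bilinear (B x)" "smooth_on S f" "smooth_on S g"
  shows "smooth_on S (\<lambda>x. B x (f x) (g x))"
proof -
  have "smooth_on S (\<lambda>x. \<Sum>i\<in>Basis. \<Sum>j\<in>Basis. ((f x \<bullet> i) * (g x \<bullet> j)) *\<^sub>R B x i j)"
    by (intro smooth_on_sum smooth_on_scaleR smooth_on_mult smooth_on_inner smooth_on_const assms) auto
  then show ?thesis
    by (subst smooth_on_cong[OF assms(1)]) (auto intro: bilinear_basis_sum assms(3))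
qed

lemma dir_deriv_M:
  assumes "X \<in> VM.sections" "f \<in> smooth_functions \<A> (points \<A>)" "c \<in> \<A>" "p \<in> fst c"
  shows "dir_deriv \<A> (X p) f = frechet_derivative (f \<circ> chart_inv c) (at (snd c p)) (snd (X p) c)"
proof -
  have p: "p \<in> points \<A>" using assms unfolding points_def by blast
  have "f \<in> VM.FF" using assms by simp
  from M.dir_deriv_eq[OF VM.section_fibre[OF assms(1) p] assms(3,4) smooth_on_has_derivative[OF VM.smooth_function[OF this assms(3)] VM.in_cdom[OF p assms(4)]]]
  show ?thesis .
qed

lemma dir_deriv_A:
  assumes "X \<in> VA.sections" "f \<in> VA.FF" "c \<in> \<A>" "v \<in> A" "fst v \<in> fst c"
  shows "dir_deriv (tangent_atlas \<A>) (X v) f = frechet_derivative (f \<circ> chart_inv (nc c)) (at (snd (nc c) v)) (snd (X v) (nc c))"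
proof -
  have v: "v \<in> fst (nc c)" using assms in_nc by simp
  show ?thesis
    by (rule T.dir_deriv_eq[OF VA.section_fibre[OF assms(1,4)] M.natural_chart_in_tangent_atlas[OF assms(3)] v
          smooth_on_has_derivative[OF VA.smooth_function[OF assms(2,3)] VA.in_cdom[OF assms(4) v]]])
qed

lemma AF_eqI:
  assumes "Z \<in> AF.sections" "Z' \<in> AF.sections"
    and "\<And>v c. v \<in> A \<Longrightarrow> c \<in> \<A> \<Longrightarrow> fst v \<in> fst c \<Longrightarrow> snd (Z v) c = snd (Z' v) c"
  shows "Z = Z'"
  by (rule AF.sections_eqI[OF assms(1,2)]) (use assms(3) ex_chart in_nc in blast)

definition pullback :: "('m \<Rightarrow> ('m, 'e) tvec) \<Rightarrow> ('m, 'e) tvec \<Rightarrow> ('m, 'e) tvec" where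
  "pullback Y = (\<lambda>v\<in>A. Y (fst v))"

lemma crd_pullback:
  assumes "c \<in> \<A>" "u \<in> AF.cdom c"
  shows "AF.crd c (pullback Y) u = VM.crd c Y (fst u)"
  by (rule cdomE[OF assms(2)]) (use assms(1) AF.crd_chart[OF assms(1)] VM.crd_chart[OF assms(1)] in \<open>simp add: pullback_def\<close>)

lemma pullback_in_sections:
  assumes "Y \<in> VM.sections"
  shows "pullback Y \<in> AF.sections"
proof (rule AF.sectionsI)
  fix c assume c: "c \<in> \<A>"
  show "smooth_on (AF.cdom c) (AF.crd c (pullback Y))"
    by (rule iffD2[OF smooth_on_cong[OF AF.open_cdom[OF c] crd_pullback[OF c]] smooth_on_fst_cdom[OF c VM.smooth_crd[OF assms c]]])
qed (use assms VM.section_fibre in_A in \<open>auto simp: pullback_def\<close>)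

text \<open>The coordinates of a pullback are independent of the fibre variable, so its derivative
  sees only the projection of the direction.\<close>

lemma derivative_pullback:
  assumes "Y \<in> VM.sections" "c \<in> \<A>" "v \<in> A" "fst v \<in> fst c"
  shows "frechet_derivative (AF.crd c (pullback Y)) (at (snd (nc c) v)) =
    (\<lambda>w. frechet_derivative (VM.crd c Y) (at (snd c (fst v))) (fst w))"
proof (rule frechet_derivative_at[symmetric])
  have "(VM.crd c Y has_derivative frechet_derivative (VM.crd c Y) (at (snd c (fst v)))) (at (fst (snd (nc c) v)))"
    using VM.crd_has_derivative[OF assms(1,2) in_A(2)[OF assms(3)] assms(4)] by simp
  from has_derivative_compose[OF has_derivative_fst[OF has_derivative_ident] this]
  have d: "((\<lambda>u. VM.crd c Y (fst u)) has_derivative (\<lambda>w. frechet_derivative (VM.crd c Y) (at (snd c (fst v))) (fst w))) (at (snd (nc c) v))" .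
  have i: "snd (nc c) v \<in> AF.cdom c" using AF.in_cdom[of v c] assms in_nc by simp
  show "(AF.crd c (pullback Y) has_derivative (\<lambda>w. frechet_derivative (VM.crd c Y) (at (snd c (fst v))) (fst w))) (at (snd (nc c) v))"
    by (rule has_derivative_transform_within_open[OF d AF.open_cdom[OF assms(2)] i])
      (simp only: crd_pullback[OF assms(2)])
qed

section \<open>Recovering the connection axioms from coordinate formulas\<close>

lemma linear_frechet_VM:
  "Y \<in> VM.sections \<Longrightarrow> c \<in> \<A> \<Longrightarrow> p \<in> points \<A> \<Longrightarrow> p \<in> fst c \<Longrightarrow> linear (frechet_derivative (VM.crd c Y) (at (snd c p)))"
  using has_derivative_linear[OF VM.crd_has_derivative] .

lemma linear_frechet_AF:
  "Z \<in> AF.sections \<Longrightarrow> c \<in> \<A> \<Longrightarrow> v \<in> A \<Longrightarrow> fst v \<in> fst c \<Longrightarrow> linear (frechet_derivative (AF.crd c Z) (at (snd (nc c) v)))"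
  using has_derivative_linear[OF AF.crd_has_derivative] in_nc by simp

text \<open>Converse of \<open>ex_aniso_rep\<close>. Read in a chart, each axiom is a rule of
  calculus for the derivative term together with bilinearity of the form.\<close>

lemma aniso_connectionsI:
  assumes D: "D \<in> VM.sections \<rightarrow>\<^sub>E VM.sections \<rightarrow>\<^sub>E AF.sections"
    and rep: "\<And>c. c \<in> \<A> \<Longrightarrow> \<exists>\<Gamma>. aniso_rep c \<Gamma> D"
  shows "D \<in> aniso_connections \<A> A"
proof -
  let ?M = "points \<A>" and ?F = "smooth_functions \<A> (points \<A>)"
  have Ds: "D X Y \<in> AF.sections" if "X \<in> VM.sections" "Y \<in> VM.sections" for X Y
    using D that by (auto simp: PiE_iff)
  have F: "f \<in> VM.FF" if "f \<in> ?F" for f using that by simp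
  obtain \<Gamma> where "\<And>c. c \<in> \<A> \<Longrightarrow> aniso_rep c (\<Gamma> c) D" using rep by metis
  then have bil: "c \<in> \<A> \<Longrightarrow> bilinear (\<Gamma> c v)"
    and crd: "c \<in> \<A> \<Longrightarrow> v \<in> A \<Longrightarrow> fst v \<in> fst c \<Longrightarrow> X \<in> VM.sections \<Longrightarrow> Y \<in> VM.sections \<Longrightarrow>
      snd (D X Y v) c = frechet_derivative (VM.crd c Y) (at (snd c (fst v))) (snd (X (fst v)) c)
          + \<Gamma> c v (snd (X (fst v)) c) (snd (Y (fst v)) c)" for c v X Y
    unfolding aniso_rep_def by blast+
  note cl = VM.field_add_in_sections VM.field_scale_in_sections[OF F] AF.field_add_in_sections
    AF.field_scale_in_sections[OF fst_o_function] Ds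
  show ?thesis
    unfolding aniso_connections_def Let_def sections_VM[symmetric] sections_AF[symmetric]
  proof (intro CollectI conjI ballI D)
    fix X Y Z assume X: "X \<in> VM.sections" and Y: "Y \<in> VM.sections" and Z: "Z \<in> VM.sections"
    show "D (field_add ?M X Y) Z = field_add A (D X Z) (D Y Z)"
      by (rule AF_eqI)
        (use X Y Z in \<open>simp_all add: cl crd snd_field_add in_A
          linear_add[OF linear_frechet_VM] bilinear_simps[OF bil]\<close>)
    show "D X (field_add ?M Y Z) = field_add A (D X Y) (D X Z)"
      by (rule AF_eqI)
        (use X Y Z in \<open>simp_all add: cl crd snd_field_add in_A VM.derivative_field_add
          bilinear_simps[OF bil]\<close>)
  next
    fix X Y f assume X: "X \<in> VM.sections" and Y: "Y \<in> VM.sections" and f: "f \<in> ?F"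
    let ?g = "\<lambda>v. dir_deriv \<A> (X (fst v)) f"
    have 1: "snd (D X (field_scale ?M f Y) v) c = ?g v *\<^sub>R snd (Y (fst v)) c + f (fst v) *\<^sub>R snd (D X Y v) c"
      if "v \<in> A" "c \<in> \<A>" "fst v \<in> fst c" for v c
      using that X Y f
      by (simp add: cl crd in_A VM.derivative_field_scale F dir_deriv_M[of X f c] bilinear_simps[OF bil]
          snd_field_scale algebra_simps)
    \<comment> \<open>\<open>AF_eqI\<close> would require the right side to be a section, hence
      smoothness of the derivative of \<open>f\<close> along \<open>X\<close>. Comparing values
      point by point avoids this.\<close>
    show "D X (field_scale ?M f Y) =
        field_add A (field_scale A ?g (Y \<circ> fst)) (field_scale A (f \<circ> fst) (D X Y))"
    proof
      fix v
      show "D X (field_scale ?M f Y) v =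
        field_add A (field_scale A ?g (Y \<circ> fst)) (field_scale A (f \<circ> fst) (D X Y)) v"
      proof (cases "v \<in> A")
        case v: True
        then obtain c where c: "c \<in> \<A>" "fst v \<in> fst c" using ex_chart by blast
        show ?thesis
          using AF.section_fibre[OF Ds v] VM.section_fibre[OF Y in_A(2)[OF v]] v 1[OF v c] X Y f
          by (intro M.tangent_space_eqI[OF _ _ c])
            (simp_all add: field_add_def field_scale_def[of A] cl M.tadd_in_tangent_space M.tscale_in_tangent_space)
      next
        case False
        then show ?thesis using AF.section_undefined[OF Ds] X Y f by (simp add: cl field_add_def)
      qed
    qed
  next
    fix X Y Z f h assume X: "X \<in> VM.sections" and Y: "Y \<in> VM.sections" and Z: "Z \<in> VM.sections"
      and f: "f \<in> ?F" "h \<in> ?F"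
    show "D (field_add ?M (field_scale ?M f X) (field_scale ?M h Y)) Z =
        field_add A (field_scale A (f \<circ> fst) (D X Z)) (field_scale A (h \<circ> fst) (D Y Z))"
      by (rule AF_eqI)
        (use X Y Z f in \<open>simp_all add: cl crd in_A linear_add[OF linear_frechet_VM] linear_cmul[OF linear_frechet_VM]
          bilinear_simps[OF bil] snd_field_add snd_field_scale algebra_simps\<close>)
  qed
qed

lemma linear_connectionsI:
  assumes D: "D \<in> VA.sections \<rightarrow>\<^sub>E AF.sections \<rightarrow>\<^sub>E AF.sections"
    and rep: "\<And>c. c \<in> \<A> \<Longrightarrow> \<exists>G. linear_rep c G D"
  shows "D \<in> linear_connections \<A> A"
proof -
  have Ds: "D X Y \<in> AF.sections" if "X \<in> VA.sections" "Y \<in> AF.sections" for X Y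
    using D that by (auto simp: PiE_iff)
  obtain G where "\<And>c. c \<in> \<A> \<Longrightarrow> linear_rep c (G c) D" using rep by metis
  then have bil: "c \<in> \<A> \<Longrightarrow> bilinear (G c v)"
    and crd: "c \<in> \<A> \<Longrightarrow> v \<in> A \<Longrightarrow> fst v \<in> fst c \<Longrightarrow> X \<in> VA.sections \<Longrightarrow> Y \<in> AF.sections \<Longrightarrow>
      snd (D X Y v) c = frechet_derivative (AF.crd c Y) (at (snd (nc c) v)) (snd (X v) (nc c))
          + G c v (snd (X v) (nc c)) (snd (Y v) c)" for c v X Y
    unfolding linear_rep_def by blast+
  note cl = VA.field_add_in_sections VA.field_scale_in_sections AF.field_add_in_sections
    AF.field_scale_in_sections Ds
  show ?thesis
    unfolding linear_connections_def Let_def sections_VA[symmetric] sections_AF[symmetric] functions_VA[symmetric]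
  proof (intro CollectI conjI ballI D)
    fix X Y Z assume X: "X \<in> VA.sections" and Y: "Y \<in> VA.sections" and Z: "Z \<in> AF.sections"
    show "D (field_add A X Y) Z = field_add A (D X Z) (D Y Z)"
      by (rule AF_eqI)
        (use X Y Z in \<open>simp_all add: cl crd snd_field_add
          linear_add[OF linear_frechet_AF] bilinear_simps[OF bil] del: M.snd_natural_chart\<close>)
  next
    fix X Z f assume X: "X \<in> VA.sections" and Z: "Z \<in> AF.sections" and f: "f \<in> VA.FF"
    show "D (field_scale A f X) Z = field_scale A f (D X Z)"
      by (rule AF_eqI)
        (use X Z f in \<open>simp_all add: cl crd snd_field_scale
          linear_cmul[OF linear_frechet_AF] bilinear_simps[OF bil] scaleR_add_right del: M.snd_natural_chart\<close>)
  next
    fix X Y Z assume X: "X \<in> VA.sections" and Y: "Y \<in> AF.sections" and Z: "Z \<in> AF.sections"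
    show "D X (field_add A Y Z) = field_add A (D X Y) (D X Z)"
      by (rule AF_eqI)
        (use X Y Z in \<open>simp_all add: cl crd snd_field_add AF.derivative_field_add in_nc
          bilinear_simps[OF bil] del: M.snd_natural_chart\<close>)
  next
    fix X Z f assume X: "X \<in> VA.sections" and Z: "Z \<in> AF.sections" and f: "f \<in> VA.FF"
    let ?g = "\<lambda>v. dir_deriv (tangent_atlas \<A>) (X v) f"
    have 1: "snd (D X (field_scale A f Z) v) c = ?g v *\<^sub>R snd (Z v) c + f v *\<^sub>R snd (D X Z v) c"
      if "v \<in> A" "c \<in> \<A>" "fst v \<in> fst c" for v c
      using that X Z f
      by (simp add: cl crd AF.derivative_field_scale dir_deriv_A[of X f c] bilinear_simps[OF bil] in_nc
          snd_field_scale algebra_simps del: M.snd_natural_chart)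
    show "D X (field_scale A f Z) = field_add A (field_scale A ?g Z) (field_scale A f (D X Z))"
    proof
      fix v
      show "D X (field_scale A f Z) v = field_add A (field_scale A ?g Z) (field_scale A f (D X Z)) v"
      proof (cases "v \<in> A")
        case v: True
        then obtain c where c: "c \<in> \<A>" "fst v \<in> fst c" using ex_chart by blast
        have e: "field_add A (field_scale A ?g Z) (field_scale A f (D X Z)) v =
            tadd (tscale (?g v) (Z v)) (tscale (f v) (D X Z v))"
          using v by (simp add: field_add_def field_scale_def)
        show ?thesis
          unfolding e
          by (rule M.tangent_space_eqI[OF _ _ c])
            (use v 1[OF v c] X Z f in \<open>simp_all add: M.tadd_in_tangent_space M.tscale_in_tangent_space
              AF.section_fibre cl\<close>)
      next
        case False
        then show ?thesis using AF.section_undefined[OF Ds] X Z f by (simp add: cl field_add_def)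
      qed
    qed
  qed
qed

section \<open>Passing between linear and anisotropic connections\<close>

lemma natural_chart_change:
  assumes "c \<in> \<A>" "d \<in> \<A>" "v \<in> A" "fst v \<in> fst c" "fst v \<in> fst d" "w \<in> tangent_space (tangent_atlas \<A>) v"
  shows "fst (snd w (nc d)) = M.dtrans c d (fst v) (fst (snd w (nc c)))"
proof -
  have v: "v \<in> fst (nc c)" "v \<in> fst (nc d)" using assms in_nc by auto
  have "snd w (nc d) = T.dtrans (nc c) (nc d) v (snd w (nc c))"
    using T.tangent_space_dtrans[OF assms(6) _ _ v] assms M.natural_chart_in_tangent_atlas by blast
  then show ?thesis using M.has_derivative_natural_transition(1)[OF assms(1,2) v] by simp
qed

lemma section_crd_change:
  assumes "c \<in> \<A>" "d \<in> \<A>" "p \<in> fst c" "p \<in> fst d" "X \<in> VM.sections"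
  shows "snd (X p) d = M.dtrans c d p (snd (X p) c)"
  using assms VM.section_fibre[OF assms(5), of p]
  by (intro M.tangent_space_dtrans) (auto simp: points_def)

text \<open>Vertical triviality without indices, so that it makes sense for any Euclidean model
  space; \<open>vertically_trivial_iff\<close> relates it to the symbols.\<close>

definition vertically_flat :: "('m, 'e) linear_conn \<Rightarrow> bool" where
  "vertically_flat D \<longleftrightarrow> (\<forall>c\<in>\<A>. \<forall>G. linear_rep c G D \<longrightarrow>
     (\<forall>v\<in>A. fst v \<in> fst c \<longrightarrow> (\<forall>\<eta> \<zeta>. G v (0, \<eta>) \<zeta> = 0)))"

lemma vertically_flatD:
  assumes "vertically_flat D" "c \<in> \<A>" "linear_rep c G D" "v \<in> A" "fst v \<in> fst c"
  shows "G v w \<zeta> = G v (fst w, 0) \<zeta>"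
proof -
  have "bilinear (G v)" using assms(3) unfolding linear_rep_def by blast
  then have "G v ((fst w, 0) + (0, snd w)) \<zeta> = G v (fst w, 0) \<zeta> + G v (0, snd w) \<zeta>"
    by (rule bilinear_simps)
  then show ?thesis using assms unfolding vertically_flat_def by auto
qed

lemma bilinear_horizontal:
  fixes B :: "'e \<times> 'e \<Rightarrow> 'e \<Rightarrow> 'e"
  assumes "bilinear B"
  shows "bilinear (\<lambda>\<xi> \<zeta>. B (\<xi>, 0) \<zeta>)"
proof -
  note b = bilinear_simps[OF assms]
  have "B (\<xi> + \<xi>', 0) \<zeta> = B (\<xi>, 0) \<zeta> + B (\<xi>', 0) \<zeta>" "B (r *\<^sub>R \<xi>, 0) \<zeta> = r *\<^sub>R B (\<xi>, 0) \<zeta>"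
    for \<xi> \<xi>' \<zeta> r
    using b(1)[of "(\<xi>, 0)" "(\<xi>', 0)" \<zeta>] b(3)[of r "(\<xi>, 0)" \<zeta>] by simp_all
  then show ?thesis unfolding bilinear_def by (auto intro!: linearI simp: b)
qed

text \<open>By vertical triviality, \<open>(\<nabla>\<^sub>X Y)\<^sub>v\<close> may be defined as the derivative of the pullback of \<open>Y\<close>
  along any vector at \<open>v\<close> that projects to \<open>X\<close>.\<close>
lemma linear_to_aniso:
  assumes Ds: "Ds \<in> linear_connections \<A> A" and flat: "vertically_flat Ds"
  obtains D where "D \<in> aniso_connections \<A> A"
    "\<And>c G. c \<in> \<A> \<Longrightarrow> linear_rep c G Ds \<Longrightarrow> aniso_rep c (\<lambda>v \<xi> \<zeta>. G v (\<xi>, 0) \<zeta>) D"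
proof -
  have DsZ: "Ds X Z \<in> AF.sections" if "X \<in> VA.sections" "Z \<in> AF.sections" for X Z
    using Ds that unfolding linear_connections_def Let_def sections_VA[symmetric] sections_AF[symmetric]
    by (auto simp: PiE_iff)
  \<comment> \<open>The lift has to project to \<open>X\<close> at the single point \<open>v\<close>
    only; a field with one prescribed value, taken in one chart, therefore suffices.\<close>
  define lifts where "lifts = (\<lambda>(X :: 'm \<Rightarrow> ('m, 'e) tvec) (v :: ('m, 'e) tvec) X'. X' \<in> VA.sections \<and>
    (\<forall>d\<in>\<A>. fst v \<in> fst d \<longrightarrow> fst (snd (X' v) (nc d)) = snd (X (fst v)) d))"
  have "\<exists>X'. lifts X v X'" if X: "X \<in> VM.sections" and v: "v \<in> A" for X v
  proof -
    obtain c where c: "c \<in> \<A>" "fst v \<in> fst c" using ex_chart v by blast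
    obtain X' Z' where X': "X' \<in> VA.sections" "snd (X' v) (nc c) = (snd (X (fst v)) c, 0)"
      using ex_fields_through_vector[OF c(1) v c(2), of "(snd (X (fst v)) c, 0)" 0] by metis
    have "fst (snd (X' v) (nc d)) = snd (X (fst v)) d" if "d \<in> \<A>" "fst v \<in> fst d" for d
      using natural_chart_change[OF c(1) that(1) v c(2) that(2) VA.section_fibre[OF X'(1) v]] X'(2)
        section_crd_change[OF c(1) that(1) c(2) that(2) X] by simp
    with X' show ?thesis unfolding lifts_def by blast
  qed
  then have "\<forall>X\<in>VM.sections. \<forall>v\<in>A. \<exists>X'. lifts X v X'" by blast
  then obtain L where L: "\<And>X v. X \<in> VM.sections \<Longrightarrow> v \<in> A \<Longrightarrow> lifts X v (L X v)" by metis
  define D where "D = (\<lambda>X\<in>VM.sections. \<lambda>Y\<in>VM.sections. \<lambda>v\<in>A. Ds (L X v) (pullback Y) v)"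
  have D: "D X Y v = Ds (L X v) (pullback Y) v" if "X \<in> VM.sections" "Y \<in> VM.sections" "v \<in> A" for X Y v
    using that by (simp add: D_def)
  have crd: "snd (D X Y v) c = frechet_derivative (VM.crd c Y) (at (snd c (fst v))) (snd (X (fst v)) c)
          + G v (snd (X (fst v)) c, 0) (snd (Y (fst v)) c)"
    if c: "c \<in> \<A>" and G: "linear_rep c G Ds" and v: "v \<in> A" "fst v \<in> fst c"
      and X: "X \<in> VM.sections" and Y: "Y \<in> VM.sections" for c G v X Y
  proof -
    have L': "L X v \<in> VA.sections" "fst (snd (L X v v) (nc c)) = snd (X (fst v)) c"
      using L[OF X v(1)] c v unfolding lifts_def by auto
    have "snd (Ds (L X v) (pullback Y) v) c =
        frechet_derivative (AF.crd c (pullback Y)) (at (snd (nc c) v)) (snd (L X v v) (nc c))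
          + G v (snd (L X v v) (nc c)) (snd (pullback Y v) c)"
      using G L'(1) pullback_in_sections[OF Y] v unfolding linear_rep_def by blast
    then show ?thesis
      using L'(2) v unfolding derivative_pullback[OF Y c v] vertically_flatD[OF flat c G v, of "snd (L X v v) (nc c)"]
        D[OF X Y v(1)] by (simp add: pullback_def)
  qed
  have sm: "smooth_on (AF.cdom c) (\<lambda>u. G (chart_inv (nc c) u) w \<zeta>)"
    and bil: "bilinear (G v)" if "linear_rep c G Ds" for c G v w \<zeta>
    using that unfolding linear_rep_def by blast+
  have rep: "aniso_rep c (\<lambda>v \<xi> \<zeta>. G v (\<xi>, 0) \<zeta>) D" if c: "c \<in> \<A>" and G: "linear_rep c G Ds" for c G
  proof -
    have "bilinear (\<lambda>\<xi> \<zeta>. G v (\<xi>, 0) \<zeta>)" for v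
      by (rule bilinear_horizontal[OF bil[OF G]])
    then show ?thesis unfolding aniso_rep_def using crd[OF c G] sm[OF G] by blast
  qed
  have "D \<in> aniso_connections \<A> A"
  proof (rule aniso_connectionsI)
    have "D X Y \<in> AF.sections" if X: "X \<in> VM.sections" and Y: "Y \<in> VM.sections" for X Y
    proof (rule AF.sectionsI)
      show "D X Y v \<in> tangent_space \<A> (fst v)" if v: "v \<in> A" for v
        using AF.section_fibre[OF DsZ[OF _ pullback_in_sections[OF Y]] v] L[OF X v] D[OF X Y v]
        unfolding lifts_def by auto
      show "D X Y v = undefined" if "v \<notin> A" for v
        using that X Y by (simp add: D_def)
      fix c assume c: "c \<in> \<A>"
      obtain G where G: "linear_rep c G Ds" using ex_linear_rep[OF Ds c] by blast
      \<comment> \<open>The lift \<open>L X v\<close> varies with \<open>v\<close> without any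
        regularity, so smoothness of \<open>D X Y\<close> comes from this coordinate expression and
        not from \<open>Ds\<close>.\<close>
      let ?h = "\<lambda>u. frechet_derivative (VM.crd c Y) (at (fst u)) (VM.crd c X (fst u))
          + G (chart_inv (nc c) u) (VM.crd c X (fst u), 0) (VM.crd c Y (fst u))"
      note o = AF.open_cdom[OF c]
      have "smooth_on (AF.cdom c) ?h"
        by (rule smooth_on_add[OF o
              smooth_on_fst_cdom[OF c smooth_on_frechet_apply[OF VM.open_cdom[OF c] VM.smooth_crd[OF Y c] VM.smooth_crd[OF X c]]]
              smooth_on_bilinear_family[OF o, where B = "\<lambda>u. G (chart_inv (nc c) u)", OF sm[OF G] bil[OF G]
                smooth_on_Pair[OF o smooth_on_fst_cdom[OF c VM.smooth_crd[OF X c]] smooth_on_const]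
                smooth_on_fst_cdom[OF c VM.smooth_crd[OF Y c]]]])
      moreover have eq: "AF.crd c (D X Y) u = ?h u" if u: "u \<in> AF.cdom c" for u
      proof -
        obtain v where v: "u = snd (nc c) v" "v \<in> A" "fst v \<in> fst c" "v \<in> fst (nc c)" by (rule cdomE[OF u])
        show ?thesis
          using crd[OF c G v(2,3) X Y] AF.crd_chart[OF c v(4)] AF.chart_inv[OF c v(4)] VM.crd_chart[OF c v(3)] v(1)
          by simp
      qed
      ultimately show "smooth_on (AF.cdom c) (AF.crd c (D X Y))"
        by (subst smooth_on_cong[OF AF.open_cdom[OF c]]) assumption+
    qed
    then show "D \<in> VM.sections \<rightarrow>\<^sub>E VM.sections \<rightarrow>\<^sub>E AF.sections"
      by (auto simp: PiE_iff extensional_def) (auto simp: D_def)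
    show "\<exists>\<Gamma>. aniso_rep c \<Gamma> D" if "c \<in> \<A>" for c
      using ex_linear_rep[OF Ds that] rep[OF that] by blast
  qed
  then show thesis using that rep by blast
qed

text \<open>The invariance of the coordinate formula is checked by splitting \<open>Z\<close> into the pullback of a
  field \<open>Y\<close> on \<open>M\<close> with \<open>Y = Z\<close> at \<open>v\<close>, to which \<open>D\<close> applies, and a section vanishing at \<open>v\<close>,
  whose derivative is tensorial.\<close>
lemma aniso_formula_invariant:
  assumes D: "D \<in> aniso_connections \<A> A" and \<Gamma>: "\<And>c. c \<in> \<A> \<Longrightarrow> aniso_rep c (\<Gamma> c) D"
    and X: "X \<in> VA.sections" and Z: "Z \<in> AF.sections" and v: "v \<in> A"
  shows "\<exists>w\<in>tangent_space \<A> (fst v). \<forall>c\<in>\<A>. fst v \<in> fst c \<longrightarrow>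
    snd w c = frechet_derivative (AF.crd c Z) (at (snd (nc c) v)) (snd (X v) (nc c))
      + \<Gamma> c v (fst (snd (X v) (nc c))) (snd (Z v) c)"
proof -
  obtain c where c: "c \<in> \<A>" "fst v \<in> fst c" using ex_chart v by blast
  obtain X' Y where X': "X' \<in> VM.sections" "snd (X' (fst v)) c = fst (snd (X v) (nc c))"
    and Y: "Y \<in> VM.sections" "snd (Y (fst v)) c = snd (Z v) c"
    using ex_fields_through_point[OF c(1) v c(2), of "fst (snd (X v) (nc c))" "snd (Z v) c"] by metis
  have DX: "D X' Y \<in> AF.sections"
    using D X' Y unfolding aniso_connections_def Let_def sections_VM[symmetric] sections_AF[symmetric]
    by (auto simp: PiE_iff)
  have Xd: "snd (X' (fst v)) d = fst (snd (X v) (nc d))" if "d \<in> \<A>" "fst v \<in> fst d" for d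
    using natural_chart_change[OF c(1) that(1) v c(2) that(2) VA.section_fibre[OF X v]] X'(2)
      section_crd_change[OF c(1) that(1) c(2) that(2) X'(1)] by simp
  have Yd: "snd (Y (fst v)) d = snd (Z v) d" if "d \<in> \<A>" "fst v \<in> fst d" for d
    using M.tangent_space_dtrans[OF AF.section_fibre[OF Z v] c(1) that(1) c(2) that(2)] Y(2)
      section_crd_change[OF c(1) that(1) c(2) that(2) Y(1)] by simp
  define Z' where "Z' = field_add A Z (field_scale A (\<lambda>_. -1) (pullback Y))"
  note sc = AF.field_scale_in_sections[OF AF.const_function pullback_in_sections[OF Y(1)], of "-1"]
  have Z': "Z' \<in> AF.sections"
    unfolding Z'_def by (intro AF.field_add_in_sections Z sc)
  have dZ': "frechet_derivative (AF.crd d Z') (at (snd (nc d) v)) (snd (X v) (nc d)) =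
      frechet_derivative (AF.crd d Z) (at (snd (nc d) v)) (snd (X v) (nc d))
      - frechet_derivative (VM.crd d Y) (at (snd d (fst v))) (fst (snd (X v) (nc d)))"
    if d: "d \<in> \<A>" "fst v \<in> fst d" for d
  proof -
    have vd: "v \<in> fst (nc d)" using v d in_nc by simp
    show ?thesis
      unfolding Z'_def AF.derivative_field_add[OF Z sc d(1) v vd]
        AF.derivative_field_scale[OF AF.const_function pullback_in_sections[OF Y(1)] d(1) v vd]
        derivative_pullback[OF Y(1) d(1) v d(2)]
      by (simp add: o_def frechet_derivative_const)
  qed
  have vc: "v \<in> fst (nc c)" using v c in_nc by simp
  define w2 where "w2 = tvec_of \<A> c (fst v) (frechet_derivative (AF.crd c Z') (at (snd (nc c) v)) (snd (X v) (nc c)))"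
  have w2: "w2 \<in> tangent_space \<A> (fst v)"
    unfolding w2_def by (rule M.tvec_of_in_tangent_space[OF c])
  have w2d: "snd w2 d = frechet_derivative (AF.crd d Z') (at (snd (nc d) v)) (snd (X v) (nc d))"
    if d: "d \<in> \<A>" "fst v \<in> fst d" for d
  proof -
    have vd: "v \<in> fst (nc d)" using v d in_nc by simp
    have "snd (Z' v) c = 0"
      unfolding Z'_def using v Y(2) by (simp add: snd_field_add snd_field_scale pullback_def)
    from AF.derivative_vanishing_section[OF c(1) d(1) v vc vd Z' this w2]
    have "frechet_derivative (AF.crd d Z') (at (snd (nc d) v)) (T.dtrans (nc c) (nc d) v (snd (X v) (nc c))) = snd w2 d"
      unfolding w2_def using c by simp
    moreover have "T.dtrans (nc c) (nc d) v (snd (X v) (nc c)) = snd (X v) (nc d)"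
      using T.tangent_space_dtrans[OF VA.section_fibre[OF X v] _ _ vc vd] c d M.natural_chart_in_tangent_atlas by simp
    ultimately show ?thesis by simp
  qed
  show ?thesis
  proof (intro bexI ballI impI)
    \<comment> \<open>The first summand contributes the derivative of \<open>Y\<close> and the
      bilinear term, the second the derivative of \<open>Z\<close> minus that of \<open>Y\<close>;
      the derivatives of \<open>Y\<close> cancel.\<close>
    show "tadd (D X' Y v) w2 \<in> tangent_space \<A> (fst v)"
      by (intro M.tadd_in_tangent_space w2 AF.section_fibre[OF DX v])
    fix d assume d: "d \<in> \<A>" "fst v \<in> fst d"
    have "snd (D X' Y v) d = frechet_derivative (VM.crd d Y) (at (snd d (fst v))) (snd (X' (fst v)) d)
        + \<Gamma> d v (snd (X' (fst v)) d) (snd (Y (fst v)) d)"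
      using \<Gamma>[OF d(1)] v d X'(1) Y(1) unfolding aniso_rep_def by blast
    then show "snd (tadd (D X' Y v) w2) d =
        frechet_derivative (AF.crd d Z) (at (snd (nc d) v)) (snd (X v) (nc d))
        + \<Gamma> d v (fst (snd (X v) (nc d))) (snd (Z v) d)"
      by (simp add: w2d[OF d] dZ'[OF d] Xd[OF d] Yd[OF d] del: M.snd_natural_chart)
  qed
qed

text \<open>\<open>aniso_formula_invariant\<close> supplies, point by point, a vector with the
  desired coordinates in all charts; any chosen one will do, since a single chart determines
  it.\<close>

lemma aniso_to_linear:
  assumes D: "D \<in> aniso_connections \<A> A"
  obtains Ds where "Ds \<in> linear_connections \<A> A"
    "\<And>c \<Gamma>. c \<in> \<A> \<Longrightarrow> aniso_rep c \<Gamma> D \<Longrightarrow> linear_rep c (\<lambda>v w \<zeta>. \<Gamma> v (fst w) \<zeta>) Ds"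
proof -
  obtain \<Gamma> where \<Gamma>: "\<And>c. c \<in> \<A> \<Longrightarrow> aniso_rep c (\<Gamma> c) D" using ex_aniso_rep[OF D] by metis
  define \<Phi> where "\<Phi> = (\<lambda>c (X :: ('m, 'e) tvec \<Rightarrow> (('m, 'e) tvec, 'e \<times> 'e) tvec)
      (Z :: ('m, 'e) tvec \<Rightarrow> ('m, 'e) tvec) v. frechet_derivative (AF.crd c Z) (at (snd (nc c) v)) (snd (X v) (nc c))
      + \<Gamma> c v (fst (snd (X v) (nc c))) (snd (Z v) c))"
  have "\<forall>X\<in>VA.sections. \<forall>Z\<in>AF.sections. \<forall>v\<in>A. \<exists>w. w \<in> tangent_space \<A> (fst v) \<and>
      (\<forall>c\<in>\<A>. fst v \<in> fst c \<longrightarrow> snd w c = \<Phi> c X Z v)"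
    using aniso_formula_invariant[OF D \<Gamma>] unfolding \<Phi>_def by blast
  then obtain W where W: "\<And>X Z v. X \<in> VA.sections \<Longrightarrow> Z \<in> AF.sections \<Longrightarrow> v \<in> A \<Longrightarrow>
      W X Z v \<in> tangent_space \<A> (fst v) \<and> (\<forall>c\<in>\<A>. fst v \<in> fst c \<longrightarrow> snd (W X Z v) c = \<Phi> c X Z v)"
    by metis
  define Ds where "Ds = (\<lambda>X\<in>VA.sections. \<lambda>Z\<in>AF.sections. \<lambda>v\<in>A. W X Z v)"
  have crd: "snd (Ds X Z v) c = \<Phi> c X Z v" if "X \<in> VA.sections" "Z \<in> AF.sections" "v \<in> A" "c \<in> \<A>" "fst v \<in> fst c"
    for X Z v c
    using W[OF that(1-3)] that by (simp add: Ds_def)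
  have sm: "smooth_on (AF.cdom c) (\<lambda>u. \<Gamma>' (chart_inv (nc c) u) \<xi> \<zeta>)"
    and bil: "bilinear (\<Gamma>' v)" if "aniso_rep c \<Gamma>' D" for c \<Gamma>' v \<xi> \<zeta>
    using that unfolding aniso_rep_def by blast+
  have rep: "linear_rep c (\<lambda>v w \<zeta>. \<Gamma>' v (fst w) \<zeta>) Ds" if c: "c \<in> \<A>" and \<Gamma>': "aniso_rep c \<Gamma>' D" for c \<Gamma>'
  proof -
    have "bilinear (\<lambda>w \<zeta>. \<Gamma>' v (fst w) \<zeta>)" for v
      unfolding bilinear_def by (auto intro!: linearI simp: bilinear_simps[OF bil[OF \<Gamma>']])
    moreover have "\<Phi> c X Z v = frechet_derivative (AF.crd c Z) (at (snd (nc c) v)) (snd (X v) (nc c))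
        + \<Gamma>' v (fst (snd (X v) (nc c))) (snd (Z v) c)" if "v \<in> A" "fst v \<in> fst c" for X Z v
      unfolding \<Phi>_def using aniso_rep_unique[OF c \<Gamma>[OF c] \<Gamma>' that] by simp
    ultimately show ?thesis unfolding linear_rep_def using crd[OF _ _ _ c] sm[OF \<Gamma>'] by auto
  qed
  have "Ds \<in> linear_connections \<A> A"
  proof (rule linear_connectionsI)
    have "Ds X Z \<in> AF.sections" if X: "X \<in> VA.sections" and Z: "Z \<in> AF.sections" for X Z
    proof (rule AF.sectionsI)
      show "Ds X Z v \<in> tangent_space \<A> (fst v)" if v: "v \<in> A" for v
        using W[OF X Z v] X Z v by (simp add: Ds_def)
      show "Ds X Z v = undefined" if "v \<notin> A" for v
        using that X Z by (simp add: Ds_def)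
      fix c assume c: "c \<in> \<A>"
      let ?h = "\<lambda>u. frechet_derivative (AF.crd c Z) (at u) (VA.crd c X u)
          + \<Gamma> c (chart_inv (nc c) u) (fst (VA.crd c X u)) (AF.crd c Z u)"
      note o = AF.open_cdom[OF c]
      have "smooth_on (AF.cdom c) ?h"
        by (rule smooth_on_add[OF o
              smooth_on_frechet_apply[OF o AF.smooth_crd[OF Z c] VA.smooth_crd[OF X c]]
              smooth_on_bilinear_family[OF o, where B = "\<lambda>u. \<Gamma> c (chart_inv (nc c) u)", OF sm[OF \<Gamma>[OF c]] bil[OF \<Gamma>[OF c]]
                smooth_on_fst[OF o VA.smooth_crd[OF X c]] AF.smooth_crd[OF Z c]]])
      moreover have eq: "AF.crd c (Ds X Z) u = ?h u" if u: "u \<in> AF.cdom c" for u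
      proof -
        obtain v where v: "u = snd (nc c) v" "v \<in> A" "fst v \<in> fst c" "v \<in> fst (nc c)" by (rule cdomE[OF u])
        show ?thesis
          unfolding v(1) AF.crd_chart[OF c v(4)] VA.crd_chart[OF c v(4)] AF.chart_inv[OF c v(4)]
          using crd[OF X Z v(2) c v(3)] unfolding \<Phi>_def .
      qed
      ultimately show "smooth_on (AF.cdom c) (AF.crd c (Ds X Z))"
        by (subst smooth_on_cong[OF AF.open_cdom[OF c]]) assumption+
    qed
    then show "Ds \<in> VA.sections \<rightarrow>\<^sub>E AF.sections \<rightarrow>\<^sub>E AF.sections"
      by (auto simp: PiE_iff extensional_def) (auto simp: Ds_def)
    show "\<exists>G. linear_rep c G Ds" if "c \<in> \<A>" for c
      using rep[OF that \<Gamma>[OF that]] by blast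
  qed
  then show thesis using that rep by blast
qed

text \<open>\<open>deriv_along\<close> extends \<open>w\<close> by an arbitrary field. In the
  coordinate formula that field enters through its value at \<open>v\<close> alone, so the choice is
  immaterial.\<close>

lemma deriv_along_rep:
  assumes D: "D \<in> linear_connections \<A> A" and G: "linear_rep c G D" and c: "c \<in> \<A>"
    and v: "v \<in> A" "fst v \<in> fst c" and w: "w \<in> tangent_space (tangent_atlas \<A>) v" and Z: "Z \<in> AF.sections"
  shows "deriv_along \<A> A D w Z \<in> tangent_space \<A> (fst v)"
    and "snd (deriv_along \<A> A D w Z) c =
      frechet_derivative (AF.crd c Z) (at (snd (nc c) v)) (snd w (nc c)) + G v (snd w (nc c)) (snd (Z v) c)"
proof -
  have wv: "fst w = v" using T.fst_tangent_space[OF w] .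
  have vc: "v \<in> fst (nc c)" using in_nc v by simp
  obtain X where X: "X \<in> VA.sections" "snd (X v) (nc c) = snd w (nc c)"
    using ex_fields_through_vector[OF c v, of "snd w (nc c)" 0] by metis
  have "X v = w"
    by (rule VA.fibre_eqI[OF c v(1) vc VA.section_fibre[OF X(1) v(1)] w X(2)])
  with X(1) have "\<exists>X. X \<in> vector_fields (tangent_atlas \<A>) A \<and> X (fst w) = w"
    unfolding sections_VA wv by blast
  from someI_ex[OF this] obtain X' where X': "X' \<in> VA.sections" "X' v = w"
    "deriv_along \<A> A D w Z = D X' Z v"
    unfolding deriv_along_def sections_VA wv by blast
  have "D X' Z \<in> AF.sections"
    using D X' Z unfolding linear_connections_def Let_def sections_VA[symmetric] sections_AF[symmetric]
    by (auto simp: PiE_iff)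
  from AF.section_fibre[OF this v(1)] show "deriv_along \<A> A D w Z \<in> tangent_space \<A> (fst v)"
    unfolding X'(3) .
  have "snd (D X' Z v) c = frechet_derivative (AF.crd c Z) (at (snd (nc c) v)) (snd (X' v) (nc c)) + G v (snd (X' v) (nc c)) (snd (Z v) c)"
    using G v X'(1) Z unfolding linear_rep_def by blast
  then show "snd (deriv_along \<A> A D w Z) c =
      frechet_derivative (AF.crd c Z) (at (snd (nc c) v)) (snd w (nc c)) + G v (snd w (nc c)) (snd (Z v) c)"
    unfolding X' .
qed

end

section \<open>The vertical bundle and homotheties\<close>

context conic_manifold
begin

lemma natural_chart_open: "c \<in> \<A> \<Longrightarrow> open (snd (nc c) ` fst (nc c))"
  using T.open_image M.natural_chart_in_tangent_atlas by blast

lemma chart_inv_nc [simp]: "c \<in> \<A> \<Longrightarrow> v \<in> fst (nc c) \<Longrightarrow> chart_inv (nc c) (snd c (fst v), snd v c) = v"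
  using T.chart_inv_chart[OF M.natural_chart_in_tangent_atlas, of c v] by simp

lemma tmap_projection:
  assumes w: "w \<in> tangent_space (tangent_atlas \<A>) v" and c: "c \<in> \<A>" "v \<in> fst (nc c)"
  shows "snd (tmap (tangent_atlas \<A>) \<A> fst w) c = fst (snd w (nc c))"
proof (rule T.tmap_coord[OF w M.natural_chart_in_tangent_atlas[OF c(1)] c(2) c(1)])
  show "fst v \<in> fst c" using c(2) M.fst_natural_chart by blast
  have "(fst has_derivative fst) (at (snd (nc c) v))"
    using has_derivative_fst[OF has_derivative_ident] .
  then show "(snd c \<circ> fst \<circ> chart_inv (nc c) has_derivative fst) (at (snd (nc c) v))"
    by (rule has_derivative_transform_within_open[OF _ natural_chart_open[OF c(1)] imageI[OF c(2)]])
      (erule imageE, use c(1) in simp)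
qed

text \<open>The kernel condition speaks of all charts of M; the base part of the coordinates changes
  linearly between charts, so its vanishing in one chart carries over to the others.\<close>

lemma vertical_space_iff:
  assumes v: "v \<in> A" and c: "c \<in> \<A>" "fst v \<in> fst c" and w: "w \<in> tangent_space (tangent_atlas \<A>) v"
  shows "w \<in> vertical_space \<A> v \<longleftrightarrow> fst (snd w (nc c)) = 0"
proof
  have vc: "v \<in> fst (nc c)" using in_nc v c by simp
  show "fst (snd w (nc c)) = 0" if "w \<in> vertical_space \<A> v"
    using that tmap_projection[OF w c(1) vc] unfolding vertical_space_def by simp
  assume 0: "fst (snd w (nc c)) = 0"
  have "snd (tmap (tangent_atlas \<A>) \<A> fst w) d = 0" for d
  proof (cases "d \<in> \<A> \<and> fst v \<in> fst d")
    case True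
    then have "fst (snd w (nc d)) = M.dtrans c d (fst v) 0"
      using natural_chart_change[OF c(1) _ v c(2) _ w] 0 by simp
    also have "\<dots> = 0" using True c by (intro linear_0 M.linear_dtrans) auto
    finally show ?thesis using tmap_projection[OF w, of d] True v in_nc by simp
  next
    case False
    then show ?thesis using T.fst_tangent_space[OF w] by (auto simp: tmap_def Let_def)
  qed
  then have "tmap (tangent_atlas \<A>) \<A> fst w = tzero (fst v)"
    using T.fst_tmap[of \<A> fst w] T.fst_tangent_space[OF w] by (auto simp: prod_eq_iff)
  then show "w \<in> vertical_space \<A> v" using w unfolding vertical_space_def by simp
qed

lemma snd_vertical_lift:
  assumes "c \<in> \<A>" "v \<in> A" "fst v \<in> fst c"
  shows "snd (vertical_lift \<A> v w) (nc c) = (0, snd w c)"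
proof -
  have "((\<lambda>t. snd (nc c) (tadd v (tscale t w))) has_vector_derivative (0, snd w c)) (at 0)"
    by (auto intro!: derivative_eq_intros has_vector_derivative_Pair)
  then show ?thesis
    using assms in_nc M.natural_chart_in_tangent_atlas unfolding vertical_lift_def
    by (simp add: vector_derivative_at)
qed

lemma vertical_lift_in_vertical_space:
  assumes v: "v \<in> A" and w: "w \<in> tangent_space \<A> (fst v)"
  shows "vertical_lift \<A> v w \<in> tangent_space (tangent_atlas \<A>) v" "vertical_lift \<A> v w \<in> vertical_space \<A> v"
proof -
  show t: "vertical_lift \<A> v w \<in> tangent_space (tangent_atlas \<A>) v"
  proof (rule T.tangent_spaceI)
    show "fst (vertical_lift \<A> v w) = v" by (simp add: vertical_lift_def)
    show "snd (vertical_lift \<A> v w) C = 0" if "C \<notin> tangent_atlas \<A> \<or> v \<notin> fst C" for C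
      using that by (auto simp: vertical_lift_def)
    fix C D assume "C \<in> tangent_atlas \<A>" "D \<in> tangent_atlas \<A>" and vCD: "v \<in> fst C" "v \<in> fst D"
    then obtain c d where c: "c \<in> \<A>" "d \<in> \<A>" and CD: "C = nc c" "D = nc d"
      by (auto elim!: M.tangent_atlasE)
    have p: "fst v \<in> fst c" "fst v \<in> fst d" using vCD in_nc[OF v] unfolding CD by auto
    show "snd (vertical_lift \<A> v w) D = T.dtrans C D v (snd (vertical_lift \<A> v w) C)"
      using M.has_derivative_natural_transition(2)[OF c vCD[unfolded CD]] M.tangent_space_dtrans[OF w c p]
      unfolding CD by (simp add: snd_vertical_lift c v p)
  qed
  obtain c where c: "c \<in> \<A>" "fst v \<in> fst c" using ex_chart[OF v] by blast
  show "vertical_lift \<A> v w \<in> vertical_space \<A> v"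
    using vertical_space_iff[OF v c t] snd_vertical_lift[OF c(1) v c(2)] by simp
qed

lemma vertical_bundle_iff: "z \<in> vertical_bundle \<A> A \<longleftrightarrow> fst z \<in> A \<and> z \<in> vertical_space \<A> (fst z)"
  using T.fst_tangent_space unfolding vertical_bundle_def vertical_space_def by blast

lemma vertical_bundle_tangent:
  "z \<in> vertical_bundle \<A> A \<Longrightarrow> z \<in> tangent_space (tangent_atlas \<A>) (fst z)"
  unfolding vertical_bundle_iff vertical_space_def by blast

lemma fst_vertical_lift [simp]: "fst (vertical_lift \<A> v w) = v"
  by (simp add: vertical_lift_def)

lemma vertical_lift_in_bundle:
  "v \<in> A \<Longrightarrow> w \<in> tangent_space \<A> (fst v) \<Longrightarrow> vertical_lift \<A> v w \<in> vertical_bundle \<A> A"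
  using vertical_lift_in_vertical_space unfolding vertical_bundle_iff by simp

lemma vertical_bundle_fst: "z \<in> vertical_bundle \<A> A \<Longrightarrow> c \<in> \<A> \<Longrightarrow> fst (fst z) \<in> fst c \<Longrightarrow> fst (snd z (nc c)) = 0"
  using vertical_space_iff vertical_bundle_iff vertical_bundle_tangent by blast

lemma vertical_bundle_eqI:
  assumes "z \<in> vertical_bundle \<A> A" "z' \<in> vertical_bundle \<A> A" "fst z = fst z'"
    and "c \<in> \<A>" "fst (fst z) \<in> fst c" "snd (snd z (nc c)) = snd (snd z' (nc c))"
  shows "z = z'"
proof (rule T.tangent_space_eqI[OF vertical_bundle_tangent[OF assms(1)] _ M.natural_chart_in_tangent_atlas[OF assms(4)]])
  show "z' \<in> tangent_space (tangent_atlas \<A>) (fst z)"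
    using vertical_bundle_tangent[OF assms(2)] assms(3) by simp
  show "fst z \<in> fst (nc c)" using assms in_nc vertical_bundle_iff by blast
  show "snd z (nc c) = snd z' (nc c)"
    using vertical_bundle_fst assms by (metis prod_eqI)
qed

lemma ex_vertical:
  assumes "v \<in> A" "c \<in> \<A>" "fst v \<in> fst c"
  obtains z where "z \<in> vertical_bundle \<A> A" "fst z = v" "snd (snd z (nc c)) = \<zeta>"
  by (rule that[of "vertical_lift \<A> v (tvec_of \<A> c (fst v) \<zeta>)"])
    (simp_all add: assms vertical_lift_in_bundle M.tvec_of_in_tangent_space snd_vertical_lift)

section \<open>The vertical bundle as a manifold\<close>

abbreviation vc :: "('m, 'e) chart \<Rightarrow> ((('m, 'e) tvec, 'e \<times> 'e) tvec, ('e \<times> 'e) \<times> 'e) chart" where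
  "vc \<equiv> vertical_chart \<A> A"

lemma fst_vc: "z \<in> fst (vc c) \<longleftrightarrow> z \<in> vertical_bundle \<A> A \<and> fst (fst z) \<in> fst c"
  using in_nc[of "fst z" c] vertical_bundle_iff[of z] unfolding vertical_chart_def Let_def by auto

lemma fst_vc_nc: "z \<in> fst (vc c) \<Longrightarrow> fst z \<in> A \<and> fst z \<in> fst (nc c)"
  using in_nc vertical_bundle_iff unfolding fst_vc by blast

lemma snd_vc: "snd (vc c) z = (snd (nc c) (fst z), snd (snd z (nc c)))"
  unfolding vertical_chart_def Let_def by simp

lemma inj_vc: 
  assumes c: "c \<in> \<A>"
  shows "inj_on (snd (vc c)) (fst (vc c))"
proof (rule inj_onI)
  fix z z' assume z: "z \<in> fst (vc c)" "z' \<in> fst (vc c)" "snd (vc c) z = snd (vc c) z'"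
  have "fst z \<in> fst (nc c)" "fst z' \<in> fst (nc c)"
    using fst_vc_nc z(1,2) by blast+
  then have "fst z = fst z'"
    using z(3) M.inj_natural_chart[OF c] unfolding snd_vc inj_on_def by blast
  then show "z = z'"
    using z c unfolding fst_vc snd_vc by (intro vertical_bundle_eqI[of z z' c]) auto
qed

text \<open>The vertical bundle lies over \<open>A\<close> only, hence the factor
  \<open>AF.cdom c\<close>; its fibres are full vector spaces.\<close>

lemma vc_image:
  assumes c: "c \<in> \<A>"
  shows "snd (vc c) ` (fst (vc c) \<inter> fst (vc d)) =
    (snd (nc c) ` (fst (nc c) \<inter> fst (nc d)) \<inter> AF.cdom c) \<times> UNIV"
proof
  show "snd (vc c) ` (fst (vc c) \<inter> fst (vc d)) \<subseteq> (snd (nc c) ` (fst (nc c) \<inter> fst (nc d)) \<inter> AF.cdom c) \<times> UNIV"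
    using fst_vc_nc unfolding AF.cdom_def snd_vc by blast
  show "(snd (nc c) ` (fst (nc c) \<inter> fst (nc d)) \<inter> AF.cdom c) \<times> UNIV \<subseteq> snd (vc c) ` (fst (vc c) \<inter> fst (vc d))"
  proof
    fix y assume "y \<in> (snd (nc c) ` (fst (nc c) \<inter> fst (nc d)) \<inter> AF.cdom c) \<times> (UNIV :: 'e set)"
    then have "fst y \<in> snd (nc c) ` (fst (nc c) \<inter> fst (nc d)) \<inter> AF.cdom c" by (simp only: mem_Times_iff)
    then obtain v where v: "fst y = snd (nc c) v" "v \<in> A" "v \<in> fst (nc c)" "v \<in> fst (nc d)"
      by (rule AF.overlapE[OF c])
    then have p: "fst v \<in> fst c" "fst v \<in> fst d" using in_nc by auto
    obtain z where z: "z \<in> vertical_bundle \<A> A" "fst z = v" "snd (snd z (nc c)) = snd y"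
      using ex_vertical[OF v(2) c p(1)] .
    then have "y = snd (vc c) z" using v(1) unfolding snd_vc by (simp add: prod_eq_iff)
    moreover have "z \<in> fst (vc c) \<inter> fst (vc d)" using z p by (simp add: fst_vc)
    ultimately show "y \<in> snd (vc c) ` (fst (vc c) \<inter> fst (vc d))" by blast
  qed
qed

lemma open_vc_image: "c \<in> \<A> \<Longrightarrow> d \<in> \<A> \<Longrightarrow> open (snd (vc c) ` (fst (vc c) \<inter> fst (vc d)))"
  unfolding vc_image by (intro open_Times AF.open_overlap_cdom open_UNIV)

lemma chart_inv_vc: "c \<in> \<A> \<Longrightarrow> z \<in> fst (vc c) \<Longrightarrow> chart_inv (vc c) (snd (vc c) z) = z"
  unfolding chart_inv_def by (rule inv_into_f_f[OF inj_vc])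

text \<open>A vertical vector has base part 0 in every chart, so its fibre coordinate changes by the
  vertical block of the Jacobian, which is the Jacobian of the base coordinates.\<close>

lemma transition_vc:
  assumes c: "c \<in> \<A>" "d \<in> \<A>" and y: "y \<in> snd (vc c) ` (fst (vc c) \<inter> fst (vc d))"
  shows "transition (vc c) (vc d) y =
    (transition (nc c) (nc d) (fst y), frechet_derivative (transition c d) (at (fst (fst y))) (snd y))"
proof -
  obtain z where z: "z \<in> fst (vc c)" "z \<in> fst (vc d)" "y = snd (vc c) z" using y by blast
  then have v: "fst z \<in> fst (nc c)" "fst z \<in> fst (nc d)" and zb: "z \<in> vertical_bundle \<A> A"
    and p: "fst (fst z) \<in> fst c" "fst (fst z) \<in> fst d"
    using fst_vc_nc fst_vc by blast+
  have "snd z (nc d) = T.dtrans (nc c) (nc d) (fst z) (0, snd (snd z (nc c)))"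
    using T.tangent_space_dtrans[OF vertical_bundle_tangent[OF zb] _ _ v] c M.natural_chart_in_tangent_atlas
      vertical_bundle_fst[OF zb c(1) p(1)] by (metis prod.collapse)
  then have "snd (snd z (nc d)) = M.dtrans c d (fst (fst z)) (snd (snd z (nc c)))"
    using M.has_derivative_natural_transition(2)[OF c v] by simp
  moreover have "transition (nc c) (nc d) (snd (nc c) (fst z)) = snd (nc d) (fst z)"
    using T.transition_chart[OF M.natural_chart_in_tangent_atlas[OF c(1)] v(1)] .
  moreover have "transition (vc c) (vc d) y = snd (vc d) z"
    unfolding transition_def z(3) using chart_inv_vc[OF c(1) z(1)] by simp
  ultimately show ?thesis unfolding z(3) snd_vc by (simp add: M.dtrans_def)
qed

lemma smooth_atlas_vertical: "smooth_atlas (vertical_atlas \<A> A)"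
proof
  show "inj_on (snd C) (fst C)" if "C \<in> vertical_atlas \<A> A" for C
    using that inj_vc unfolding vertical_atlas_def by auto
next
  fix C D assume "C \<in> vertical_atlas \<A> A" "D \<in> vertical_atlas \<A> A"
  then obtain c d where c: "c \<in> \<A>" "d \<in> \<A>" and CD: "C = vc c" "D = vc d"
    unfolding vertical_atlas_def by auto
  show o: "open (snd C ` (fst C \<inter> fst D))"
    unfolding CD by (rule open_vc_image[OF c])
  note o = o[unfolded CD]
  let ?O = "snd (vc c) ` (fst (vc c) \<inter> fst (vc d))"
  have sub: "fst ` ?O \<subseteq> snd (nc c) ` (fst (nc c) \<inter> fst (nc d))"
    unfolding vc_image[OF c(1)] by auto
  have sub': "fst ` fst ` ?O \<subseteq> snd c ` (fst c \<inter> fst d)"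
    using image_mono[OF sub, of fst] unfolding M.natural_chart_image[OF c(1)] by auto
  have N: "nc c \<in> tangent_atlas \<A>" "nc d \<in> tangent_atlas \<A>"
    using c M.natural_chart_in_tangent_atlas by auto
  have "smooth_on ?O (\<lambda>y. transition (nc c) (nc d) (fst y))"
    by (rule smooth_on_compose[OF o T.open_overlap[OF N] T.smooth_transition[OF N] smooth_on_fst[OF o smooth_on_id[OF o]] sub])
  moreover have "smooth_on ?O (\<lambda>y. frechet_derivative (transition c d) (at (fst (fst y))) (snd y))"
  proof (rule smooth_on_linear_family[OF o, where T = "\<lambda>y. frechet_derivative (transition c d) (at (fst (fst y)))" and h = snd])
    show "smooth_on ?O (\<lambda>y. frechet_derivative (transition c d) (at (fst (fst y))) i)" for i
      by (rule smooth_on_compose[OF o M.open_overlap[OF c] smooth_on_frechet[OF M.smooth_transition[OF c]]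
            smooth_on_fst[OF o smooth_on_fst[OF o smooth_on_id[OF o]]]])
        (use sub' in \<open>simp add: image_image\<close>)
    show "linear (frechet_derivative (transition c d) (at (fst (fst y))))" if "y \<in> ?O" for y
    proof -
      have "fst (fst y) \<in> snd c ` (fst c \<inter> fst d)" using that sub' by blast
      then show ?thesis using M.linear_dtrans[OF c] unfolding M.dtrans_def by auto
    qed
    show "smooth_on ?O snd" by (intro smooth_on_snd smooth_on_id o)
  qed
  ultimately have s: "smooth_on ?O (\<lambda>y. (transition (nc c) (nc d) (fst y), frechet_derivative (transition c d) (at (fst (fst y))) (snd y)))"
    by (rule smooth_on_Pair[OF o])
  show "smooth_on (snd C ` (fst C \<inter> fst D)) (transition C D)"
    unfolding CD by (rule iffD2[OF smooth_on_cong[OF o transition_vc[OF c]] s])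
qed

sublocale V: smooth_atlas "vertical_atlas \<A> A" by (rule smooth_atlas_vertical)

lemma vc_in_atlas: "c \<in> \<A> \<Longrightarrow> vc c \<in> vertical_atlas \<A> A"
  unfolding vertical_atlas_def by simp

lemma vertical_atlasE:
  assumes "C \<in> vertical_atlas \<A> A"
  obtains c where "c \<in> \<A>" "C = vc c"
  using assms unfolding vertical_atlas_def by blast

lemma in_vc: "z \<in> vertical_bundle \<A> A \<Longrightarrow> fst (fst z) \<in> fst c \<Longrightarrow> z \<in> fst (vc c)"
  unfolding fst_vc by blast

subsection \<open>Tangent maps of sections and homotheties\<close>

text \<open>In the charts \<open>nc c\<close> and \<open>vc c\<close> the lifted section is the
  graph map of \<open>AF.crd c Z\<close>.\<close>

lemma tmap_lift:
  assumes Z: "Z \<in> AF.sections" and v: "v \<in> A" and w: "w \<in> tangent_space (tangent_atlas \<A>) v"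
  shows "tmap (tangent_atlas \<A>) (vertical_atlas \<A> A) (\<lambda>v. vertical_lift \<A> v (Z v)) w
      \<in> tangent_space (vertical_atlas \<A> A) (vertical_lift \<A> v (Z v))"
    and "c \<in> \<A> \<Longrightarrow> fst v \<in> fst c \<Longrightarrow>
      snd (tmap (tangent_atlas \<A>) (vertical_atlas \<A> A) (\<lambda>v. vertical_lift \<A> v (Z v)) w) (vc c) =
      (snd w (nc c), frechet_derivative (AF.crd c Z) (at (snd (nc c) v)) (snd w (nc c)))"
proof -
  let ?f = "\<lambda>v. vertical_lift \<A> v (Z v)"
  have fz: "?f u \<in> vertical_bundle \<A> A" if "u \<in> A" for u
    by (rule vertical_lift_in_bundle[OF that AF.section_fibre[OF Z that]])
  have der: "(snd (vc c) \<circ> ?f \<circ> chart_inv (nc c) has_derivative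
      (\<lambda>e. (e, frechet_derivative (AF.crd c Z) (at (snd (nc c) v)) e))) (at (snd (nc c) v))"
    if c: "c \<in> \<A>" "fst v \<in> fst c" for c
  proof -
    have vc: "v \<in> fst (nc c)" using v c in_nc by simp
    have "((\<lambda>u. (u, AF.crd c Z u)) has_derivative
        (\<lambda>e. (e, frechet_derivative (AF.crd c Z) (at (snd (nc c) v)) e))) (at (snd (nc c) v))"
      by (intro has_derivative_Pair has_derivative_ident AF.crd_has_derivative Z c v vc)
    then show ?thesis
    proof (rule has_derivative_transform_within_open[OF _ AF.open_cdom[OF c(1)] AF.in_cdom[OF v vc]])
      fix u assume "u \<in> AF.cdom c"
      then obtain v' where v': "u = snd (nc c) v'" "v' \<in> A" "fst v' \<in> fst c" "v' \<in> fst (nc c)" by (rule cdomE)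
      show "(u, AF.crd c Z u) = (snd (vc c) \<circ> ?f \<circ> chart_inv (nc c)) u"
        unfolding v'(1) AF.crd_chart[OF c(1) v'(4)] o_def AF.chart_inv[OF c(1) v'(4)] snd_vc
        by (simp only: fst_vertical_lift snd_vertical_lift[OF c(1) v'(2,3)] snd_conv)
    qed
  qed
  show "tmap (tangent_atlas \<A>) (vertical_atlas \<A> A) ?f w \<in> tangent_space (vertical_atlas \<A> A) (?f v)"
  proof (rule T.tmap_in_tangent_space[OF smooth_atlas_vertical w])
    fix D assume D: "D \<in> vertical_atlas \<A> A" "?f v \<in> fst D"
    then obtain d where d: "d \<in> \<A>" "D = vc d" by (auto elim: vertical_atlasE)
    then have p: "fst v \<in> fst d" using D(2) by (simp add: fst_vc)
    have "?f (chart_inv (nc d) x) \<in> fst D" if x: "x \<in> AF.cdom d" for x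
    proof -
      obtain v' where v': "x = snd (nc d) v'" "v' \<in> A" "fst v' \<in> fst d" "v' \<in> fst (nc d)" using x by (rule cdomE)
      show ?thesis using fz[OF v'(2)] v'(3) unfolding v'(1) AF.chart_inv[OF d(1) v'(4)] d(2) by (simp add: fst_vc)
    qed
    then show "\<exists>c N f'. c \<in> tangent_atlas \<A> \<and> v \<in> fst c \<and> (snd D \<circ> ?f \<circ> chart_inv c has_derivative f') (at (snd c v)) \<and>
        open N \<and> snd c v \<in> N \<and> (\<forall>x\<in>N. ?f (chart_inv c x) \<in> fst D)"
      using der[OF d(1) p] AF.open_cdom[OF d(1)] AF.in_cdom[OF v] in_nc[OF v] p
        M.natural_chart_in_tangent_atlas[OF d(1)] unfolding d(2) by blast
  qed
  show "snd (tmap (tangent_atlas \<A>) (vertical_atlas \<A> A) ?f w) (vc c) =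
      (snd w (nc c), frechet_derivative (AF.crd c Z) (at (snd (nc c) v)) (snd w (nc c)))"
    if c: "c \<in> \<A>" "fst v \<in> fst c"
    by (rule T.tmap_coord[OF w M.natural_chart_in_tangent_atlas[OF c(1)] _ vc_in_atlas[OF c(1)] _ der[OF c]])
      (use fz[OF v] c v in_nc in \<open>simp_all add: fst_vc\<close>)
qed

text \<open>One direction reads the parallel condition in the chart. The other has to produce a
  global section with prescribed value at the point and prescribed derivative in one
  direction.\<close>

lemma horizontal_distribution_iff:
  assumes D: "D \<in> linear_connections \<A> A" and G: "linear_rep c G D" and z: "z \<in> vertical_bundle \<A> A"
    and c: "c \<in> \<A>" "fst (fst z) \<in> fst c"
  shows "e \<in> horizontal_distribution \<A> A D z \<longleftrightarrow> e \<in> tangent_space (vertical_atlas \<A> A) z \<and>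
    snd (snd e (vc c)) = - G (fst z) (fst (snd e (vc c))) (snd (snd z (nc c)))"
proof
  let ?v = "fst z" and ?\<zeta> = "snd (snd z (nc c))"
  have v: "?v \<in> A" using z vertical_bundle_iff by blast
  note dr = deriv_along_rep[OF D G c(1) v c(2)]
  have vn: "?v \<in> fst (nc c)" using in_nc v c by simp
  {
    assume "e \<in> horizontal_distribution \<A> A D z"
    then obtain Z w where Z: "Z \<in> AF.sections" and w: "w \<in> tangent_space (tangent_atlas \<A>) ?v"
      and zZ: "vertical_lift \<A> ?v (Z ?v) = z" and par: "deriv_along \<A> A D w Z = tzero (fst ?v)"
      and e: "e = tmap (tangent_atlas \<A>) (vertical_atlas \<A> A) (\<lambda>v. vertical_lift \<A> v (Z v)) w"
      unfolding horizontal_distribution_def sections_AF by blast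
    have "snd (Z ?v) c = ?\<zeta>" using snd_vertical_lift[OF c(1) v c(2), of "Z ?v"] zZ by simp
    then have "frechet_derivative (AF.crd c Z) (at (snd (nc c) ?v)) (snd w (nc c)) + G ?v (snd w (nc c)) ?\<zeta> = 0"
      using dr(2)[OF w Z] par by simp
    then show "e \<in> tangent_space (vertical_atlas \<A> A) z \<and> snd (snd e (vc c)) = - G ?v (fst (snd e (vc c))) ?\<zeta>"
      using tmap_lift[OF Z v w] c zZ unfolding e by (simp add: eq_neg_iff_add_eq_0)
  }
  {
    assume e: "e \<in> tangent_space (vertical_atlas \<A> A) z \<and> snd (snd e (vc c)) = - G ?v (fst (snd e (vc c))) ?\<zeta>"
    define \<omega> where "\<omega> = fst (snd e (vc c))"
    define \<tau> where "\<tau> = snd (snd e (vc c))"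
    have \<tau>: "\<tau> = - G ?v \<omega> ?\<zeta>" using e unfolding \<tau>_def \<omega>_def by blast
    have "bilinear (G ?v)" using G unfolding linear_rep_def by blast
    then have \<tau>0: "\<tau> = 0" if "\<omega> = 0" using that \<tau> by (simp add: bilinear_lzero)
    define w where "w = tvec_of (tangent_atlas \<A>) (nc c) ?v \<omega>"
    have w: "w \<in> tangent_space (tangent_atlas \<A>) ?v" "snd w (nc c) = \<omega>"
      unfolding w_def using M.natural_chart_in_tangent_atlas[OF c(1)] vn by (auto intro: T.tvec_of_in_tangent_space)
    \<comment> \<open>The affine function with value \<open>?\<zeta>\<close> at the point and
      derivative \<open>\<tau>\<close> along \<open>\<omega>\<close>. For
      \<open>\<omega> = 0\<close> the quotient is 0 by convention, which is right because then
      \<open>\<tau> = 0\<close> by bilinearity.\<close>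
    define g where "g = (\<lambda>u. ?\<zeta> + ((u - snd (nc c) ?v) \<bullet> \<omega> / (\<omega> \<bullet> \<omega>)) *\<^sub>R \<tau>)"
    have g': "(g has_derivative (\<lambda>h. (h \<bullet> \<omega> / (\<omega> \<bullet> \<omega>)) *\<^sub>R \<tau>)) (at (snd (nc c) ?v))"
      unfolding g_def divide_inverse by (auto intro!: derivative_eq_intros)
    have "smooth_on (AF.cdom c) (\<lambda>u. ?\<zeta> + (((u + - snd (nc c) ?v) \<bullet> \<omega>) * inverse (\<omega> \<bullet> \<omega>)) *\<^sub>R \<tau>)"
      by (intro smooth_on_add smooth_on_scaleR smooth_on_mult smooth_on_inner smooth_on_const smooth_on_id AF.open_cdom c)
    then have sg: "smooth_on (AF.cdom c) g" 
      unfolding g_def divide_inverse by (simp only: diff_conv_add_uminus)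
    obtain b N where b: "AF.cutoff c b" "AF.one_near c b N" "snd (nc c) ?v \<in> N"
      using ex_cutoff_A[OF c(1) v c(2)] .
    let ?Z = "AF.extend c b g"
    have Z: "?Z \<in> AF.sections" by (rule AF.extend_in_sections[OF b(1) sg])
    have "b ?v = 1" using b(2,3) v vn unfolding AF.one_near_def by blast
    then have Zv: "snd (?Z ?v) c = ?\<zeta>"
      using AF.extend_inside(2)[OF c(1) v vn] by (simp add: g_def)
    have dZ: "frechet_derivative (AF.crd c ?Z) (at (snd (nc c) ?v)) \<omega> = \<tau>"
      unfolding AF.derivative_extend[OF b(1,2) v vn b(3) g'] using \<tau>0 by (cases "\<omega> = 0") auto
    have lz: "vertical_lift \<A> ?v (?Z ?v) = z"
      by (rule vertical_bundle_eqI[OF vertical_lift_in_bundle[OF v AF.section_fibre[OF Z v]] z _ c(1)])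
        (simp_all add: snd_vertical_lift[OF c(1) v c(2)] Zv c)
    have "snd (deriv_along \<A> A D w ?Z) c = 0"
      using dr(2)[OF w(1) Z] w(2) dZ Zv \<tau> by simp
    then have par: "deriv_along \<A> A D w ?Z = tzero (fst ?v)"
      by (intro M.tangent_space_eqI[OF dr(1)[OF w(1) Z] M.tzero_in_tangent_space c]) simp
    have "e = tmap (tangent_atlas \<A>) (vertical_atlas \<A> A) (\<lambda>v. vertical_lift \<A> v (?Z v)) w"
      (is "e = ?e")
    proof (rule V.tangent_space_eqI[OF _ _ vc_in_atlas[OF c(1)] in_vc[OF z c(2)]])
      show "e \<in> tangent_space (vertical_atlas \<A> A) z" using e by blast
      show "?e \<in> tangent_space (vertical_atlas \<A> A) z" using tmap_lift(1)[OF Z v w(1)] unfolding lz .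
      show "snd e (vc c) = snd ?e (vc c)"
        using tmap_lift(2)[OF Z v w(1) c] w(2) dZ by (simp add: prod_eq_iff \<omega>_def \<tau>_def)
    qed
    then show "e \<in> horizontal_distribution \<A> A D z"
      unfolding horizontal_distribution_def
      using Z[unfolded sections_AF] w(1) lz par
      by (intro CollectI exI[of _ ?Z] exI[of _ w] conjI)
  }
qed

section \<open>Homotheties of the vertical bundle and invariance under them\<close>

definition homothety :: "real \<Rightarrow> (('m, 'e) tvec, 'e \<times> 'e) tvec \<Rightarrow> (('m, 'e) tvec, 'e \<times> 'e) tvec" where
  "homothety r = tmap (tangent_atlas \<A>) (tangent_atlas \<A>) (tscale r)"

lemma tscale_in_nc: "v \<in> fst (nc c) \<Longrightarrow> tscale r v \<in> fst (nc c)"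
  using M.tscale_in_tangent_space by (simp add: M.fst_natural_chart)

lemma homothety_vertical:
  assumes z: "z \<in> vertical_bundle \<A> A" and r: "r > 0"
  shows "fst (homothety r z) = tscale r (fst z)" "homothety r z \<in> vertical_bundle \<A> A"
    and "c \<in> \<A> \<Longrightarrow> fst (fst z) \<in> fst c \<Longrightarrow> snd (homothety r z) (nc c) = (0, r *\<^sub>R snd (snd z (nc c)))"
proof -
  let ?v = "fst z"
  have v: "?v \<in> A" and w: "z \<in> tangent_space (tangent_atlas \<A>) ?v"
    using z vertical_bundle_iff vertical_bundle_tangent by auto
  have der: "(snd (nc c) \<circ> tscale r \<circ> chart_inv (nc c) has_derivative (\<lambda>e. (fst e, r *\<^sub>R snd e))) (at (snd (nc c) ?v))"
    if c: "c \<in> \<A>" "?v \<in> fst (nc c)" for c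
  proof -
    have "((\<lambda>u. (fst u, r *\<^sub>R snd u)) has_derivative (\<lambda>e. (fst e, r *\<^sub>R snd e))) (at (snd (nc c) ?v))"
      by (auto intro!: derivative_eq_intros)
    then show ?thesis
      by (rule has_derivative_transform_within_open[OF _ natural_chart_open[OF c(1)] imageI[OF c(2)]])
        (erule imageE, use c(1) tscale_in_nc in simp)
  qed
  show f: "fst (homothety r z) = tscale r ?v" unfolding homothety_def by (simp add: T.fst_tmap)
  have t: "homothety r z \<in> tangent_space (tangent_atlas \<A>) (tscale r ?v)"
    unfolding homothety_def
  proof (rule T.tmap_in_tangent_space[OF T.smooth_atlas_axioms w])
    fix C assume C: "C \<in> tangent_atlas \<A>" "tscale r ?v \<in> fst C"
    then obtain c where c: "c \<in> \<A>" "C = nc c" by (auto elim: M.tangent_atlasE)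
    then have "fst ?v \<in> fst c" using C(2) M.fst_natural_chart[of "tscale r ?v" c] by simp
    then have vc: "?v \<in> fst (nc c)" using in_nc[OF v] by blast
    have "tscale r (chart_inv (nc c) x) \<in> fst (nc c)" if "x \<in> snd (nc c) ` fst (nc c)" for x
      using that by (rule imageE) (use c(1) tscale_in_nc in simp)
    then show "\<exists>c N f'. c \<in> tangent_atlas \<A> \<and> ?v \<in> fst c \<and>
        (snd C \<circ> tscale r \<circ> chart_inv c has_derivative f') (at (snd c ?v)) \<and>
        open N \<and> snd c ?v \<in> N \<and> (\<forall>x\<in>N. tscale r (chart_inv c x) \<in> fst C)"
      using der[OF c(1) vc] natural_chart_open[OF c(1)] vc C(1) unfolding c(2) by blast
  qed
  have s: "snd (homothety r z) (nc c) = (0, r *\<^sub>R snd (snd z (nc c)))" if c: "c \<in> \<A>" "fst ?v \<in> fst c" for c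
  proof -
    have vc: "?v \<in> fst (nc c)" using c v in_nc by simp
    have "snd (homothety r z) (nc c) = (fst (snd z (nc c)), r *\<^sub>R snd (snd z (nc c)))"
      unfolding homothety_def
      by (rule T.tmap_coord[OF w _ vc _ tscale_in_nc[OF vc] der[OF c(1) vc]])
        (use c M.natural_chart_in_tangent_atlas in auto)
    then show ?thesis using vertical_bundle_fst[OF z c] by simp
  qed
  then show "c \<in> \<A> \<Longrightarrow> fst ?v \<in> fst c \<Longrightarrow> snd (homothety r z) (nc c) = (0, r *\<^sub>R snd (snd z (nc c)))" .
  obtain c where c: "c \<in> \<A>" "fst ?v \<in> fst c" using ex_chart[OF v] by blast
  show "homothety r z \<in> vertical_bundle \<A> A"
    unfolding vertical_bundle_iff f
    using tscale_in_A[OF r v] vertical_space_iff[OF tscale_in_A[OF r v] c(1) _ t] s[OF c] c by simp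
qed

text \<open>In the charts \<open>vc c\<close> the homothety is the restriction of a linear map,
  which is its own derivative.\<close>

lemma tmap_homothety:
  assumes z: "z \<in> vertical_bundle \<A> A" and r: "r > 0" and e: "e \<in> tangent_space (vertical_atlas \<A> A) z"
  defines "h \<equiv> tmap (vertical_atlas \<A> A) (vertical_atlas \<A> A) (homothety r)"
  shows "h e \<in> tangent_space (vertical_atlas \<A> A) (homothety r z)"
    and "c \<in> \<A> \<Longrightarrow> fst (fst z) \<in> fst c \<Longrightarrow> snd (h e) (vc c) =
      ((fst (fst (snd e (vc c))), r *\<^sub>R snd (fst (snd e (vc c)))), r *\<^sub>R snd (snd e (vc c)))"
proof -
  have open_vc: "open (snd (vc c) ` fst (vc c))" if "c \<in> \<A>" for c
    using open_vc_image[OF that that] by simp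
  have mem: "homothety r (chart_inv (vc c) x) \<in> fst (vc c)" if "c \<in> \<A>" "x \<in> snd (vc c) ` fst (vc c)" for c x
    using that homothety_vertical[OF _ r] by (auto simp: chart_inv_vc fst_vc)
  have der: "(snd (vc c) \<circ> homothety r \<circ> chart_inv (vc c) has_derivative
      (\<lambda>e. ((fst (fst e), r *\<^sub>R snd (fst e)), r *\<^sub>R snd e))) (at (snd (vc c) z))"
    if c: "c \<in> \<A>" "z \<in> fst (vc c)" for c
  proof -
    have "((\<lambda>u. ((fst (fst u), r *\<^sub>R snd (fst u)), r *\<^sub>R snd u)) has_derivative
        (\<lambda>e. ((fst (fst e), r *\<^sub>R snd (fst e)), r *\<^sub>R snd e))) (at (snd (vc c) z))"
      by (auto intro!: derivative_eq_intros)
    then show ?thesis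
    proof (rule has_derivative_transform_within_open[OF _ open_vc[OF c(1)] imageI[OF c(2)]])
      fix x assume "x \<in> snd (vc c) ` fst (vc c)"
      then obtain y where y: "x = snd (vc c) y" "y \<in> fst (vc c)" by blast
      then have "y \<in> vertical_bundle \<A> A" "fst (fst y) \<in> fst c" by (auto simp: fst_vc)
      note hy = homothety_vertical[OF this(1) r] and p = this(2)
      show "((fst (fst x), r *\<^sub>R snd (fst x)), r *\<^sub>R snd x) = (snd (vc c) \<circ> homothety r \<circ> chart_inv (vc c)) x"
        using hy(1) hy(3)[OF c(1) p] unfolding y(1) o_def chart_inv_vc[OF c(1) y(2)] by (simp add: snd_vc)
    qed
  qed
  show "h e \<in> tangent_space (vertical_atlas \<A> A) (homothety r z)"
    unfolding h_def
  proof (rule V.tmap_in_tangent_space[OF smooth_atlas_vertical e])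
    fix C assume C: "C \<in> vertical_atlas \<A> A" "homothety r z \<in> fst C"
    then obtain c where c: "c \<in> \<A>" "C = vc c" by (auto elim: vertical_atlasE)
    then have zc: "z \<in> fst (vc c)" using C(2) z homothety_vertical(1)[OF z r] by (simp add: fst_vc)
    show "\<exists>c N f'. c \<in> vertical_atlas \<A> A \<and> z \<in> fst c \<and>
        (snd C \<circ> homothety r \<circ> chart_inv c has_derivative f') (at (snd c z)) \<and>
        open N \<and> snd c z \<in> N \<and> (\<forall>x\<in>N. homothety r (chart_inv c x) \<in> fst C)"
      using der[OF c(1) zc] open_vc[OF c(1)] zc C(1) mem[OF c(1)] unfolding c(2) by blast
  qed
  show "snd (h e) (vc c) = ((fst (fst (snd e (vc c))), r *\<^sub>R snd (fst (snd e (vc c)))), r *\<^sub>R snd (snd e (vc c)))"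
    if c: "c \<in> \<A>" "fst (fst z) \<in> fst c"
  proof -
    have zc: "z \<in> fst (vc c)" using z c by (simp add: fst_vc)
    have "homothety r z \<in> fst (vc c)" using homothety_vertical(1,2)[OF z r] c by (simp add: fst_vc)
    from V.tmap_coord[OF e vc_in_atlas[OF c(1)] zc vc_in_atlas[OF c(1)] this der[OF c(1) zc]]
    show ?thesis unfolding h_def .
  qed
qed

text \<open>The differential of the homothety multiplies the fibre component of a horizontal vector
  by \<open>r\<close>, and the point \<open>z\<close>, which is the second argument of
  \<open>G\<close>, is multiplied by \<open>r\<close> too. The two factors cancel, so a factor
  \<open>r\<close> is left only on the vertical part \<open>\<eta>\<close> of the direction.\<close>

lemma homothety_invariant_iff:
  assumes D: "D \<in> linear_connections \<A> A" and G: "\<And>c. c \<in> \<A> \<Longrightarrow> linear_rep c (G c) D"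
  shows "homothety_invariant \<A> A D \<longleftrightarrow> (\<forall>c\<in>\<A>. \<forall>v\<in>A. fst v \<in> fst c \<longrightarrow>
    (\<forall>r>0. \<forall>\<xi> \<eta> \<zeta>. G c (tscale r v) (\<xi>, r *\<^sub>R \<eta>) \<zeta> = G c v (\<xi>, \<eta>) \<zeta>))" (is "_ \<longleftrightarrow> ?R")
proof
  let ?T = "\<lambda>z. tangent_space (vertical_atlas \<A> A) z"
  let ?H = "horizontal_distribution \<A> A D"
  let ?h = "\<lambda>r. tmap (vertical_atlas \<A> A) (vertical_atlas \<A> A) (homothety r)"
  have inv: "homothety_invariant \<A> A D \<longleftrightarrow> (\<forall>r>0. \<forall>z\<in>vertical_bundle \<A> A. ?h r ` ?H z = ?H (homothety r z))"
    unfolding homothety_invariant_def Let_def homothety_def ..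
  have bil: "bilinear (G c v)" if "c \<in> \<A>" for c v
    using G[OF that] unfolding linear_rep_def by blast
  {
    assume inv': "homothety_invariant \<A> A D"
    show ?R
    proof (intro ballI impI allI)
      fix c v r \<xi> \<eta> \<zeta> assume c: "c \<in> \<A>" and v: "v \<in> A" "fst v \<in> fst c" and r: "(r::real) > 0"
      obtain z where z: "z \<in> vertical_bundle \<A> A" "fst z = v" "snd (snd z (nc c)) = \<zeta>"
        using ex_vertical[OF v(1) c v(2)] .
      have p: "fst (fst z) \<in> fst c" using z v by simp
      note hz = homothety_vertical[OF z(1) r]
      define e where "e = tvec_of (vertical_atlas \<A> A) (vc c) z ((\<xi>, \<eta>), - G c v (\<xi>, \<eta>) \<zeta>)"
      have e: "e \<in> ?T z" "snd e (vc c) = ((\<xi>, \<eta>), - G c v (\<xi>, \<eta>) \<zeta>)"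
        unfolding e_def using vc_in_atlas[OF c] in_vc[OF z(1) p] by (auto intro: V.tvec_of_in_tangent_space)
      have "e \<in> ?H z" using horizontal_distribution_iff[OF D G[OF c] z(1) c p] e z by simp
      then have "?h r e \<in> ?H (homothety r z)" using inv' r z(1) unfolding inv by blast
      then have "r *\<^sub>R - G c v (\<xi>, \<eta>) \<zeta> = - G c (tscale r v) (\<xi>, r *\<^sub>R \<eta>) (r *\<^sub>R \<zeta>)"
        using horizontal_distribution_iff[OF D G[OF c] hz(2) c, of "?h r e"] p z tmap_homothety(2)[OF z(1) r e(1) c p] e(2)
        by (simp add: hz(1) hz(3)[OF c p])
      then show "G c (tscale r v) (\<xi>, r *\<^sub>R \<eta>) \<zeta> = G c v (\<xi>, \<eta>) \<zeta>"
        using r by (simp add: bilinear_simps[OF bil[OF c]])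
    qed
  }
  assume R: ?R
  show "homothety_invariant \<A> A D" unfolding inv
  proof (intro allI impI ballI)
    fix r :: real and z assume r: "r > 0" and z: "z \<in> vertical_bundle \<A> A"
    let ?v = "fst z"
    have v: "?v \<in> A" using z vertical_bundle_iff by blast
    obtain c where c: "c \<in> \<A>" "fst ?v \<in> fst c" using ex_chart[OF v] by blast
    note hz = homothety_vertical[OF z r]
    have p': "fst (fst (homothety r z)) \<in> fst c" using hz(1) c by simp
    have iff: "?h r e \<in> ?H (homothety r z) \<longleftrightarrow> e \<in> ?H z" if e: "e \<in> ?T z" for e
    proof -
      let ?\<xi> = "fst (fst (snd e (vc c)))" and ?\<eta> = "snd (fst (snd e (vc c)))" and ?\<zeta> = "snd (snd z (nc c))"
      have "G c (tscale r ?v) (?\<xi>, r *\<^sub>R ?\<eta>) ?\<zeta> = G c ?v (?\<xi>, ?\<eta>) ?\<zeta>" using R c v r by blast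
      then have *: "G c (tscale r ?v) (?\<xi>, r *\<^sub>R ?\<eta>) (r *\<^sub>R ?\<zeta>) = r *\<^sub>R G c ?v (fst (snd e (vc c))) ?\<zeta>"
        by (simp add: bilinear_simps[OF bil[OF c(1)]])
      have "?h r e \<in> ?H (homothety r z) \<longleftrightarrow> r *\<^sub>R snd (snd e (vc c)) = r *\<^sub>R - G c ?v (fst (snd e (vc c))) ?\<zeta>"
        using horizontal_distribution_iff[OF D G[OF c(1)] hz(2) c(1) p', of "?h r e"] tmap_homothety[OF z r e] c
        by (simp add: hz(1) hz(3)[OF c] *)
      also have "\<dots> \<longleftrightarrow> e \<in> ?H z"
        using horizontal_distribution_iff[OF D G[OF c(1)] z c, of e] e r
        by (simp del: scaleR_minus_right)
      finally show ?thesis .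
    qed
    have HT: "?H z \<subseteq> ?T z" using horizontal_distribution_iff[OF D G[OF c(1)] z c] by blast
    \<comment> \<open>\<open>iff\<close> alone gives one inclusion; for this one, each vector over
      the image point is written as an image by scaling its coordinates back with
      \<open>inverse r\<close>.\<close>
    have "?H (homothety r z) \<subseteq> ?h r ` ?H z"
    proof
      fix e' assume e': "e' \<in> ?H (homothety r z)"
      then have e'T: "e' \<in> ?T (homothety r z)"
        using horizontal_distribution_iff[OF D G[OF c(1)] hz(2) c(1) p'] by blast
      define e where "e = tvec_of (vertical_atlas \<A> A) (vc c) z
        ((fst (fst (snd e' (vc c))), inverse r *\<^sub>R snd (fst (snd e' (vc c)))), inverse r *\<^sub>R snd (snd e' (vc c)))"
      have e: "e \<in> ?T z"
        unfolding e_def using vc_in_atlas[OF c(1)] in_vc[OF z c(2)] by (auto intro: V.tvec_of_in_tangent_space)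
      have "?h r e = e'"
      proof (rule V.tangent_space_eqI[OF tmap_homothety(1)[OF z r e] e'T vc_in_atlas[OF c(1)] in_vc[OF hz(2) p']])
        show "snd (?h r e) (vc c) = snd e' (vc c)"
          unfolding tmap_homothety(2)[OF z r e c] using r
          by (simp add: prod_eq_iff e_def V.snd_tvec_of_same[OF vc_in_atlas[OF c(1)] in_vc[OF z c(2)]])
      qed
      then show "e' \<in> ?h r ` ?H z" using iff[OF e] e' by blast
    qed
    then show "?h r ` ?H z = ?H (homothety r z)" using iff HT by blast
  qed
qed

end

section \<open>The correspondence\<close>

lemma PiE2_eqI:
  assumes "D \<in> P \<rightarrow>\<^sub>E Q \<rightarrow>\<^sub>E R" "D' \<in> P \<rightarrow>\<^sub>E Q \<rightarrow>\<^sub>E R" "\<And>X Y. X \<in> P \<Longrightarrow> Y \<in> Q \<Longrightarrow> D X Y = D' X Y"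
  shows "D = D'"
proof (rule extensionalityI[of D P D'])
  show "D X = D' X" if "X \<in> P" for X
    by (rule extensionalityI[of _ Q]) (use assms that in \<open>auto simp: PiE_iff\<close>)
qed (use assms in \<open>auto simp: PiE_iff\<close>)

context conic_manifold
begin

lemma aniso_rep_formula:
  "aniso_rep c \<Gamma> D \<Longrightarrow> v \<in> A \<Longrightarrow> fst v \<in> fst c \<Longrightarrow> X \<in> VM.sections \<Longrightarrow> Y \<in> VM.sections \<Longrightarrow>
    snd (D X Y v) c = frechet_derivative (VM.crd c Y) (at (snd c (fst v))) (snd (X (fst v)) c)
      + \<Gamma> v (snd (X (fst v)) c) (snd (Y (fst v)) c)"
  unfolding aniso_rep_def by blast

lemma linear_rep_formula:
  "linear_rep c G D \<Longrightarrow> v \<in> A \<Longrightarrow> fst v \<in> fst c \<Longrightarrow> X \<in> VA.sections \<Longrightarrow> Z \<in> AF.sections \<Longrightarrow>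
    snd (D X Z v) c = frechet_derivative (AF.crd c Z) (at (snd (nc c) v)) (snd (X v) (nc c))
      + G v (snd (X v) (nc c)) (snd (Z v) c)"
  unfolding linear_rep_def by blast

lemma aniso_maps: "D \<in> aniso_connections \<A> A \<Longrightarrow> D \<in> VM.sections \<rightarrow>\<^sub>E VM.sections \<rightarrow>\<^sub>E AF.sections"
  unfolding aniso_connections_def Let_def sections_VM sections_AF by blast

lemma linear_maps: "D \<in> linear_connections \<A> A \<Longrightarrow> D \<in> VA.sections \<rightarrow>\<^sub>E AF.sections \<rightarrow>\<^sub>E AF.sections"
  unfolding linear_connections_def Let_def sections_VA sections_AF by blast

lemma aniso_eqI:
  assumes D: "D \<in> aniso_connections \<A> A" "D' \<in> aniso_connections \<A> A"
    and rep: "\<And>c. c \<in> \<A> \<Longrightarrow> \<exists>\<Gamma>. aniso_rep c \<Gamma> D \<and> aniso_rep c \<Gamma> D'"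
  shows "D = D'"
proof (rule PiE2_eqI[OF aniso_maps[OF D(1)] aniso_maps[OF D(2)]])
  fix X Y assume X: "X \<in> VM.sections" and Y: "Y \<in> VM.sections"
  show "D X Y = D' X Y"
  proof (rule AF_eqI)
    show "D X Y \<in> AF.sections" "D' X Y \<in> AF.sections"
      using aniso_maps[OF D(1)] aniso_maps[OF D(2)] X Y by (auto simp: PiE_iff)
    fix v c assume v: "v \<in> A" and c: "c \<in> \<A>" "fst v \<in> fst c"
    from rep[OF c(1)] obtain \<Gamma> where "aniso_rep c \<Gamma> D" "aniso_rep c \<Gamma> D'" by blast
    then show "snd (D X Y v) c = snd (D' X Y v) c"
      using aniso_rep_formula[OF _ v c(2) X Y] by metis
  qed
qed

lemma linear_eqI:
  assumes D: "D \<in> linear_connections \<A> A" "D' \<in> linear_connections \<A> A"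
    and rep: "\<And>c. c \<in> \<A> \<Longrightarrow> \<exists>G. linear_rep c G D \<and> linear_rep c G D'"
  shows "D = D'"
proof (rule PiE2_eqI[OF linear_maps[OF D(1)] linear_maps[OF D(2)]])
  fix X Z assume X: "X \<in> VA.sections" and Z: "Z \<in> AF.sections"
  show "D X Z = D' X Z"
  proof (rule AF_eqI)
    show "D X Z \<in> AF.sections" "D' X Z \<in> AF.sections"
      using linear_maps[OF D(1)] linear_maps[OF D(2)] X Z by (auto simp: PiE_iff)
    fix v c assume v: "v \<in> A" and c: "c \<in> \<A>" "fst v \<in> fst c"
    from rep[OF c(1)] obtain G where "linear_rep c G D" "linear_rep c G D'" by blast
    then show "snd (D X Z v) c = snd (D' X Z v) c"
      using linear_rep_formula[OF _ v c(2) X Z] by metis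
  qed
qed

text \<open>Expresses \<open>same_christoffel\<close> without a nonlinear connection: horizontal
  directions are represented by vectors (\<xi>, 0) of the chart, which is harmless for vertically
  flat connections.\<close>

definition corresponds :: "('m, 'e) linear_conn \<Rightarrow> ('m, 'e) aniso_conn \<Rightarrow> bool" where
  "corresponds Ds D \<longleftrightarrow> (\<forall>c\<in>\<A>. \<forall>G. linear_rep c G Ds \<longrightarrow> aniso_rep c (\<lambda>v \<xi> \<zeta>. G v (\<xi>, 0) \<zeta>) D)"

text \<open>The formula in \<open>aniso_rep\<close> tests the form only over \<open>A\<close> within
  the chart; bilinearity elsewhere is supplied by \<open>G\<close>.\<close>

lemma aniso_rep_transfer:
  assumes "linear_rep c G Ds" "aniso_rep c \<Gamma> D"
    and "\<And>v \<xi> \<zeta>. v \<in> A \<Longrightarrow> fst v \<in> fst c \<Longrightarrow> \<Gamma> v \<xi> \<zeta> = G v (\<xi>, 0) \<zeta>"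
  shows "aniso_rep c (\<lambda>v \<xi> \<zeta>. G v (\<xi>, 0) \<zeta>) D"
proof -
  have "bilinear (\<lambda>\<xi> \<zeta>. G v (\<xi>, 0) \<zeta>)" for v
    using assms(1) bilinear_horizontal unfolding linear_rep_def by blast
  moreover have "smooth_on (AF.cdom c) (\<lambda>u. G (chart_inv (nc c) u) (\<xi>, 0) \<zeta>)" for \<xi> \<zeta>
    using assms(1) unfolding linear_rep_def by blast
  ultimately show ?thesis
    using aniso_rep_formula[OF assms(2)] assms(3) unfolding aniso_rep_def by simp
qed

lemma corresponds_unique_aniso:
  assumes "Ds \<in> linear_connections \<A> A" "D \<in> aniso_connections \<A> A" "D' \<in> aniso_connections \<A> A"
    and "corresponds Ds D" "corresponds Ds D'"
  shows "D = D'"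
  using assms ex_linear_rep[OF assms(1)] unfolding corresponds_def
  by (intro aniso_eqI) blast+

text \<open>\<open>D\<close> fixes the form on directions (\<xi>, 0), and flatness makes it vanish
  on directions (0, \<eta>).\<close>

lemma corresponds_unique_linear:
  assumes Ds: "Ds \<in> linear_connections \<A> A" "Ds' \<in> linear_connections \<A> A"
    and flat: "vertically_flat Ds" "vertically_flat Ds'"
    and D: "corresponds Ds D" "corresponds Ds' D"
  shows "Ds = Ds'"
proof (rule linear_eqI[OF Ds])
  fix c assume c: "c \<in> \<A>"
  obtain G G' where G: "linear_rep c G Ds" "linear_rep c G' Ds'"
    using ex_linear_rep[OF Ds(1) c] ex_linear_rep[OF Ds(2) c] by blast
  have eq: "G v w \<zeta> = G' v w \<zeta>" if v: "v \<in> A" "fst v \<in> fst c" for v w \<zeta>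
  proof -
    have "aniso_rep c (\<lambda>v \<xi> \<zeta>. G v (\<xi>, 0) \<zeta>) D" "aniso_rep c (\<lambda>v \<xi> \<zeta>. G' v (\<xi>, 0) \<zeta>) D"
      using D G c unfolding corresponds_def by blast+
    from aniso_rep_unique[OF c this v, of "fst w" \<zeta>]
    show ?thesis
      using vertically_flatD[OF flat(1) c G(1) v, of w \<zeta>] vertically_flatD[OF flat(2) c G(2) v, of w \<zeta>] by simp
  qed
  have "linear_rep c G Ds'"
    using linear_rep_formula[OF G(2)] G(1) eq unfolding linear_rep_def by simp
  with G(1) show "\<exists>G. linear_rep c G Ds \<and> linear_rep c G Ds'" by blast
qed

lemma ex_corresponding_linear:
  assumes D: "D \<in> aniso_connections \<A> A"
  obtains Ds where "Ds \<in> linear_connections \<A> A" "vertically_flat Ds" "corresponds Ds D"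
proof -
  obtain Ds where Ds: "Ds \<in> linear_connections \<A> A"
    "\<And>c \<Gamma>. c \<in> \<A> \<Longrightarrow> aniso_rep c \<Gamma> D \<Longrightarrow> linear_rep c (\<lambda>v w \<zeta>. \<Gamma> v (fst w) \<zeta>) Ds"
    by (rule aniso_to_linear[OF D]) (rule that)
  \<comment> \<open>\<open>vertically_flat\<close> and \<open>corresponds\<close> speak of every
    representing form; uniqueness reduces them to the one built from
    \<open>\<Gamma>\<close>.\<close>
  have eq: "\<exists>\<Gamma>. aniso_rep c \<Gamma> D \<and> (\<forall>v\<in>A. fst v \<in> fst c \<longrightarrow> (\<forall>w \<zeta>. G v w \<zeta> = \<Gamma> v (fst w) \<zeta>))"
    if c: "c \<in> \<A>" and G: "linear_rep c G Ds" for c G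
  proof -
    obtain \<Gamma> where \<Gamma>: "aniso_rep c \<Gamma> D" using ex_aniso_rep[OF D c] by blast
    then show ?thesis using linear_rep_unique[OF c G Ds(2)[OF c \<Gamma>]] by blast
  qed
  have "vertically_flat Ds"
    unfolding vertically_flat_def
  proof (intro ballI allI impI)
    fix c G v \<eta> \<zeta> assume c: "c \<in> \<A>" and G: "linear_rep c G Ds" and v: "v \<in> A" "fst v \<in> fst c"
    obtain \<Gamma> where \<Gamma>: "aniso_rep c \<Gamma> D" "\<forall>v\<in>A. fst v \<in> fst c \<longrightarrow> (\<forall>w \<zeta>. G v w \<zeta> = \<Gamma> v (fst w) \<zeta>)"
      using eq[OF c G] by blast
    then have "bilinear (\<Gamma> v)" unfolding aniso_rep_def by blast
    then show "G v (0, \<eta>) \<zeta> = 0" using \<Gamma>(2) v by (simp add: bilinear_lzero)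
  qed
  moreover have "corresponds Ds D"
    unfolding corresponds_def
  proof (intro ballI allI impI)
    fix c G assume c: "c \<in> \<A>" and G: "linear_rep c G Ds"
    obtain \<Gamma> where \<Gamma>: "aniso_rep c \<Gamma> D" "\<forall>v\<in>A. fst v \<in> fst c \<longrightarrow> (\<forall>w \<zeta>. G v w \<zeta> = \<Gamma> v (fst w) \<zeta>)"
      using eq[OF c G] by blast
    show "aniso_rep c (\<lambda>v \<xi> \<zeta>. G v (\<xi>, 0) \<zeta>) D"
      by (rule aniso_rep_transfer[OF G \<Gamma>(1)]) (use \<Gamma>(2) in simp)
  qed
  ultimately show thesis using that Ds(1) by blast
qed

text \<open>The derivative term depends on the base point only, which \<open>v\<close> and its
  multiples share, so homogeneity is a condition on \<open>\<Gamma>\<close> alone.\<close>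

lemma homogeneous_aniso_iff:
  assumes D: "D \<in> aniso_connections \<A> A" and \<Gamma>: "\<And>c. c \<in> \<A> \<Longrightarrow> aniso_rep c (\<Gamma> c) D"
  shows "homogeneous_aniso \<A> A D \<longleftrightarrow> (\<forall>c\<in>\<A>. \<forall>v\<in>A. fst v \<in> fst c \<longrightarrow>
    (\<forall>r>0. \<forall>\<xi> \<zeta>. \<Gamma> c (tscale r v) \<xi> \<zeta> = \<Gamma> c v \<xi> \<zeta>))" (is "_ \<longleftrightarrow> ?R")
proof
  assume h: "homogeneous_aniso \<A> A D"
  show ?R
  proof (intro ballI allI impI)
    fix c v r \<xi> \<zeta> assume c: "c \<in> \<A>" and v: "v \<in> A" "fst v \<in> fst c" and r: "(r::real) > 0"
    obtain X Y where XY: "X \<in> VM.sections" "Y \<in> VM.sections" "snd (X (fst v)) c = \<xi>" "snd (Y (fst v)) c = \<zeta>"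
      using ex_fields_through_point[OF c v] by metis
    have "D X Y (tscale r v) = D X Y v"
      using h XY v r unfolding homogeneous_aniso_def sections_VM by blast
    then show "\<Gamma> c (tscale r v) \<xi> \<zeta> = \<Gamma> c v \<xi> \<zeta>"
      using aniso_rep_formula[OF \<Gamma>[OF c] v XY(1,2)] aniso_rep_formula[OF \<Gamma>[OF c] tscale_in_A[OF r v(1)] _ XY(1,2)] v XY
      by simp
  qed
next
  assume R: ?R
  show "homogeneous_aniso \<A> A D"
    unfolding homogeneous_aniso_def sections_VM[symmetric]
  proof (intro ballI allI impI)
    fix X Y v and r :: real assume X: "X \<in> VM.sections" and Y: "Y \<in> VM.sections" and v: "v \<in> A" and r: "r > 0"
    obtain c where c: "c \<in> \<A>" "fst v \<in> fst c" using ex_chart[OF v] by blast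
    have DX: "D X Y \<in> AF.sections" using aniso_maps[OF D] X Y by (auto simp: PiE_iff)
    show "D X Y (tscale r v) = D X Y v"
    proof (rule M.tangent_space_eqI[OF _ AF.section_fibre[OF DX v] c])
      show "D X Y (tscale r v) \<in> tangent_space \<A> (fst v)"
        using AF.section_fibre[OF DX tscale_in_A[OF r v]] by simp
      show "snd (D X Y (tscale r v)) c = snd (D X Y v) c"
        using aniso_rep_formula[OF \<Gamma>[OF c(1)] v c(2) X Y] aniso_rep_formula[OF \<Gamma>[OF c(1)] tscale_in_A[OF r v] _ X Y] c v R r
        by simp
    qed
  qed
qed

text \<open>Flatness removes the vertical argument, and with it the factor \<open>r\<close>, from
  the criterion for \<open>Ds\<close>; what is left is the criterion for \<open>D\<close>.\<close>

lemma homothety_invariant_iff_homogeneous: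
  assumes Ds: "Ds \<in> linear_connections \<A> A" "vertically_flat Ds"
    and D: "D \<in> aniso_connections \<A> A" "corresponds Ds D"
  shows "homothety_invariant \<A> A Ds \<longleftrightarrow> homogeneous_aniso \<A> A D"
proof -
  obtain G where G: "\<And>c. c \<in> \<A> \<Longrightarrow> linear_rep c (G c) Ds" using ex_linear_rep[OF Ds(1)] by metis
  then have \<Gamma>: "\<And>c. c \<in> \<A> \<Longrightarrow> aniso_rep c (\<lambda>v \<xi> \<zeta>. G c v (\<xi>, 0) \<zeta>) D"
    using D(2) unfolding corresponds_def by blast
  have "G c v (\<xi>, \<eta>) \<zeta> = G c v (\<xi>, 0) \<zeta>" if "c \<in> \<A>" "v \<in> A" "fst v \<in> fst c" for c v \<xi> \<eta> \<zeta>
    using vertically_flatD[OF Ds(2) that(1) G[OF that(1)] that(2,3), of "(\<xi>, \<eta>)" \<zeta>] by simp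
  then have "G c (tscale r v) (\<xi>, r *\<^sub>R \<eta>) \<zeta> = G c v (\<xi>, \<eta>) \<zeta> \<longleftrightarrow> G c (tscale r v) (\<xi>, 0) \<zeta> = G c v (\<xi>, 0) \<zeta>"
    if "c \<in> \<A>" "v \<in> A" "fst v \<in> fst c" "r > 0" for c v r \<xi> \<eta> \<zeta>
    using that tscale_in_A[OF that(4,2)] by (metis fst_tscale)
  then show ?thesis
    using homothety_invariant_iff[OF Ds(1), of G] homogeneous_aniso_iff[OF D(1), of "\<lambda>c v \<xi>. G c v (\<xi>, 0)"] G \<Gamma>
    by simp
qed

end

subsection \<open>Christoffel symbols\<close>

locale conic_coordinates = conic_manifold \<A> A
  for \<A> :: "('m, real^'n) chart set" and A :: "('m, real^'n) tvec set"
begin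

text \<open>A cutoff times the coordinate field shows that the choice is not empty. Constant
  coordinates near \<open>p\<close> kill the derivative term, so the Christoffel symbols are values
  of the bilinear form on basis vectors.\<close>

lemma extended_coord_field:
  fixes i :: 'n
  assumes c: "c \<in> \<A>" "p \<in> fst c"
  defines "X \<equiv> extended_coord_field \<A> c i p"
  shows "X \<in> VM.sections" "snd (X p) c = axis i 1"
    and "frechet_derivative (VM.crd c X) (at (snd c p)) = (\<lambda>_. 0)"
proof -
  let ?P = "\<lambda>X. X \<in> vector_fields \<A> (points \<A>) \<and>
     (\<exists>W. openin (atlas_topology \<A>) W \<and> p \<in> W \<and> W \<subseteq> fst c \<and> (\<forall>q\<in>W. X q = coord_vec \<A> c i q))"
  have "\<exists>X. ?P X"
  proof -
    obtain b N where b: "VM.cutoff c b" "VM.one_near c b N" "snd c p \<in> N"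
      using ex_cutoff_manifold[OF c] .
    let ?E = "VM.extend c b (\<lambda>_. axis i 1)" and ?W = "{q \<in> fst c. snd c q \<in> N}"
    have E: "?E \<in> VM.sections" by (intro VM.extend_in_sections b smooth_on_const)
    have "?E q = coord_vec \<A> c i q" if q: "q \<in> ?W" for q
    proof -
      have p: "q \<in> points \<A>" "q \<in> fst c" using q c(1) unfolding points_def by blast+
      have "b q = 1" using b(2) q p unfolding VM.one_near_def by blast
      then show ?thesis
        unfolding coord_vec_def
        using VM.extend_inside[OF c(1) p, of b "\<lambda>_. axis i 1"] c(1) p
        by (intro M.tangent_space_eqI[OF _ M.tvec_of_in_tangent_space c(1) p(2)]) auto
    qed
    moreover have "openin (atlas_topology \<A>) ?W"
      using b(2) M.openin_chart_preimage[OF c(1)] unfolding VM.one_near_def by blast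
    ultimately have "?P ?E" using E b(3) c(2) unfolding sections_VM by (intro conjI exI[of _ ?W]) auto
    then show ?thesis by blast
  qed
  from someI_ex[OF this] have X: "?P X" unfolding X_def extended_coord_field_def .
  then obtain W where W: "openin (atlas_topology \<A>) W" "p \<in> W" "W \<subseteq> fst c" "\<And>q. q \<in> W \<Longrightarrow> X q = coord_vec \<A> c i q"
    by blast
  show "X \<in> VM.sections" using X unfolding sections_VM by blast
  have Xq: "snd (X q) c = axis i 1" if "q \<in> W" for q
    using W(3,4) that c(1) unfolding coord_vec_def by auto
  then show "snd (X p) c = axis i 1" using W(2) by blast
  have o: "open (snd c ` (W \<inter> fst c))" using W(1) c(1) unfolding M.openin_iff by blast
  have "(VM.crd c X has_derivative (\<lambda>_. 0)) (at (snd c p))"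
    by (rule has_derivative_transform_within_open[OF has_derivative_const[of "axis i 1"] o])
      (use W(2) c Xq VM.crd_chart in auto)
  then show "frechet_derivative (VM.crd c X) (at (snd c p)) = (\<lambda>_. 0)"
    by (rule frechet_derivative_at[symmetric])
qed

lemma extended_coord_section:
  fixes j :: 'n
  assumes c: "c \<in> \<A>" and v: "v \<in> A" "fst v \<in> fst c"
  defines "Z \<equiv> extended_coord_section \<A> A c j v"
  shows "Z \<in> AF.sections" "snd (Z v) c = axis j 1"
    and "frechet_derivative (AF.crd c Z) (at (snd (nc c) v)) = (\<lambda>_. 0)"
proof -
  let ?P = "\<lambda>Z. Z \<in> aniso_fields \<A> A \<and>
     (\<exists>W. openin (atlas_topology (tangent_atlas \<A>)) W \<and> v \<in> W \<and> W \<subseteq> A \<inter> fst (nc c) \<and>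
       (\<forall>u\<in>W. Z u = coord_vec \<A> c j (fst u)))"
  have N: "nc c \<in> tangent_atlas \<A>" by (rule M.natural_chart_in_tangent_atlas[OF c])
  have "\<exists>Z. ?P Z"
  proof -
    obtain b N where b: "AF.cutoff c b" "AF.one_near c b N" "snd (nc c) v \<in> N"
      using ex_cutoff_A[OF c v] .
    \<comment> \<open>A natural chart also covers vectors outside \<open>A\<close>, so the
      neighbourhood is cut down to \<open>A\<close>.\<close>
    let ?E = "AF.extend c b (\<lambda>_. axis j 1)" and ?W = "{u \<in> fst (nc c). snd (nc c) u \<in> N} \<inter> A"
    have E: "?E \<in> AF.sections" by (intro AF.extend_in_sections b smooth_on_const)
    have "?E u = coord_vec \<A> c j (fst u)" if u: "u \<in> ?W" for u
    proof -
      have p: "u \<in> A" "u \<in> fst (nc c)" "fst u \<in> fst c" using u in_nc by blast+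
      have "b u = 1" using b(2) u p unfolding AF.one_near_def by blast
      then show ?thesis
        unfolding coord_vec_def
        using AF.extend_inside[OF c p(1,2), of b "\<lambda>_. axis j 1"] c p
        by (intro M.tangent_space_eqI[OF _ M.tvec_of_in_tangent_space c p(3)]) auto
    qed
    moreover have "openin (atlas_topology (tangent_atlas \<A>)) ?W"
      using b(2) T.openin_chart_preimage[OF N] conic unfolding AF.one_near_def conic_domain_def
      by (blast intro: openin_Int)
    ultimately have "?P ?E"
      using E b(3) v in_nc[OF v(1), of c] unfolding sections_AF by (intro conjI exI[of _ ?W]) auto
    then show ?thesis by blast
  qed
  from someI_ex[OF this] have Z: "?P Z" unfolding Z_def extended_coord_section_def .
  then obtain W where W: "openin (atlas_topology (tangent_atlas \<A>)) W" "v \<in> W" "W \<subseteq> A \<inter> fst (nc c)"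
    "\<And>u. u \<in> W \<Longrightarrow> Z u = coord_vec \<A> c j (fst u)"
    by blast
  show "Z \<in> AF.sections" using Z unfolding sections_AF by blast
  have Zu: "snd (Z u) c = axis j 1" if u: "u \<in> W" for u
  proof -
    have "fst u \<in> fst c" using W(3) u in_nc by blast
    then show ?thesis using W(4)[OF u] c unfolding coord_vec_def by simp
  qed
  then show "snd (Z v) c = axis j 1" using W(2) by blast
  have o: "open (snd (nc c) ` (W \<inter> fst (nc c)))" using W(1) N unfolding T.openin_iff by blast
  have i: "snd (nc c) v \<in> snd (nc c) ` (W \<inter> fst (nc c))" using W(2,3) by blast
  have "(AF.crd c Z has_derivative (\<lambda>_. 0)) (at (snd (nc c) v))"
    by (rule has_derivative_transform_within_open[OF has_derivative_const[of "axis j 1"] o i])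
      (erule imageE, use c Zu AF.crd_chart[OF c] in simp)
  then show "frechet_derivative (AF.crd c Z) (at (snd (nc c) v)) = (\<lambda>_. 0)"
    by (rule frechet_derivative_at[symmetric])
qed

lemma aniso_christoffel_eq:
  assumes "c \<in> \<A>" "aniso_rep c \<Gamma> D" "v \<in> A" "fst v \<in> fst c"
  shows "aniso_christoffel \<A> D c a i j v = \<Gamma> v (axis i 1) (axis j 1) $ a"
  unfolding aniso_christoffel_def
    aniso_rep_formula[OF assms(2-4) extended_coord_field(1)[OF assms(1,4)] extended_coord_field(1)[OF assms(1,4)]]
  by (simp add: extended_coord_field[OF assms(1,4)])

text \<open>Serves horizontal and vertical symbols alike, since \<open>delta_vec\<close> and
  \<open>vertical_coord_vec\<close> are both given by coordinates in the natural chart.\<close>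

lemma deriv_along_coord_section:
  assumes "D \<in> linear_connections \<A> A" "c \<in> \<A>" "linear_rep c G D" "v \<in> A" "fst v \<in> fst c"
  shows "snd (deriv_along \<A> A D (tvec_of (tangent_atlas \<A>) (nc c) v w) (extended_coord_section \<A> A c j v)) c
    = G v w (axis j 1)"
proof -
  have v: "v \<in> fst (nc c)" using assms in_nc by simp
  note N = M.natural_chart_in_tangent_atlas[OF assms(2)]
  show ?thesis
    using deriv_along_rep(2)[OF assms(1,3,2,4,5) T.tvec_of_in_tangent_space[OF N v, of w]
        extended_coord_section(1)[OF assms(2,4,5), of j]]
      extended_coord_section(2,3)[OF assms(2,4,5), of j] N v
    by (simp del: M.snd_natural_chart)
qed

lemma bilinear_eq_0:
  fixes B :: "real^'n \<Rightarrow> real^'n \<Rightarrow> real^'n"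
  assumes "bilinear B" "\<And>i j. B (axis i 1) (axis j 1) = 0"
  shows "B x y = 0"
proof -
  have "B i j = 0" if "i \<in> Basis" "j \<in> Basis" for i j
    using that assms(2) by (auto simp: Basis_vec_def)
  then show ?thesis by (subst bilinear_basis_sum[OF assms(1)]) simp
qed

text \<open>The vertical symbols are the components of \<open>G\<close> on basis vectors, and a
  bilinear form is determined by these.\<close>

lemma vertically_trivial_iff:
  assumes D: "D \<in> linear_connections \<A> A"
  shows "vertically_trivial \<A> A D \<longleftrightarrow> vertically_flat D"
proof -
  have eq: "vertical_christoffel \<A> A D c a i j v = G v (0, axis i 1) (axis j 1) $ a"
    if "c \<in> \<A>" "linear_rep c G D" "v \<in> A" "fst v \<in> fst c" for c G v a i j
    unfolding vertical_christoffel_def vertical_coord_vec_def deriv_along_coord_section[OF D that] ..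
  have "vertically_flat D" if t: "vertically_trivial \<A> A D"
    unfolding vertically_flat_def
  proof (intro ballI allI impI)
    fix c G v \<eta> \<zeta> assume c: "c \<in> \<A>" and G: "linear_rep c G D" and v: "v \<in> A" "fst v \<in> fst c"
    have b: "bilinear (G v)" using G unfolding linear_rep_def by blast
    have "bilinear (\<lambda>\<eta> \<zeta>. G v (0, \<eta>) \<zeta>)"
    proof -
      have "G v (0, x + y) \<zeta> = G v (0, x) \<zeta> + G v (0, y) \<zeta>" "G v (0, r *\<^sub>R x) \<zeta> = r *\<^sub>R G v (0, x) \<zeta>"
        for x y \<zeta> r
        using bilinear_simps(1)[OF b, of "(0, x)" "(0, y)" \<zeta>] bilinear_simps(3)[OF b, of r "(0, x)" \<zeta>] by simp_all
      then show ?thesis unfolding bilinear_def by (auto intro!: linearI simp: bilinear_simps[OF b])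
    qed
    moreover have "G v (0, axis i 1) (axis j 1) = 0" for i j
      using t eq[OF c G v] c v unfolding vertically_trivial_def by (simp add: vec_eq_iff)
    ultimately show "G v (0, \<eta>) \<zeta> = 0" by (rule bilinear_eq_0)
  qed
  moreover have "vertically_trivial \<A> A D" if f: "vertically_flat D"
    unfolding vertically_trivial_def
  proof (intro ballI allI impI)
    fix c v a i j assume c: "c \<in> \<A>" and v: "v \<in> A" "fst v \<in> fst c"
    obtain G where G: "linear_rep c G D" using ex_linear_rep[OF D c] by blast
    then have "G v (0, axis i 1) (axis j 1) = 0" using f c v unfolding vertically_flat_def by blast
    then show "vertical_christoffel \<A> A D c a i j v = 0" unfolding eq[OF c G v] by simp
  qed
  ultimately show ?thesis by blast
qed

text \<open>By vertical triviality, the horizontal symbols do not involve the components of \<open>\<nu>\<close>.\<close>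
lemma same_christoffel_iff:
  assumes Ds: "Ds \<in> linear_connections \<A> A" "vertically_flat Ds" and D: "D \<in> aniso_connections \<A> A"
  shows "same_christoffel \<A> A \<nu> Ds D \<longleftrightarrow> corresponds Ds D"
proof -
  have H: "horizontal_christoffel \<A> A \<nu> Ds c a i j v = G v (axis i 1, 0) (axis j 1) $ a"
    if "c \<in> \<A>" "linear_rep c G Ds" "v \<in> A" "fst v \<in> fst c" for c G v a i j
    unfolding horizontal_christoffel_def delta_vec_def deriv_along_coord_section[OF Ds(1) that]
    using vertically_flatD[OF Ds(2) that, of "(axis i 1, - nonlin_components \<A> \<nu> c v i)"] by simp
  have "corresponds Ds D" if s: "same_christoffel \<A> A \<nu> Ds D"
    unfolding corresponds_def
  proof (intro ballI allI impI)
    fix c G assume c: "c \<in> \<A>" and G: "linear_rep c G Ds"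
    obtain \<Gamma> where \<Gamma>: "aniso_rep c \<Gamma> D" using ex_aniso_rep[OF D c] by blast
    show "aniso_rep c (\<lambda>v \<xi> \<zeta>. G v (\<xi>, 0) \<zeta>) D"
    proof (rule aniso_rep_transfer[OF G \<Gamma>])
      fix v \<xi> \<zeta> assume v: "v \<in> A" "fst v \<in> fst c"
      have "bilinear (\<Gamma> v)" "bilinear (G v)" using \<Gamma> G unfolding aniso_rep_def linear_rep_def by blast+
      note b = bilinear_simps[OF this(1)] bilinear_simps[OF bilinear_horizontal[OF this(2)]]
      have "bilinear (\<lambda>\<xi> \<zeta>. \<Gamma> v \<xi> \<zeta> - G v (\<xi>, 0) \<zeta>)"
        unfolding bilinear_def by (intro conjI allI linearI) (simp_all only: b algebra_simps)
      moreover have "\<Gamma> v (axis i 1) (axis j 1) - G v (axis i 1, 0) (axis j 1) = 0" for i j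
        using s c v aniso_christoffel_eq[OF c \<Gamma> v] H[OF c G v] unfolding same_christoffel_def
        by (simp add: vec_eq_iff)
      ultimately have "\<Gamma> v \<xi> \<zeta> - G v (\<xi>, 0) \<zeta> = 0" by (rule bilinear_eq_0)
      then show "\<Gamma> v \<xi> \<zeta> = G v (\<xi>, 0) \<zeta>" by simp
    qed
  qed
  moreover have "same_christoffel \<A> A \<nu> Ds D" if "corresponds Ds D"
    unfolding same_christoffel_def
  proof (intro ballI allI impI)
    fix c v a i j assume c: "c \<in> \<A>" and v: "v \<in> A" "fst v \<in> fst c"
    obtain G where G: "linear_rep c G Ds" using ex_linear_rep[OF Ds(1) c] by blast
    then have "aniso_rep c (\<lambda>v \<xi> \<zeta>. G v (\<xi>, 0) \<zeta>) D" using that c unfolding corresponds_def by blast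
    then show "aniso_christoffel \<A> D c a i j v = horizontal_christoffel \<A> A \<nu> Ds c a i j v"
      using aniso_christoffel_eq[OF c _ v] H[OF c G v] by simp
  qed
  ultimately show ?thesis by blast
qed

lemma vertically_trivial_connections_iff:
  "Ds \<in> vertically_trivial_connections \<A> A \<longleftrightarrow> Ds \<in> linear_connections \<A> A \<and> vertically_flat Ds"
  unfolding vertically_trivial_connections_def using vertically_trivial_iff by blast

lemma ex1_corresponding_aniso:
  assumes "Ds \<in> vertically_trivial_connections \<A> A"
  shows "\<exists>!D. D \<in> aniso_connections \<A> A \<and> corresponds Ds D"
proof -
  have Ds: "Ds \<in> linear_connections \<A> A" "vertically_flat Ds"
    using assms vertically_trivial_connections_iff by auto
  obtain D where "D \<in> aniso_connections \<A> A" "corresponds Ds D"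
    using linear_to_aniso[OF Ds] unfolding corresponds_def by metis
  then show ?thesis using corresponds_unique_aniso[OF Ds(1)] by blast
qed

lemma aniso_of_linear:
  assumes "Ds \<in> vertically_trivial_connections \<A> A"
  shows "\<exists>!D. D \<in> aniso_connections \<A> A \<and> same_christoffel \<A> A \<nu> Ds D"
    and "aniso_of_linear \<A> A \<nu> Ds \<in> aniso_connections \<A> A" "corresponds Ds (aniso_of_linear \<A> A \<nu> Ds)"
proof -
  have Ds: "Ds \<in> linear_connections \<A> A" "vertically_flat Ds"
    using assms vertically_trivial_connections_iff by auto
  have eq: "D \<in> aniso_connections \<A> A \<and> same_christoffel \<A> A \<nu> Ds D \<longleftrightarrow>
      D \<in> aniso_connections \<A> A \<and> corresponds Ds D" for D
    using same_christoffel_iff[OF Ds] by blast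
  note ex = ex1_corresponding_aniso[OF assms]
  show "\<exists>!D. D \<in> aniso_connections \<A> A \<and> same_christoffel \<A> A \<nu> Ds D"
    unfolding eq by (rule ex)
  show "aniso_of_linear \<A> A \<nu> Ds \<in> aniso_connections \<A> A" "corresponds Ds (aniso_of_linear \<A> A \<nu> Ds)"
    using theI'[OF ex] unfolding aniso_of_linear_def eq by blast+
qed

text \<open>Injectivity is uniqueness, and surjectivity existence, of the vertically flat partner of
  a given anisotropic connection.\<close>

lemma bij_aniso_of_linear:
  "bij_betw (aniso_of_linear \<A> A \<nu>) (vertically_trivial_connections \<A> A) (aniso_connections \<A> A)"
proof (rule bij_betwI')
  fix Ds Ds' assume D: "Ds \<in> vertically_trivial_connections \<A> A" "Ds' \<in> vertically_trivial_connections \<A> A"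
  show "aniso_of_linear \<A> A \<nu> Ds = aniso_of_linear \<A> A \<nu> Ds' \<longleftrightarrow> Ds = Ds'"
    using corresponds_unique_linear[of Ds Ds'] D[unfolded vertically_trivial_connections_iff]
      aniso_of_linear(3)[OF D(1)] aniso_of_linear(3)[OF D(2)] by metis
next
  show "aniso_of_linear \<A> A \<nu> Ds \<in> aniso_connections \<A> A" if "Ds \<in> vertically_trivial_connections \<A> A" for Ds
    by (rule aniso_of_linear(2)[OF that])
next
  fix D assume D: "D \<in> aniso_connections \<A> A"
  obtain Ds where "Ds \<in> linear_connections \<A> A" "vertically_flat Ds" and c: "corresponds Ds D"
    using ex_corresponding_linear[OF D] .
  then have Ds: "Ds \<in> vertically_trivial_connections \<A> A" using vertically_trivial_connections_iff by blast
  have "D = aniso_of_linear \<A> A \<nu> Ds"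
    using ex1_corresponding_aniso[OF Ds] D c aniso_of_linear(2,3)[OF Ds] by blast
  with Ds show "\<exists>Ds\<in>vertically_trivial_connections \<A> A. D = aniso_of_linear \<A> A \<nu> Ds" by blast
qed

lemma homothety_invariant_iff_aniso_of_linear:
  assumes "Ds \<in> vertically_trivial_connections \<A> A"
  shows "homothety_invariant \<A> A Ds \<longleftrightarrow> homogeneous_aniso \<A> A (aniso_of_linear \<A> A \<nu> Ds)"
  using homothety_invariant_iff_homogeneous aniso_of_linear(2,3)[OF assms] assms
    vertically_trivial_connections_iff by blast

end

theorem theorem3:
  fixes \<A> :: "('m, real^'n) chart set"
    and A :: "('m, real^'n) tvec set"
    and \<nu> :: "('m, real^'n) nonlin_conn"
  assumes "smooth_manifold \<A>"
    and "conic_domain \<A> A"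
    and "nonlinear_connection \<A> A \<nu>"
    and "homogeneous_nonlinear \<A> A \<nu>"
  shows "(\<forall>Ds\<in>vertically_trivial_connections \<A> A.
            \<exists>!D. D \<in> aniso_connections \<A> A \<and> same_christoffel \<A> A \<nu> Ds D)
    \<and> bij_betw (aniso_of_linear \<A> A \<nu>)
        (vertically_trivial_connections \<A> A) (aniso_connections \<A> A)
    \<and> bij_betw (aniso_of_linear \<A> A \<nu>)
        {Ds \<in> vertically_trivial_connections \<A> A. homothety_invariant \<A> A Ds}
        {D \<in> aniso_connections \<A> A. homogeneous_aniso \<A> A D}
    \<and> (\<forall>\<nu>'. nonlinear_connection \<A> A \<nu>' \<and> homogeneous_nonlinear \<A> A \<nu>' \<longrightarrow>
         (\<forall>Ds\<in>vertically_trivial_connections \<A> A.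
            aniso_of_linear \<A> A \<nu>' Ds = aniso_of_linear \<A> A \<nu> Ds))
    \<and> (\<forall>Ds\<in>vertically_trivial_connections \<A> A.
         homothety_invariant \<A> A Ds \<longleftrightarrow> homogeneous_aniso \<A> A (aniso_of_linear \<A> A \<nu> Ds))"
proof -
  interpret conic_coordinates \<A> A
    using assms(1,2) by unfold_locales
  have bij: "bij_betw (aniso_of_linear \<A> A \<nu>) (vertically_trivial_connections \<A> A) (aniso_connections \<A> A)"
    by (rule bij_aniso_of_linear)
  have hom: "homothety_invariant \<A> A Ds \<longleftrightarrow> homogeneous_aniso \<A> A (aniso_of_linear \<A> A \<nu> Ds)"
    if "Ds \<in> vertically_trivial_connections \<A> A" for Ds
    by (rule homothety_invariant_iff_aniso_of_linear[OF that])
  \<comment> \<open>Injectivity is inherited from \<open>bij\<close>; by \<open>hom\<close> the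
    homogeneous connections are exactly the images of the invariant ones.\<close>
  have "bij_betw (aniso_of_linear \<A> A \<nu>)
        {Ds \<in> vertically_trivial_connections \<A> A. homothety_invariant \<A> A Ds}
        {D \<in> aniso_connections \<A> A. homogeneous_aniso \<A> A D}"
  proof (rule bij_betw_subset[OF bij])
    have im: "aniso_connections \<A> A = aniso_of_linear \<A> A \<nu> ` vertically_trivial_connections \<A> A"
      using bij unfolding bij_betw_def by simp
    show "aniso_of_linear \<A> A \<nu> ` {Ds \<in> vertically_trivial_connections \<A> A. homothety_invariant \<A> A Ds} =
        {D \<in> aniso_connections \<A> A. homogeneous_aniso \<A> A D}"
      unfolding im using hom by blast
  qed blast
  \<comment> \<open>Both sides are the unique partner of \<open>Ds\<close> under
    \<open>corresponds\<close>, a relation in which no nonlinear connection occurs.\<close>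
  moreover have "aniso_of_linear \<A> A \<nu>' Ds = aniso_of_linear \<A> A \<nu> Ds"
    if "Ds \<in> vertically_trivial_connections \<A> A" for \<nu>' Ds
    using ex1_corresponding_aniso[OF that] aniso_of_linear(2,3)[OF that] by blast
  ultimately show ?thesis
    using aniso_of_linear(1) bij hom by blast
qed

end
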